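(* Let $(M,\prec)$ be an ordered simple matroid on $[n]$. Assume that the minimal broken circuits of $M$ (with respect to $\prec$) are pairwise disjoint. Then the Poincaré polynomial of the Orlik-Solomon algebra $\mathbf{A}(M)$ of $M$ over a field $K$ is $$\pi(\mathbf{A}(M),t)=(t+1)^{n-\sum_{i=1}^hq_i}\prod_{i=1}^h\big((t+1)^{q_i}-t^{q_i}\big),$$ where $q_1,\ldots,q_h$ are the sizes of the minimal broken circuits. Moreover, the following conditions are equivalent: (i) $\pi(\mathbf{A}(M),t)$ factors completely (into linear factors) over $\mathbb{Z}$; (ii) $q_i=2$ for all $i=1,\ldots,h$; (iii) $M$ is supersolvable; (iv) $\mathbf{A}(M)$ is Koszul.
   Context: $[n]=\{1,\ldots,n\}$. A circuit of a matroid is a minimal dependent set; a matroid is simple if every circuit has at least 3 elements. An ordered matroid $(M,\prec)$ is a matroid with a linear ordering $\prec$ of its ground set. The broken circuit of a circuit $C$ is $bc_\prec(C)=C-\{\min_\prec(C)\}$; minimal broken circuits are those minimal with respect to inclusion. Let $E=K\langle e_1,\ldots,e_n\rangle$ be the standard graded exterior algebra over $K$. For $T=\{i_1<\cdots<i_m\}\subseteq[n]$ put $e_T=e_{i_1}\cdots e_{i_m}$ and $\partial e_T=\sum_{t=1}^m(-1)^{t-1}e_{T-\{i_t\}}$. The Orlik-Solomon ideal $J(M)\subset E$ is generated by all $\partial e_T$ with $T$ a dependent set of $M$, and $\mathbf{A}(M)=E/J(M)$. If $M$ has rank $r$, then $\mathbf{A}(M)=\bigoplus_{p=0}^r\mathbf{A}_p(M)$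 and $\pi(\mathbf{A}(M),t)=\sum_{p=0}^r\dim_K\mathbf{A}_p(M)\,t^p$. $M$ is supersolvable if its lattice of flats has a maximal chain consisting of modular elements. A graded $K$-algebra $B$ that is a quotient of an exterior (or polynomial) algebra over $K$ by a graded ideal is Koszul if $K$ has a linear resolution over $B$. *)

theory Defs
  imports
    "HOL-Library.FuncSet"
    "HOL-Computational_Algebra.Polynomial"
    "HOL-Algebra.QuotRing"
    "HOL-Algebra.Embedded_Algebras"
begin

section \<open>Matroids\<close>

locale matroid =
  fixes ground :: "'a set" and indep :: "'a set \<Rightarrow> bool"
  assumes finite_ground: "finite ground"
    and indep_subset_ground: "indep I \<Longrightarrow> I \<subseteq> ground"
    and indep_empty: "indep {}"
    and indep_mono: "indep I \<Longrightarrow> I' \<subseteq> I \<Longrightarrow> indep I'"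
    and indep_augment:
      "indep I \<Longrightarrow> indep I' \<Longrightarrow> card I < card I' \<Longrightarrow> \<exists>x\<in>I' - I. indep (insert x I)"

definition dependent_set :: "'a set \<Rightarrow> ('a set \<Rightarrow> bool) \<Rightarrow> 'a set \<Rightarrow> bool" where
  "dependent_set ground indep T \<longleftrightarrow> T \<subseteq> ground \<and> \<not> indep T"

definition circuit :: "'a set \<Rightarrow> ('a set \<Rightarrow> bool) \<Rightarrow> 'a set \<Rightarrow> bool" where
  "circuit ground indep C \<longleftrightarrow>
     dependent_set ground indep C \<and> (\<forall>T. T \<subset> C \<longrightarrow> \<not> dependent_set ground indep T)"

definition simple_matroid :: "'a set \<Rightarrow> ('a set \<Rightarrow> bool) \<Rightarrow> bool" where
  "simple_matroid ground indep \<longleftrightarrow>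
     matroid ground indep \<and> (\<forall>C. circuit ground indep C \<longrightarrow> 3 \<le> card C)"

definition matroid_rank :: "('a set \<Rightarrow> bool) \<Rightarrow> 'a set \<Rightarrow> nat" where
  "matroid_rank indep X = Max (card ` {I. I \<subseteq> X \<and> indep I})"

definition matroid_closure :: "'a set \<Rightarrow> ('a set \<Rightarrow> bool) \<Rightarrow> 'a set \<Rightarrow> 'a set" where
  "matroid_closure ground indep X = {x \<in> ground. matroid_rank indep (insert x X) = matroid_rank indep X}"

definition flats :: "'a set \<Rightarrow> ('a set \<Rightarrow> bool) \<Rightarrow> 'a set set" where
  "flats ground indep = {F. F \<subseteq> ground \<and> matroid_closure ground indep F = F}"

text \<open>
  In the lattice of flats, ordered by inclusion, the meet of \<open>X\<close> and \<open>Y\<close> is \<open>X \<inter> Y\<close>, their join is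
  the closure of \<open>X \<union> Y\<close>, and the height of a flat is its rank.
\<close>

definition modular_flat :: "'a set \<Rightarrow> ('a set \<Rightarrow> bool) \<Rightarrow> 'a set \<Rightarrow> bool" where
  "modular_flat ground indep X \<longleftrightarrow> X \<in> flats ground indep \<and>
     (\<forall>Y \<in> flats ground indep.
        matroid_rank indep X + matroid_rank indep Y
          = matroid_rank indep (matroid_closure ground indep (X \<union> Y)) + matroid_rank indep (X \<inter> Y))"

definition supersolvable :: "'a set \<Rightarrow> ('a set \<Rightarrow> bool) \<Rightarrow> bool" where
  "supersolvable ground indep \<longleftrightarrow>
     (\<exists>\<C>. subset.maxchain (flats ground indep) \<C> \<and> (\<forall>X\<in>\<C>. modular_flat ground indep X))"


section \<open>Broken circuits\<close>

text \<open>\<open>prec\<close> is a reflexive linear order in the sense of \<^const>\<open>linear_order_on\<close>.\<close>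

definition min_wrt :: "'a rel \<Rightarrow> 'a set \<Rightarrow> 'a" where
  "min_wrt prec C = (THE m. m \<in> C \<and> (\<forall>x\<in>C. (m, x) \<in> prec))"

definition broken_circuits :: "'a set \<Rightarrow> ('a set \<Rightarrow> bool) \<Rightarrow> 'a rel \<Rightarrow> 'a set set" where
  "broken_circuits ground indep prec = {C - {min_wrt prec C} | C. circuit ground indep C}"

definition minimal_broken_circuits :: "'a set \<Rightarrow> ('a set \<Rightarrow> bool) \<Rightarrow> 'a rel \<Rightarrow> 'a set set" where
  "minimal_broken_circuits ground indep prec =
     {B \<in> broken_circuits ground indep prec. \<not> (\<exists>B' \<in> broken_circuits ground indep prec. B' \<subset> B)}"


section \<open>The exterior algebra on \<open>n\<close> generators\<close>

text \<open>
  An element is represented by its coefficients with respect to the monomial basis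
  \<open>(e\<^sub>T)\<close>, where \<open>T\<close> ranges over the subsets of \<open>{1..n}\<close>.  For disjoint \<open>S\<close> and \<open>T\<close> we have
  \<open>e\<^sub>S e\<^sub>T = ext_sign S T e\<^bsub>S \<union> T\<^esub>\<close>; otherwise \<open>e\<^sub>S e\<^sub>T = 0\<close>.
\<close>

definition ext_sign :: "nat set \<Rightarrow> nat set \<Rightarrow> 'k::field" where
  "ext_sign S T = (- 1) ^ card {(i, j). i \<in> S \<and> j \<in> T \<and> j < i}"

definition ext_basis :: "nat set \<Rightarrow> nat set \<Rightarrow> 'k::field" where
  "ext_basis T = (\<lambda>U. if U = T then 1 else 0)"

definition ext_algebra :: "nat \<Rightarrow> (nat set \<Rightarrow> 'k::field) ring" where
  "ext_algebra n =
    \<lparr> carrier = {f. \<forall>U. \<not> U \<subseteq> {1..n} \<longrightarrow> f U = 0},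
      mult = (\<lambda>f g U. \<Sum>S\<in>Pow U. ext_sign S (U - S) * f S * g (U - S)),
      one = ext_basis {},
      zero = (\<lambda>U. 0),
      add = (\<lambda>f g U. f U + g U) \<rparr>"

definition ext_homogeneous :: "nat \<Rightarrow> nat \<Rightarrow> (nat set \<Rightarrow> 'k::field) set" where
  "ext_homogeneous n p = {f \<in> carrier (ext_algebra n). \<forall>U. card U \<noteq> p \<longrightarrow> f U = 0}"

definition ext_scalars :: "(nat set \<Rightarrow> 'k::field) set" where
  "ext_scalars = range (\<lambda>c U. c * ext_basis {} U)"

text \<open>If \<open>i = i\<^sub>t\<close> in \<open>T = {i\<^sub>1 < \<dots> < i\<^sub>m}\<close> then \<open>t - 1 = card {j \<in> T. j < i}\<close>.\<close>

definition ext_boundary :: "nat set \<Rightarrow> nat set \<Rightarrow> 'k::field" where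
  "ext_boundary T = (\<lambda>U. \<Sum>i\<in>T. (- 1) ^ card {j \<in> T. j < i} * ext_basis (T - {i}) U)"


section \<open>The Orlik-Solomon algebra of a matroid on \<open>{1..n}\<close>\<close>

definition OS_ideal :: "nat \<Rightarrow> (nat set \<Rightarrow> bool) \<Rightarrow> (nat set \<Rightarrow> 'k::field) set" where
  "OS_ideal n indep =
     genideal (ext_algebra n) {ext_boundary T | T. dependent_set {1..n} indep T}"

definition OS_algebra :: "nat \<Rightarrow> (nat set \<Rightarrow> bool) \<Rightarrow> (nat set \<Rightarrow> 'k::field) set ring" where
  "OS_algebra n indep = ext_algebra n Quot OS_ideal n indep"

definition OS_coset ::
    "nat \<Rightarrow> (nat set \<Rightarrow> bool) \<Rightarrow> (nat set \<Rightarrow> 'k::field) \<Rightarrow> (nat set \<Rightarrow> 'k) set" where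
  "OS_coset n indep f = OS_ideal n indep +>\<^bsub>ext_algebra n\<^esub> f"

definition OS_homogeneous ::
    "nat \<Rightarrow> (nat set \<Rightarrow> bool) \<Rightarrow> nat \<Rightarrow> (nat set \<Rightarrow> 'k::field) set set" where
  "OS_homogeneous n indep p = OS_coset n indep ` ext_homogeneous n p"

text \<open>The image of the field of scalars in the quotient algebra.\<close>

definition OS_scalars :: "nat \<Rightarrow> (nat set \<Rightarrow> bool) \<Rightarrow> (nat set \<Rightarrow> 'k::field) set set" where
  "OS_scalars n indep = OS_coset n indep ` ext_scalars"

definition OS_poincare :: "'k::field itself \<Rightarrow> nat \<Rightarrow> (nat set \<Rightarrow> bool) \<Rightarrow> int poly" where
  "OS_poincare K n indep =
     (\<Sum>p\<le>matroid_rank indep {1..n}.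
        Polynomial.monom (int (ring.dim (OS_algebra n indep :: (nat set \<Rightarrow> 'k) set ring)
                      (OS_scalars n indep) (OS_homogeneous n indep p))) p)"

definition factors_completely :: "int poly \<Rightarrow> bool" where
  "factors_completely f \<longleftrightarrow>
     (\<exists>c ls. (\<forall>l\<in>set ls. Polynomial.degree l = 1) \<and> f = [:c:] * prod_list ls)"


section \<open>Koszul algebras\<close>

text \<open>
  \<open>B\<close> is a ring, graded by \<open>G p\<close> (\<open>p \<ge> 0\<close>), not necessarily commutative.  Modules are left modules:
  the free module of rank \<open>b\<close> consists of row vectors, and homomorphisms between free modules
  multiply rows by matrices from the right.
\<close>

definition free_module :: "('a, 'm) ring_scheme \<Rightarrow> nat \<Rightarrow> (nat \<Rightarrow> 'a) set" where
  "free_module B b = {..<b} \<rightarrow>\<^sub>E carrier B"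

definition mat_apply ::
    "('a, 'm) ring_scheme \<Rightarrow> nat \<Rightarrow> nat \<Rightarrow> (nat \<Rightarrow> nat \<Rightarrow> 'a) \<Rightarrow> (nat \<Rightarrow> 'a) \<Rightarrow> nat \<Rightarrow> 'a" where
  "mat_apply B b c D v = (\<lambda>k\<in>{..<c}. \<Oplus>\<^bsub>B\<^esub>j\<in>{..<b}. v j \<otimes>\<^bsub>B\<^esub> D j k)"

definition mat_image ::
    "('a, 'm) ring_scheme \<Rightarrow> nat \<Rightarrow> nat \<Rightarrow> (nat \<Rightarrow> nat \<Rightarrow> 'a) \<Rightarrow> (nat \<Rightarrow> 'a) set" where
  "mat_image B b c D = mat_apply B b c D ` free_module B b"

definition mat_kernel ::
    "('a, 'm) ring_scheme \<Rightarrow> nat \<Rightarrow> nat \<Rightarrow> (nat \<Rightarrow> nat \<Rightarrow> 'a) \<Rightarrow> (nat \<Rightarrow> 'a) set" where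
  "mat_kernel B b c D =
     {v \<in> free_module B b. mat_apply B b c D v = (\<lambda>k\<in>{..<c}. \<zero>\<^bsub>B\<^esub>)}"

text \<open>The ideal \<open>\<Oplus>\<^bsub>p \<ge> 1\<^esub> G p\<close>; the residue field \<open>K\<close> is the quotient of \<open>B\<close> by it.\<close>

definition irrelevant_ideal :: "('a, 'm) ring_scheme \<Rightarrow> (nat \<Rightarrow> 'a set) \<Rightarrow> 'a set" where
  "irrelevant_ideal B G = {finsum B x {1..m} | m x. \<forall>p\<in>{1..m}. x p \<in> G p}"

text \<open>
  A linear resolution of \<open>K\<close> is an exact sequence
  \<open>\<dots> \<rightarrow> B(-2)\<^bsup>b 2\<^esup> \<rightarrow> B(-1)\<^bsup>b 1\<^esup> \<rightarrow> B \<rightarrow> K \<rightarrow> 0\<close> of graded modules, the last map being the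
  canonical projection.  The map \<open>B(-(i+1))\<^bsup>b (i+1)\<^esup> \<rightarrow> B(-i)\<^bsup>b i\<^esup>\<close> is given by the matrix \<open>d i\<close>;
  it is homogeneous of degree 0 precisely if the matrix entries have degree 1.
\<close>

definition linear_resolution ::
    "('a, 'm) ring_scheme \<Rightarrow> (nat \<Rightarrow> 'a set) \<Rightarrow> (nat \<Rightarrow> nat) \<Rightarrow> (nat \<Rightarrow> nat \<Rightarrow> nat \<Rightarrow> 'a) \<Rightarrow> bool"
  where
  "linear_resolution B G b d \<longleftrightarrow>
     b 0 = 1 \<and>
     (\<forall>i. \<forall>j<b (Suc i). \<forall>k<b i. d i j k \<in> G 1) \<and>
     mat_image B (b 1) (b 0) (d 0) = {v \<in> free_module B (b 0). v 0 \<in> irrelevant_ideal B G} \<and>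
     (\<forall>i. mat_image B (b (Suc (Suc i))) (b (Suc i)) (d (Suc i))
            = mat_kernel B (b (Suc i)) (b i) (d i))"

definition koszul :: "('a, 'm) ring_scheme \<Rightarrow> (nat \<Rightarrow> 'a set) \<Rightarrow> bool" where
  "koszul B G \<longleftrightarrow> (\<exists>b d. linear_resolution B G b d)"

end

theory Submission
  imports Defs Complex_Main
begin

text \<open>
  The monomials \<open>e\<^sub>T\<close> with \<open>T\<close> containing no broken circuit form a basis of the Orlik-Solomon
  algebra. They span because the relation of a circuit rewrites its broken circuit into smaller
  monomials. They are independent because any map \<open>l\<close> of the ground set that is not injective on any
  circuit induces a homomorphism \<open>e\<^sub>i \<mapsto> e\<^bsub>l i\<^esub>\<close> that kills the Orlik-Solomon ideal, and the flag of
  flats spanned by the largest elements of \<open>T\<close> yields such a map that detects \<open>e\<^sub>T\<close>. When the minimal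
  broken circuits \<open>Q\<close> are disjoint, counting basis monomials gives the Poincare polynomial, and
  \<open>(t + 1)\<^sup>q - t\<^sup>q\<close> has a non-real root if \<open>q \<ge> 3\<close>.

  If some \<open>Q\<close> has at least 3 elements, the map that is injective on \<open>Q\<close> and collapses everything else
  collides on every 3-element circuit but not on the circuit that breaks to \<open>Q\<close>. In the
  supersolvable case a collision on all 3-element circuits propagates to all circuits, by trading
  elements along the modular chain; in the Koszul case the ideal is generated by quadrics, hence by
  the relations of the 3-element circuits. Both are contradictions.

  If all \<open>Q\<close> have 2 elements, they and the remaining points are the fibres of a function whose sublevel
  sets form a chain of modular flats, and the ideals generated by the variables in these flats form a
  Koszul filtration.
\<close>

section \<open>Matroids\<close>

text \<open>Two devices carry the algebra, over any field: rewriting modulo the ideal and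
  substitution of generators. If \<open>x\<close> and \<open>y\<close> get the same image, the
  boundary of any set containing both goes to 0, so a map that is injective on no circuit descends
  to \<open>A\<close>. Points that are to be merged away from the ground set need a spare target,
  which is \<open>n + 1\<close>. Disjointness enters three times: it makes the count of basis
  monomials a product, it forces the two-element broken circuit of a 3-element circuit to miss a
  larger \<open>Q\<close>, so that two of its points are merged, and it makes the two-element sets
  \<open>Q\<close> fibres of a function. The obstacle in the Koszul direction is that
  \<open>prec\<close> need not run fibre by fibre, whereas the colon ideals are computed with levels
  that are initial segments. The basis theorem is therefore proved for an arbitrary injective weight
  and used with two of them. The colon by \<open>e_x\<close> of the ideal of all variables lighter
  than \<open>x\<close> is the ideal of the variables in all fibres up to that of \<open>x\<close>;
  so the family of levels is closed under colons, which is what a Koszul filtration demands.\<close>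

lemma obtain_max:
  fixes f :: "'a \<Rightarrow> nat"
  assumes "finite S" "S \<noteq> {}"
  obtains x where "x \<in> S" "\<forall>y\<in>S. f y \<le> f x"
proof -
  have "Max (f ` S) \<in> f ` S" using assms by (intro Max_in) auto
  then obtain x where "x \<in> S" "f x = Max (f ` S)" by fastforce
  then show ?thesis using that[of x] assms by simp
qed

lemma obtain_min:
  fixes f :: "'a \<Rightarrow> nat"
  assumes "finite S" "S \<noteq> {}"
  obtains x where "x \<in> S" "\<forall>y\<in>S. f x \<le> f y"
proof -
  have "Min (f ` S) \<in> f ` S" using assms by (intro Min_in) auto
  then obtain x where "x \<in> S" "f x = Min (f ` S)" by fastforce
  then show ?thesis using that[of x] assms by simp
qed

context matroid
begin

abbreviation rk :: "'a set \<Rightarrow> nat" where "rk \<equiv> matroid_rank indep"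
abbreviation cl :: "'a set \<Rightarrow> 'a set" where "cl \<equiv> matroid_closure ground indep"
abbreviation circ :: "'a set \<Rightarrow> bool" where "circ \<equiv> circuit ground indep"

lemma finite_if_ground: "X \<subseteq> ground \<Longrightarrow> finite X"
  by (rule finite_subset[OF _ finite_ground])

lemma indep_finite: "indep I \<Longrightarrow> finite I"
  by (simp add: finite_if_ground indep_subset_ground)

lemma finite_indep_cards: "finite (card ` {I. I \<subseteq> X \<and> indep I})"
proof -
  have "{I. I \<subseteq> X \<and> indep I} \<subseteq> Pow ground" using indep_subset_ground by blast
  then show ?thesis using finite_ground finite_subset by blast
qed

lemma rank_ge: "I \<subseteq> X \<Longrightarrow> indep I \<Longrightarrow> card I \<le> rk X"
  unfolding matroid_rank_def by (rule Max_ge[OF finite_indep_cards]) auto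

lemma obtain_basis: obtains I where "I \<subseteq> X" "indep I" "card I = rk X"
proof -
  have "rk X \<in> card ` {I. I \<subseteq> X \<and> indep I}"
    unfolding matroid_rank_def by (rule Max_in[OF finite_indep_cards]) (use indep_empty in auto)
  then show ?thesis using that by auto
qed

lemma rank_mono: assumes "X \<subseteq> Y" shows "rk X \<le> rk Y"
proof -
  obtain I where "I \<subseteq> X" "indep I" "card I = rk X" by (rule obtain_basis)
  then show ?thesis using rank_ge[of I Y] assms by auto
qed

lemma rank_insert_ge: "rk X \<le> rk (insert x X)"
  by (rule rank_mono) auto

lemma rank_le_card: assumes "finite X" shows "rk X \<le> card X"
proof -
  obtain I where "I \<subseteq> X" "indep I" "card I = rk X" by (rule obtain_basis)
  then show ?thesis using card_mono[OF assms, of I] by simp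
qed

lemma rank_indep: "indep I \<Longrightarrow> rk I = card I"
  by (simp add: rank_ge rank_le_card indep_finite le_antisym)

lemma indep_iff_rank: "X \<subseteq> ground \<Longrightarrow> indep X \<longleftrightarrow> rk X = card X"
proof
  assume X: "X \<subseteq> ground" "rk X = card X"
  obtain I where I: "I \<subseteq> X" "indep I" "card I = rk X" by (rule obtain_basis)
  have "finite X" using X finite_if_ground by simp
  then have "I = X" using I X by (intro card_subset_eq) auto
  then show "indep X" using I by simp
qed (rule rank_indep)

lemma obtain_basis_extending:
  assumes "indep I" "I \<subseteq> X"
  obtains J where "I \<subseteq> J" "J \<subseteq> X" "indep J" "card J = rk X"
proof -
  have "\<exists>J. I \<subseteq> J \<and> J \<subseteq> X \<and> indep J \<and> card J = rk X"
    using assms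
  proof (induction "rk X - card I" arbitrary: I)
    case 0
    then have "card I = rk X" using rank_ge[of I X] by simp
    then show ?case using 0 by blast
  next
    case (Suc k)
    obtain B where B: "B \<subseteq> X" "indep B" "card B = rk X" by (rule obtain_basis)
    obtain x where x: "x \<in> B - I" "indep (insert x I)"
      using indep_augment[OF Suc.prems(1) B(2)] Suc.hyps(2) B(3) by fastforce
    have "card (insert x I) = Suc (card I)" using x Suc.prems(1) indep_finite by simp
    then have "k = rk X - card (insert x I)" using Suc.hyps(2) by simp
    from Suc.hyps(1)[OF this x(2)] show ?case using x(1) B(1) Suc.prems(2) by blast
  qed
  then show ?thesis using that by blast
qed

text \<open>A basis of the intersection is extended to one of the union, whose traces on
  \<open>X\<close> and \<open>Y\<close> are independent and have the first basis in common.\<close>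

lemma rank_submodular: "rk (X \<union> Y) + rk (X \<inter> Y) \<le> rk X + rk Y"
proof -
  obtain I where I: "I \<subseteq> X \<inter> Y" "indep I" "card I = rk (X \<inter> Y)" by (rule obtain_basis)
  obtain J where J: "I \<subseteq> J" "J \<subseteq> X \<union> Y" "indep J" "card J = rk (X \<union> Y)"
    using obtain_basis_extending[OF I(2), of "X \<union> Y"] I(1) by blast
  have fin: "finite J" using J(3) indep_finite by simp
  have "card J + card I \<le> card ((J \<inter> X) \<union> (J \<inter> Y)) + card ((J \<inter> X) \<inter> (J \<inter> Y))"
    by (intro add_mono card_mono) (use fin I(1) J(1,2) in auto)
  also have "\<dots> = card (J \<inter> X) + card (J \<inter> Y)"
    by (rule card_Un_Int[symmetric]) (use fin in auto)
  also have "\<dots> \<le> rk X + rk Y"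
    by (intro add_mono rank_ge indep_mono[OF J(3)]) auto
  finally show ?thesis using I(3) J(4) by simp
qed

lemma closure_iff: "x \<in> cl X \<longleftrightarrow> x \<in> ground \<and> rk (insert x X) = rk X"
  by (simp add: matroid_closure_def)

lemma closure_subset_ground: "cl X \<subseteq> ground"
  by (auto simp: closure_iff)

lemma subset_closure: "X \<subseteq> ground \<Longrightarrow> X \<subseteq> cl X"
  by (auto simp: closure_iff insert_absorb)

lemma closure_mono:
  assumes "X \<subseteq> Y" shows "cl X \<subseteq> cl Y"
proof
  fix x assume "x \<in> cl X"
  then have x: "x \<in> ground" "rk (insert x X) = rk X" by (auto simp: closure_iff)
  have "rk (insert x X \<union> Y) + rk (insert x X \<inter> Y) \<le> rk (insert x X) + rk Y"
    by (rule rank_submodular)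
  moreover have "insert x X \<union> Y = insert x Y" using assms by auto
  moreover have "rk X \<le> rk (insert x X \<inter> Y)" using assms by (intro rank_mono) auto
  ultimately have "rk (insert x Y) \<le> rk Y" using x(2) by simp
  then show "x \<in> cl Y" using x(1) rank_insert_ge[of Y x] by (simp add: closure_iff)
qed

lemma rank_Un_closure: "A \<subseteq> cl X \<Longrightarrow> rk (X \<union> A) = rk X"
proof -
  assume A: "A \<subseteq> cl X"
  then have "finite A" using closure_subset_ground[of X] by (intro finite_if_ground) auto
  then show ?thesis using A
  proof (induction A)
    case (insert a A)
    have "a \<in> cl (X \<union> A)" using insert.prems closure_mono[of X "X \<union> A"] by auto
    then show ?case using insert by (simp add: closure_iff)
  qed simp
qed

lemma rank_closure: "X \<subseteq> ground \<Longrightarrow> rk (cl X) = rk X"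
  using rank_Un_closure[of "cl X" X] subset_closure[of X] by (simp add: Un_absorb1)

lemma closure_idem: "X \<subseteq> ground \<Longrightarrow> cl (cl X) = cl X"
proof
  assume X: "X \<subseteq> ground"
  show "cl (cl X) \<subseteq> cl X"
  proof
    fix x assume x: "x \<in> cl (cl X)"
    then have "rk (insert x (cl X)) = rk X" using rank_closure[OF X] by (simp add: closure_iff)
    moreover have "rk (insert x X) \<le> rk (insert x (cl X))"
      using subset_closure[OF X] by (intro rank_mono) auto
    ultimately have "rk (insert x X) = rk X" using rank_insert_ge[of X x] by simp
    then show "x \<in> cl X" using x by (simp add: closure_iff)
  qed
  show "cl X \<subseteq> cl (cl X)" by (rule subset_closure[OF closure_subset_ground])
qed

lemma closure_flat: "X \<subseteq> ground \<Longrightarrow> cl X \<in> flats ground indep"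
  by (simp add: flats_def closure_subset_ground closure_idem)

lemma flat_subset: "X \<in> flats ground indep \<Longrightarrow> X \<subseteq> ground"
  by (simp add: flats_def)

lemma flat_closure_subset: "X \<in> flats ground indep \<Longrightarrow> A \<subseteq> X \<Longrightarrow> cl A \<subseteq> X"
  using closure_mono[of A X] by (simp add: flats_def)

lemma flat_eqI:
  assumes "X \<in> flats ground indep" "Y \<subseteq> ground" "X \<subseteq> Y" "rk X = rk Y"
  shows "X = Y"
proof -
  have "Y \<subseteq> cl X"
  proof
    fix y assume "y \<in> Y"
    then have "rk (insert y X) \<le> rk Y" using assms(3) by (intro rank_mono) auto
    then show "y \<in> cl X" using assms \<open>y \<in> Y\<close> rank_insert_ge[of X y]
      by (simp add: closure_iff subset_iff)
  qed
  then show ?thesis using assms by (auto simp: flats_def)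
qed

lemma closure_indep_iff:
  assumes "indep I" "x \<in> ground" "x \<notin> I"
  shows "x \<in> cl I \<longleftrightarrow> \<not> indep (insert x I)"
proof -
  have I: "I \<subseteq> ground" "finite I" using assms indep_subset_ground indep_finite by auto
  have "rk I \<le> rk (insert x I)" "rk (insert x I) \<le> Suc (card I)"
    using rank_insert_ge[of I x] rank_le_card[of "insert x I"] I assms by auto
  then show ?thesis
    using I assms indep_iff_rank[of "insert x I"] rank_indep[of I] by (auto simp: closure_iff)
qed

lemma rank_insert_le: "rk (insert x X) \<le> Suc (rk X)"
proof -
  have "rk ({x} \<union> X) + rk ({x} \<inter> X) \<le> rk {x} + rk X" by (rule rank_submodular)
  moreover have "rk {x} \<le> 1" using rank_le_card[of "{x}"] by simp
  ultimately show ?thesis by simp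
qed

lemma circuit_ground: "circ C \<Longrightarrow> C \<subseteq> ground"
  by (simp add: circuit_def dependent_set_def)

lemma circuit_not_indep: "circ C \<Longrightarrow> \<not> indep C"
  by (simp add: circuit_def dependent_set_def)

lemma circuit_psubset_indep: "circ C \<Longrightarrow> T \<subset> C \<Longrightarrow> indep T"
  unfolding circuit_def dependent_set_def by blast

lemma circuit_minus_indep: "circ C \<Longrightarrow> x \<in> C \<Longrightarrow> indep (C - {x})"
  by (rule circuit_psubset_indep) auto

lemma circuit_finite: "circ C \<Longrightarrow> finite C"
  by (simp add: finite_if_ground circuit_ground)

lemma circuit_subset_eq: "circ C \<Longrightarrow> circ D \<Longrightarrow> C \<subseteq> D \<Longrightarrow> C = D"
  using circuit_not_indep circuit_psubset_indep by blast

lemma obtain_circuit: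
  assumes "T \<subseteq> ground" "\<not> indep T"
  obtains C where "circ C" "C \<subseteq> T"
proof -
  have "finite T" using assms finite_if_ground by simp
  then have "\<exists>C. circ C \<and> C \<subseteq> T" using assms
  proof (induction T rule: finite_psubset_induct)
    case (psubset T)
    show ?case
    proof (cases "circ T")
      case False
      then obtain T' where "T' \<subset> T" "T' \<subseteq> ground" "\<not> indep T'"
        using psubset.prems by (auto simp: circuit_def dependent_set_def)
      then show ?thesis using psubset.IH by (meson psubset_imp_subset subset_trans)
    qed blast
  qed
  then show ?thesis using that by blast
qed

lemma circuit_in_closure:
  assumes "circ C" "x \<in> C" shows "x \<in> cl (C - {x})"
proof -
  have "indep (C - {x})" using assms by (rule circuit_minus_indep)
  then show ?thesis
    using closure_indep_iff[of "C - {x}" x] assms circuit_ground[of C] circuit_not_indep[of C]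
    by (auto simp: insert_absorb)
qed

lemma rank_circuit:
  assumes "circ C" shows "Suc (rk C) = card C"
proof -
  obtain x where x: "x \<in> C" using circuit_not_indep[OF assms] indep_empty by fastforce
  have "rk C = rk (C - {x})"
    using circuit_in_closure[OF assms x] x by (simp add: closure_iff insert_absorb)
  also have "\<dots> = card (C - {x})" by (rule rank_indep[OF circuit_minus_indep[OF assms x]])
  also have "Suc \<dots> = card C" using x circuit_finite[OF assms] by (meson card_Suc_Diff1)
  finally show ?thesis .
qed

text \<open>Were the rest independent, the union would have rank at least its size minus 1.
  Submodularity, applied with the independent intersection, bounds the rank by its size minus
  2.\<close>

lemma circuit_elimination:
  assumes "circ C" "circ D" "C \<noteq> D" "y \<in> C \<inter> D"
  obtains B where "circ B" "B \<subseteq> (C \<union> D) - {y}"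
proof -
  have fin: "finite C" "finite D" using assms circuit_finite by auto
  have "\<not> indep ((C \<union> D) - {y})"
  proof
    assume ind: "indep ((C \<union> D) - {y})"
    have "indep (C \<inter> D)"
      using assms circuit_psubset_indep[of C] circuit_subset_eq[of C D] by blast
    then have "rk (C \<union> D) + card (C \<inter> D) \<le> rk C + rk D"
      using rank_submodular[of C D] by (simp add: rank_indep)
    moreover have "Suc (rk C) = card C" "Suc (rk D) = card D" using assms rank_circuit by auto
    moreover have "card C + card D = card (C \<union> D) + card (C \<inter> D)"
      by (rule card_Un_Int[OF fin])
    moreover have "card ((C \<union> D) - {y}) \<le> rk (C \<union> D)" by (rule rank_ge[OF _ ind]) auto
    moreover have "Suc (card ((C \<union> D) - {y})) = card (C \<union> D)"
      using assms(4) fin by (intro card_Suc_Diff1) auto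
    ultimately show False by linarith
  qed
  then show ?thesis using that obtain_circuit[of "(C \<union> D) - {y}"] assms circuit_ground by blast
qed

end

section \<open>Simple matroids and modular chains of flats\<close>

locale simple_matroid_locale = matroid +
  assumes circuit_card: "circuit ground indep C \<Longrightarrow> 3 \<le> card C"
begin

lemma indep_small:
  assumes "X \<subseteq> ground" "card X \<le> 2" shows "indep X"
proof (rule ccontr)
  assume "\<not> indep X"
  then obtain C where "circ C" "C \<subseteq> X" using assms obtain_circuit by blast
  then show False using circuit_card[of C] assms card_mono[of X C] finite_if_ground[of X] by simp
qed

lemma circuit_of_line:
  assumes "x \<in> ground" "y \<in> ground" "x \<noteq> y" "z \<in> cl {x, y}" "z \<noteq> x" "z \<noteq> y"
  shows "circ {x, y, z}"
proof -
  have ind: "indep {x, y}" using assms by (intro indep_small) auto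
  have z: "z \<in> ground" using assms closure_subset_ground by blast
  have "\<not> indep {x, y, z}"
    using closure_indep_iff[OF ind z] assms by (simp add: insert_commute)
  moreover have "indep T" if "T \<subset> {x, y, z}" for T
  proof (rule indep_small)
    show "T \<subseteq> ground" using that assms z by auto
    have "card T < card {x, y, z}" using that by (intro psubset_card_mono) auto
    then show "card T \<le> 2" using assms by simp
  qed
  ultimately show ?thesis using assms z by (auto simp: circuit_def dependent_set_def)
qed

text \<open>\<open>lev x\<close> is the rank of the first flat of a modular maximal chain that contains \<open>x\<close>. By
  modularity the line through two points of the same level meets the preceding flat.\<close>

lemma supersolvable_line_meets:
  assumes ss: "supersolvable ground indep"
  obtains lev :: "'a \<Rightarrow> nat" where
    "\<And>x y. x \<in> ground \<Longrightarrow> y \<in> ground \<Longrightarrow> x \<noteq> y \<Longrightarrow> lev x = lev y \<Longrightarrow> \<exists>z. lev z < lev x \<and> circ {x, y, z}"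
    "\<And>C. circ C \<Longrightarrow> \<exists>x\<in>C. \<exists>y\<in>C. x \<noteq> y \<and> lev x = lev y \<and> (\<forall>u\<in>C. lev u \<le> lev x)"
proof -
  obtain CC where mc: "subset.maxchain (flats ground indep) CC"
    and mod: "\<And>X. X \<in> CC \<Longrightarrow> modular_flat ground indep X"
    using ss by (auto simp: supersolvable_def)
  have CCf: "CC \<subseteq> flats ground indep" and chain: "\<And>X Y. X \<in> CC \<Longrightarrow> Y \<in> CC \<Longrightarrow> X \<subseteq> Y \<or> Y \<subseteq> X"
    using subset.maxchain_imp_chain[OF mc] by (auto simp: subset_chain_def)
  have maxi: "Z \<in> CC" if "Z \<in> flats ground indep" "\<And>V. V \<in> CC \<Longrightarrow> V \<subseteq> Z \<or> Z \<subseteq> V" for Z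
  proof (rule ccontr)
    assume "Z \<notin> CC"
    moreover have "subset.chain (flats ground indep) (insert Z CC)"
      using that CCf chain by (auto simp: subset_chain_def)
    ultimately show False using mc by (auto simp: subset.maxchain_def)
  qed
  have gr: "ground \<in> CC"
  proof (rule maxi)
    show "ground \<in> flats ground indep"
      unfolding flats_def using closure_subset_ground[of ground] subset_closure[of ground] by blast
    show "V \<subseteq> ground \<or> ground \<subseteq> V" if "V \<in> CC" for V
      using that CCf flat_subset by blast
  qed
  have em: "{} \<in> CC"
  proof (rule maxi)
    have "x \<notin> cl {}" for x
      using closure_indep_iff[OF indep_empty, of x] indep_small[of "{x}"] closure_subset_ground[of "{}"]
      by (cases "x \<in> ground") auto
    then show "{} \<in> flats ground indep" by (auto simp: flats_def)
  qed auto
  have finF: "finite (flats ground indep)"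
    by (rule finite_subset[of _ "Pow ground"]) (use finite_ground in \<open>auto simp: flats_def\<close>)
  then have finCC: "finite CC" by (rule finite_subset[OF CCf])
  define lev where "lev x = Min (rk ` {X \<in> CC. x \<in> X})" for x
  have lev_ex: "\<exists>X\<in>CC. x \<in> X \<and> rk X = lev x" if "x \<in> ground" for x
  proof -
    have "lev x \<in> rk ` {X \<in> CC. x \<in> X}"
      unfolding lev_def by (rule Min_in) (use finCC gr that in auto)
    then show ?thesis by auto
  qed
  have lev_le: "lev x \<le> rk X" if "X \<in> CC" "x \<in> X" for x X
    unfolding lev_def by (rule Min_le) (use finCC that in auto)
  have mem_of_lev: "x \<in> X" if mem: "x \<in> ground" "X \<in> CC" "lev x \<le> rk X" for x X
  proof -
    obtain Y where Y: "Y \<in> CC" "x \<in> Y" "rk Y = lev x" using lev_ex[OF mem(1)] by blast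
    show ?thesis
    proof (cases "Y \<subseteq> X")
      case False
      then have "X \<subseteq> Y" using chain Y that by blast
      then have "rk X = rk Y" using rank_mono[of X Y] Y that by auto
      then have "X = Y" using flat_eqI[of X Y] \<open>X \<subseteq> Y\<close> CCf Y that flat_subset by blast
      then show ?thesis using Y by blast
    qed (use Y in blast)
  qed
  \<comment> \<open>\<open>W\<close> is the largest member of the chain strictly inside the first
    member \<open>X\<close> that contains \<open>x\<close>. The closure of \<open>W\<close> and
    \<open>x\<close> is comparable with every member, so by maximality it belongs to the chain and
    equals \<open>X\<close>; hence the rank drops by only 1.\<close>
  have prev: "\<exists>W\<in>CC. rk W < lev x \<and> lev x \<le> Suc (rk W) \<and> (\<forall>u\<in>ground. lev u < lev x \<longrightarrow> u \<in> W)"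
    if xg: "x \<in> ground" for x
  proof -
    obtain X where X: "X \<in> CC" "x \<in> X" "rk X = lev x" using lev_ex xg by blast
    let ?P = "{W \<in> CC. W \<subset> X}"
    have finP: "finite ?P" "?P \<noteq> {}" using finCC em X by auto
    obtain W where W: "W \<in> ?P" and Wmax0: "\<forall>V\<in>?P. W \<subseteq> V \<longrightarrow> W = V"
      using finite_has_maximal[OF finP] by (elim bexE)
    have Wmax: "W = V" if "V \<in> ?P" "W \<subseteq> V" for V using Wmax0 that by blast
    have Wf: "W \<in> flats ground indep" "W \<subseteq> ground" and Xf: "X \<in> flats ground indep" "X \<subseteq> ground"
      using W X CCf flat_subset by auto
    have rW: "rk W < rk X"
    proof -
      have "W \<subseteq> X" "W \<noteq> X" using W by auto
      then show ?thesis using flat_eqI[OF Wf(1) Xf(2)] rank_mono[of W X] by fastforce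
    qed
    have xW: "x \<notin> W" using lev_le[of W x] W rW X(3) by auto
    have below: "V \<subseteq> W" if "V \<in> CC" "V \<subset> X" for V
    proof -
      have "V \<subseteq> W \<or> W \<subseteq> V" using chain that W by blast
      moreover have "W = V" if "W \<subseteq> V" using Wmax[of V] that \<open>V \<in> CC\<close> \<open>V \<subset> X\<close> by blast
      ultimately show ?thesis by blast
    qed
    let ?Z = "cl (insert x W)"
    have ixW: "insert x W \<subseteq> X" using X W by auto
    have ZX: "?Z \<subseteq> X" using flat_closure_subset[OF Xf(1) ixW] .
    have sub: "insert x W \<subseteq> ?Z" using ixW Xf by (intro subset_closure) auto
    have Zf: "?Z \<in> flats ground indep" using ixW Xf by (intro closure_flat) auto
    have "?Z \<in> CC"
    proof (rule maxi[OF Zf])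
      fix V assume V: "V \<in> CC"
      show "V \<subseteq> ?Z \<or> ?Z \<subseteq> V"
      proof (cases "X \<subseteq> V")
        case False
        then have "V \<subset> X" using chain[OF V X(1)] by blast
        then show ?thesis using below[OF V] sub by blast
      qed (use ZX in blast)
    qed
    then have ZX': "?Z = X" using below[of ?Z] ZX sub xW by blast
    have "insert x W \<subseteq> ground" using ixW Xf(2) by (rule subset_trans)
    then have "rk ?Z \<le> Suc (rk W)"
      using rank_insert_le[of x W] by (simp only: rank_closure)
    then have "rk X \<le> Suc (rk W)" unfolding ZX' .
    moreover have "u \<in> W" if u: "u \<in> ground" "lev u < lev x" for u
    proof -
      obtain V where V: "V \<in> CC" "u \<in> V" "rk V = lev u" using lev_ex[OF u(1)] by blast
      then have "rk V < rk X" using u X by simp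
      then have "V \<subset> X" using chain[OF V(1) X(1)] rank_mono[of X V] by fastforce
      then show ?thesis using below V by blast
    qed
    ultimately show ?thesis using W rW X(3) by auto
  qed
  show ?thesis
  proof (rule that[of lev])
    fix x y assume x: "x \<in> ground" and y: "y \<in> ground" and xy: "x \<noteq> y" and l: "lev x = lev y"
    obtain W where W: "W \<in> CC" "rk W < lev x" "lev x \<le> Suc (rk W)" using prev[OF x] by blast
    obtain X where X: "X \<in> CC" "x \<in> X" "rk X = lev x" using lev_ex x by blast
    have yX: "y \<in> X" using mem_of_lev[OF y X(1)] l X(3) by simp
    have Xf: "X \<in> flats ground indep" "X \<subseteq> ground" using X CCf flat_subset by auto
    have xyW: "x \<notin> W" "y \<notin> W" using lev_le[OF W(1)] W(2) l by fastforce+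
    have WX: "W \<subseteq> X" using chain[OF W(1) X(1)] rank_mono[of X W] W(2) X(3) by fastforce
    let ?Y = "cl {x, y}"
    have Yf: "?Y \<in> flats ground indep" using x y by (intro closure_flat) auto
    have "rk ?Y = 2" using rank_closure[of "{x,y}"] x y xy rank_indep[OF indep_small[of "{x,y}"]] by auto
    moreover have "rk W + rk ?Y = rk (cl (W \<union> ?Y)) + rk (W \<inter> ?Y)"
      using mod[OF W(1)] Yf by (simp add: modular_flat_def)
    moreover have "cl (W \<union> ?Y) \<subseteq> X"
      by (intro flat_closure_subset[OF Xf(1)] Un_least WX) (use X yX Xf in auto)
    then have "rk (cl (W \<union> ?Y)) \<le> Suc (rk W)"
      using rank_mono[of "cl (W \<union> ?Y)" X] X(3) W(3) by linarith
    \<comment> \<open>The line has rank 2 and its join with \<open>W\<close> has rank at most one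
      more than \<open>W\<close>, so the modular equation leaves at least 1 for the meet.\<close>
    ultimately have "rk (W \<inter> ?Y) \<ge> 1" by linarith
    then have "W \<inter> ?Y \<noteq> {}" using rank_indep[OF indep_empty] by auto
    then obtain z where z: "z \<in> W" "z \<in> ?Y" by blast
    have "circ {x, y, z}" using circuit_of_line[OF x y xy z(2)] z(1) xyW by blast
    moreover have "lev z < lev x" using lev_le[OF W(1) z(1)] W(2) by simp
    ultimately show "\<exists>z. lev z < lev x \<and> circ {x, y, z}" by blast
  next
    fix C assume C: "circ C"
    have fin: "finite C" and ne: "C \<noteq> {}" using C circuit_finite circuit_not_indep indep_empty by auto
    obtain x where x: "x \<in> C" and mx[rule_format]: "\<forall>u\<in>C. lev u \<le> lev x"
      by (rule obtain_max[OF fin ne])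
    have xg: "x \<in> ground" using x circuit_ground[OF C] by blast
    obtain W where W: "W \<in> CC" "rk W < lev x" "\<forall>u\<in>ground. lev u < lev x \<longrightarrow> u \<in> W"
      using prev[OF xg] by blast
    \<comment> \<open>Were \<open>x\<close> alone on the top level, the flat \<open>W\<close> would
      contain the rest of the circuit and therefore \<open>x\<close>.\<close>
    have "\<exists>y\<in>C. x \<noteq> y \<and> lev x = lev y"
    proof (rule ccontr)
      assume "\<not> ?thesis"
      then have "C - {x} \<subseteq> W" using W(3) mx circuit_ground[OF C] by fastforce
      then have "x \<in> W"
        using flat_closure_subset[of W "C - {x}"] W(1) CCf circuit_in_closure[OF C x] by blast
      then show False using lev_le[OF W(1)] W(2) by fastforce
    qed
    then show "\<exists>x\<in>C. \<exists>y\<in>C. x \<noteq> y \<and> lev x = lev y \<and> (\<forall>u\<in>C. lev u \<le> lev x)"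
      using x mx by blast
  qed
qed

text \<open>Induction on the sum of the levels. A circuit with more than 3 elements has two points
  on its top level, and the line through them has a third point \<open>z\<close> of lower level. On
  these three points \<open>l\<close> collides by assumption. If \<open>z\<close> collides with
  \<open>y\<close>, elimination of \<open>y\<close> gives a circuit inside \<open>C\<close> with
  \<open>y\<close> replaced by \<open>z\<close>; its level sum is smaller, and a collision on it is
  one on \<open>C\<close>, since \<open>z\<close> and \<open>y\<close> have the same image.\<close>

lemma supersolvable_collision:
  fixes l :: "'a \<Rightarrow> 'b"
  assumes ss: "supersolvable ground indep"
    and three: "\<And>C. circ C \<Longrightarrow> card C = 3 \<Longrightarrow> \<not> inj_on l C"
    and C: "circ C"
  shows "\<not> inj_on l C"
proof -
  obtain lev :: "'a \<Rightarrow> nat" where line: "\<And>x y. x \<in> ground \<Longrightarrow> y \<in> ground \<Longrightarrow> x \<noteq> y \<Longrightarrow> lev x = lev y \<Longrightarrow> \<exists>z. lev z < lev x \<and> circ {x, y, z}"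
    and top: "\<And>C. circ C \<Longrightarrow> \<exists>x\<in>C. \<exists>y\<in>C. x \<noteq> y \<and> lev x = lev y \<and> (\<forall>u\<in>C. lev u \<le> lev x)"
    using supersolvable_line_meets[OF ss] by blast
  have trade: "\<not> inj_on l C"
    if C: "circ C" and IH: "\<And>B. sum lev B < sum lev C \<Longrightarrow> circ B \<Longrightarrow> \<not> inj_on l B"
      and y: "y \<in> C" and zC: "z \<notin> C" and z: "lev z < lev y" "l z = l y"
      and D: "circ D" "y \<in> D" "z \<in> D" "D \<subseteq> insert z C" for C D y z
  proof
    assume inj: "inj_on l C"
    have fin: "finite C" using C circuit_finite by simp
    obtain B where B: "circ B" "B \<subseteq> (C \<union> D) - {y}"
      using circuit_elimination[OF C D(1), of y] y D zC by blast
    then have Bs: "B \<subseteq> insert z (C - {y})" using D by blast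
    have "sum lev B \<le> sum lev (insert z (C - {y}))"
      using Bs fin by (intro sum_mono2) auto
    also have "\<dots> = lev z + sum lev (C - {y})" using fin zC by simp
    also have "\<dots> < sum lev C" using z y fin by (simp add: sum.remove[of C y])
    finally have "\<not> inj_on l B" using IH B by blast
    moreover have "inj_on l (insert z (C - {y}))"
      using inj z(2) y zC by (auto simp: inj_on_def)
    ultimately show False using Bs inj_on_subset by blast
  qed
  from C show ?thesis
  proof (induction "sum lev C" arbitrary: C rule: less_induct)
    case less
    note C = less.prems
    show ?case
    proof (cases "card C = 3")
      case False
      obtain x y where xy: "x \<in> C" "y \<in> C" "x \<noteq> y" "lev x = lev y" using top[OF C] by blast
      obtain z where z: "lev z < lev x" "circ {x, y, z}"
        using line[of x y] xy circuit_ground[OF C] by blast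
      have neq: "z \<noteq> x" "z \<noteq> y" using z xy by auto
      have zC: "z \<notin> C"
      proof
        assume "z \<in> C"
        then have "{x, y, z} = C" using circuit_subset_eq[OF z(2) C] xy by blast
        then show False using False neq xy by auto
      qed
      have "\<not> inj_on l {x, y, z}" using three[OF z(2)] neq xy by auto
      then consider "l x = l y" | "l z = l y" | "l z = l x" using neq xy by (auto simp: inj_on_def)
      then show ?thesis
      proof cases
        case 1 then show ?thesis using xy by (auto simp: inj_on_def)
      next
        case 2
        have lt: "lev z < lev y" using z xy by simp
        show ?thesis by (rule trade[OF C _ xy(2) zC lt 2 z(2)]) (use less.hyps xy in auto)
      next
        case 3
        show ?thesis by (rule trade[OF C _ xy(1) zC z(1) 3 z(2)]) (use less.hyps xy in auto)
      qed
    qed (use three C in blast)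
  qed
qed

end


section \<open>Signs of monomial products\<close>

lemma ext_sign_empty [simp]: "ext_sign {} T = 1" "ext_sign S {} = 1"
  by (simp_all add: ext_sign_def)

lemma ext_sign_Un_left:
  assumes "finite S" "finite S'" "finite T" "S \<inter> S' = {}"
  shows "ext_sign (S \<union> S') T = ext_sign S T * (ext_sign S' T :: 'k::field)"
proof -
  let ?I = "\<lambda>S. {(i, j). i \<in> S \<and> j \<in> T \<and> j < i}"
  have fin: "finite (?I A)" if "finite A" for A
    by (rule finite_subset[of _ "A \<times> T"]) (use that assms in auto)
  have "?I (S \<union> S') = ?I S \<union> ?I S'" by auto
  moreover have "card (?I S \<union> ?I S') = card (?I S) + card (?I S')"
    by (rule card_Un_disjoint) (use fin assms in auto)
  ultimately show ?thesis by (simp add: ext_sign_def power_add)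
qed

lemma ext_sign_Un_right:
  assumes "finite S" "finite T" "finite T'" "T \<inter> T' = {}"
  shows "ext_sign S (T \<union> T') = ext_sign S T * (ext_sign S T' :: 'k::field)"
proof -
  let ?I = "\<lambda>T. {(i, j). i \<in> S \<and> j \<in> T \<and> j < i}"
  have fin: "finite (?I A)" if "finite A" for A
    by (rule finite_subset[of _ "S \<times> A"]) (use that assms in auto)
  have "?I (T \<union> T') = ?I T \<union> ?I T'" by auto
  moreover have "card (?I T \<union> ?I T') = card (?I T) + card (?I T')"
    by (rule card_Un_disjoint) (use fin assms in auto)
  ultimately show ?thesis by (simp add: ext_sign_def power_add)
qed

lemma ext_sign_singleton: "ext_sign {i} T = (- 1) ^ card {j \<in> T. j < i}"
proof -
  have "{(a, j). a \<in> {i} \<and> j \<in> T \<and> j < a} = Pair i ` {j \<in> T. j < i}" by auto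
  then have "card {(a, j). a \<in> {i} \<and> j \<in> T \<and> j < a} = card {j \<in> T. j < i}"
    by (simp only:) (rule card_image, simp add: inj_on_def)
  then show ?thesis unfolding ext_sign_def by (rule arg_cong)
qed


section \<open>The exterior algebra as a type\<close>

text \<open>Infinitely many generators, and formal infinite sums of monomials, are allowed: this makes all
  truncations, homogeneous components and substitutions total.\<close>

typedef (overloaded) 'k ext = "{f :: nat set \<Rightarrow> 'k::field. \<forall>U. infinite U \<longrightarrow> f U = 0}"
  morphisms coeff Ext
  by (rule exI[of _ "\<lambda>_. 0"]) simp

lemma coeff_infinite: "infinite U \<Longrightarrow> coeff f U = 0"
  using coeff[of f] by simp

lemma coeff_Ext: "(\<And>U. infinite U \<Longrightarrow> f U = 0) \<Longrightarrow> coeff (Ext f) = f"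
  by (rule Ext_inverse) simp

lemma ext_eqI: "(\<And>U. finite U \<Longrightarrow> coeff f U = coeff g U) \<Longrightarrow> f = g"
proof -
  assume "\<And>U. finite U \<Longrightarrow> coeff f U = coeff g U"
  then have "coeff f = coeff g" by (metis coeff_infinite ext)
  then show ?thesis by (simp add: coeff_inject)
qed

instantiation ext :: (field) ring_1
begin

definition "0 = Ext (\<lambda>U. 0)"
definition "1 = Ext (ext_basis {})"
definition "f + g = Ext (\<lambda>U. coeff f U + coeff g U)"
definition "f - g = Ext (\<lambda>U. coeff f U - coeff g U)"
definition "- f = Ext (\<lambda>U. - coeff f U)"
definition "f * g = Ext (\<lambda>U. \<Sum>S\<in>Pow U. ext_sign S (U - S) * coeff f S * coeff g (U - S))"

lemma coeff_zero [simp]: "coeff 0 U = 0"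
  by (simp add: zero_ext_def coeff_Ext)

lemma coeff_one: "coeff 1 U = ext_basis {} U"
  unfolding one_ext_def by (subst coeff_Ext) (auto simp: ext_basis_def)

lemma coeff_add [simp]: "coeff (f + g) U = coeff f U + coeff g U"
  unfolding plus_ext_def by (subst coeff_Ext) (auto simp: coeff_infinite)

lemma coeff_diff [simp]: "coeff (f - g) U = coeff f U - coeff g U"
  unfolding minus_ext_def by (subst coeff_Ext) (auto simp: coeff_infinite)

lemma coeff_minus [simp]: "coeff (- f) U = - coeff f U"
  unfolding uminus_ext_def by (subst coeff_Ext) (auto simp: coeff_infinite)

lemma coeff_mult:
  "coeff (f * g) U = (\<Sum>S\<in>Pow U. ext_sign S (U - S) * coeff f S * coeff g (U - S))"
  unfolding times_ext_def by (subst coeff_Ext) (auto simp: sum.infinite)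

instance
proof
  fix a b c :: "'a ext"
  show "a * b * c = a * (b * c)"
  proof (rule ext_eqI)
    fix U :: "nat set" assume U: "finite U"
    have fin: "finite S" if "S \<subseteq> U" for S using that U finite_subset by blast
    \<comment> \<open>\<open>F P R T\<close> is the contribution of an ordered partition of
      \<open>U\<close> into three parts. Both bracketings sum it over all such partitions and differ
      only in their enumeration.\<close>
    define F where "F P R T = ext_sign P R * ext_sign P T * ext_sign R T * coeff a P * coeff b R * coeff c T" for P R T
    have "coeff (a * b * c) U = (\<Sum>S\<in>Pow U. \<Sum>P\<in>Pow S. F P (S - P) (U - S))"
      unfolding coeff_mult sum_distrib_left sum_distrib_right
    proof (intro sum.cong refl)
      fix S P assume S: "S \<in> Pow U" "P \<in> Pow S"
      have "ext_sign (P \<union> (S - P)) (U - S) = ext_sign P (U - S) * (ext_sign (S - P) (U - S) :: 'a)"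
        by (rule ext_sign_Un_left) (use S fin in auto)
      moreover have "P \<union> (S - P) = S" using S by auto
      ultimately show "ext_sign S (U - S) * (ext_sign P (S - P) * coeff a P * coeff b (S - P)) * coeff c (U - S)
          = F P (S - P) (U - S)" by (simp add: F_def)
    qed
    also have "\<dots> = (\<Sum>(S, P)\<in>Sigma (Pow U) Pow. F P (S - P) (U - S))"
      by (rule sum.Sigma) (use U fin in auto)
    also have "\<dots> = (\<Sum>(P, R)\<in>Sigma (Pow U) (\<lambda>P. Pow (U - P)). F P R (U - P - R))"
      by (rule sum.reindex_bij_witness[of _ "\<lambda>(P, R). (P \<union> R, P)" "\<lambda>(S, P). (P, S - P)"])
        (auto simp: Diff_eq Un_absorb1 Int_assoc Un_Int_distrib; fail | auto simp: set_diff_eq intro!: arg_cong3[where f=F])+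
    also have "\<dots> = (\<Sum>P\<in>Pow U. \<Sum>R\<in>Pow (U - P). F P R (U - P - R))"
      by (rule sum.Sigma[symmetric]) (use U fin in auto)
    also have "\<dots> = coeff (a * (b * c)) U"
      unfolding coeff_mult sum_distrib_left sum_distrib_right
    proof (intro sum.cong refl)
      fix P R assume S: "P \<in> Pow U" "R \<in> Pow (U - P)"
      have "ext_sign P (R \<union> (U - P - R)) = ext_sign P R * (ext_sign P (U - P - R) :: 'a)"
        by (rule ext_sign_Un_right) (use S U fin[of P] fin[of R] in auto)
      moreover have "R \<union> (U - P - R) = U - P" using S by auto
      ultimately show "F P R (U - P - R) = ext_sign P (U - P) * coeff a P *
          (ext_sign R (U - P - R) * coeff b R * coeff c (U - P - R))" by (simp add: F_def)
    qed
    finally show "coeff (a * b * c) U = coeff (a * (b * c)) U" .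
  qed
  show "1 * a = a"
  proof (rule ext_eqI)
    fix U :: "nat set" assume U: "finite U"
    have "coeff (1 * a) U = (\<Sum>S\<in>Pow U. if S = {} then coeff a U else 0)"
      unfolding coeff_mult by (rule sum.cong) (auto simp: coeff_one ext_basis_def)
    then show "coeff (1 * a) U = coeff a U" using U by simp
  qed
  show "a * 1 = a"
  proof (rule ext_eqI)
    fix U :: "nat set" assume U: "finite U"
    have "coeff (a * 1) U = (\<Sum>S\<in>Pow U. if S = U then coeff a U else 0)"
      unfolding coeff_mult by (rule sum.cong) (auto simp: coeff_one ext_basis_def)
    then show "coeff (a * 1) U = coeff a U" using U by simp
  qed
  show "(a + b) * c = a * c + b * c"
    by (rule ext_eqI) (simp add: coeff_mult algebra_simps sum.distrib)
  show "a * (b + c) = a * b + a * c"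
    by (rule ext_eqI) (simp add: coeff_mult algebra_simps sum.distrib)
  show "(0 :: 'a ext) \<noteq> 1"
  proof
    assume "(0 :: 'a ext) = 1"
    then have "coeff (0 :: 'a ext) {} = coeff 1 {}" by simp
    then show False by (simp add: coeff_one ext_basis_def)
  qed
qed (rule ext_eqI; simp add: algebra_simps)+

end

lemma coeff_sum [simp]: "coeff (sum f A) U = (\<Sum>x\<in>A. coeff (f x) U)"
  by (induction A rule: infinite_finite_induct) auto

definition cst :: "'k::field \<Rightarrow> 'k ext" where
  "cst c = Ext (\<lambda>U. c * ext_basis {} U)"

text \<open>For infinite \<open>T\<close> this is 0; the guard keeps the argument of
  \<open>Ext\<close> inside the represented set.\<close>

definition emon :: "nat set \<Rightarrow> 'k::field ext" where
  "emon T = Ext (\<lambda>U. if infinite U then 0 else ext_basis T U)"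

abbreviation gen :: "nat \<Rightarrow> 'k::field ext" where
  "gen i \<equiv> emon {i}"

lemma coeff_cst: "coeff (cst c) U = (if U = {} then c else 0)"
  unfolding cst_def by (subst coeff_Ext) (auto simp: ext_basis_def)

lemma coeff_emon: "finite U \<Longrightarrow> coeff (emon T) U = (if U = T then 1 else 0)"
  unfolding emon_def by (subst coeff_Ext) (auto simp: ext_basis_def)

lemma coeff_emon': "finite T \<Longrightarrow> coeff (emon T) U = (if U = T then 1 else 0)"
  unfolding emon_def by (subst coeff_Ext) (auto simp: ext_basis_def)

lemma emon_empty: "emon {} = 1"
  by (rule ext_eqI) (simp add: coeff_emon coeff_one ext_basis_def)

lemma coeff_cst_mult [simp]: "coeff (cst c * f) U = c * coeff f U"
proof (cases "finite U")
  case True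
  have "coeff (cst c * f) U = (\<Sum>S\<in>Pow U. if S = {} then c * coeff f U else 0)"
    unfolding coeff_mult by (rule sum.cong) (auto simp: coeff_cst)
  then show ?thesis using True by simp
qed (simp add: coeff_infinite)

lemma coeff_mult_cst [simp]: "coeff (f * cst c) U = c * coeff f U"
proof (cases "finite U")
  case True
  have "coeff (f * cst c) U = (\<Sum>S\<in>Pow U. if S = U then c * coeff f U else 0)"
    unfolding coeff_mult by (rule sum.cong) (auto simp: coeff_cst)
  then show ?thesis using True by simp
qed (simp add: coeff_infinite)

lemma cst_commute: "f * cst c = cst c * f"
  by (rule ext_eqI) simp

lemma cst_mult: "cst (a * b) = cst a * cst b"
  by (rule ext_eqI) (simp add: coeff_cst)

lemma cst_add: "cst (a + b) = cst a + cst b"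
  by (rule ext_eqI) (simp add: coeff_cst)

lemma cst_one [simp]: "cst 1 = 1"
  by (rule ext_eqI) (simp add: coeff_cst coeff_one ext_basis_def)

lemma cst_zero [simp]: "cst 0 = 0"
  by (rule ext_eqI) (simp add: coeff_cst)

lemma cst_minus: "cst (- a) = - cst a"
  by (rule ext_eqI) (simp add: coeff_cst)

lemma mult_cst_left_commute: "f * (cst c * g) = cst c * (f * g)"
  by (metis cst_commute mult.assoc)

text \<open>The instance of \<open>mult_cst_left_commute\<close> with which rewriting terminates.\<close>

lemma gen_cst_left_commute: "emon T * (cst c * g) = cst c * (emon T * g)"
  by (rule mult_cst_left_commute)

lemma emon_mult:
  assumes "finite S" "finite T"
  shows "emon S * emon T = (if S \<inter> T = {} then cst (ext_sign S T) * emon (S \<union> T) else (0 :: 'k::field ext))"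
proof (rule ext_eqI)
  fix U :: "nat set" assume U: "finite U"
  have fin: "finite P" if "P \<subseteq> U" for P using that U finite_subset by blast
  have "coeff (emon S * emon T :: 'k ext) U =
    (\<Sum>P\<in>Pow U. if P = S then if S \<subseteq> U \<and> U - S = T then ext_sign S T else 0 else 0)"
    unfolding coeff_mult by (rule sum.cong) (auto simp: coeff_emon fin U)
  also have "\<dots> = (if S \<subseteq> U \<and> U - S = T then ext_sign S T else 0)" using U by simp
  also have "\<dots> = coeff (if S \<inter> T = {} then cst (ext_sign S T) * emon (S \<union> T) else (0 :: 'k ext)) U"
    using U by (auto simp: coeff_emon)
  finally show "coeff (emon S * emon T) U = coeff (if S \<inter> T = {} then cst (ext_sign S T) * emon (S \<union> T) else (0 :: 'k ext)) U" .
qed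

lemma gen_mult_emon:
  assumes "finite T" "i \<notin> T"
  shows "gen i * emon T = cst ((- 1) ^ card {j \<in> T. j < i}) * (emon (insert i T) :: 'k::field ext)"
  using assms by (simp add: emon_mult ext_sign_singleton)

lemma gen_square [simp]: "gen i * gen i = 0"
  by (simp add: emon_mult)

lemma gen_anticommute: "gen i * gen j = - (gen j * (gen i :: 'k::field ext))"
proof (cases "i = j")
  case False
  have "ext_sign {i} {j} = - (ext_sign {j} {i} :: 'k)"
  proof -
    have "{k \<in> {j}. k < i} = (if j < i then {j} else {})" "{k \<in> {i}. k < j} = (if i < j then {i} else {})"
      by auto
    then show ?thesis using False by (simp add: ext_sign_singleton)
  qed
  then show ?thesis using False by (simp add: emon_mult cst_minus insert_commute)
qed simp

lemma gen_square_left [simp]: "gen i * (gen i * f) = 0"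
  by (simp add: mult.assoc[symmetric])

lemma gen_anticommute_left: "gen i * (gen j * f) = - (gen j * (gen i * (f :: 'k::field ext)))"
  by (simp only: mult.assoc[symmetric] gen_anticommute[of i j] mult_minus_left)

lemma emon_insert_min:
  assumes "finite T" "\<And>j. j \<in> T \<Longrightarrow> i < j"
  shows "gen i * emon T = (emon (insert i T) :: 'k::field ext)"
proof -
  have "{j \<in> T. j < i} = {}" "i \<notin> T" using assms(2) by force+
  then show ?thesis using gen_mult_emon[OF assms(1), of i] by (simp del: Collect_empty_eq)
qed

text \<open>Sorting \<open>i\<close> into the list needs one transposition per smaller entry, and
  anticommutation holds for the images under \<open>l\<close> just as for the generators themselves.
  So the sign agrees with the one in \<open>gen_mult_emon\<close>, which makes substitution
  compatible with multiplication.\<close>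

lemma prod_list_gen_insort:
  fixes l :: "nat \<Rightarrow> nat"
  assumes "sorted xs" "distinct xs" "i \<notin> set xs"
  shows "gen (l i) * prod_list (map (\<lambda>j. gen (l j)) xs) =
    cst ((- 1) ^ card {j \<in> set xs. j < i}) * prod_list (map (\<lambda>j. gen (l j) :: 'k::field ext) (insort i xs))"
  using assms
proof (induction xs)
  case (Cons x xs)
  show ?case
  proof (cases "i < x")
    case True
    then have "{j \<in> set (x # xs). j < i} = {}" using Cons.prems by auto
    moreover have "insort i (x # xs) = i # x # xs" using True by simp
    ultimately show ?thesis by (simp del: Collect_empty_eq insort_key.simps set_simps)
  next
    case False
    then have "{j \<in> set (x # xs). j < i} = insert x {j \<in> set xs. j < i}" using Cons.prems by auto
    moreover have "x \<notin> {j \<in> set xs. j < i}" using Cons.prems by simp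
    ultimately have card: "card {j \<in> set (x # xs). j < i} = Suc (card {j \<in> set xs. j < i})" by simp
    have "gen (l i) * prod_list (map (\<lambda>j. gen (l j)) (x # xs)) =
      - (gen (l x) * (gen (l i) * prod_list (map (\<lambda>j. gen (l j) :: 'k ext) xs)))"
      using gen_anticommute_left by simp
    also have "gen (l i) * prod_list (map (\<lambda>j. gen (l j)) xs) =
      cst ((- 1) ^ card {j \<in> set xs. j < i}) * prod_list (map (\<lambda>j. gen (l j) :: 'k ext) (insort i xs))"
      using Cons by simp
    finally show ?thesis using False card Cons.prems by (auto simp add: cst_minus gen_cst_left_commute)
  qed
qed simp

lemma emon_eq_prod_list:
  assumes "finite T"
  shows "(emon T :: 'k::field ext) = prod_list (map gen (sorted_list_of_set T))"
  using assms
proof (induction T rule: finite_linorder_min_induct)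
  case (insert b A)
  have *: "sorted_list_of_set (insert b A) = b # sorted_list_of_set A"
  proof -
    have "A - {b} = A" using insert.hyps by auto
    then show ?thesis using insert.hyps
      by (simp add: sorted_list_of_set_insert_remove insort_is_Cons less_imp_le)
  qed
  show ?case unfolding * using insert.hyps insert.IH[symmetric] emon_insert_min[of A b, where 'k='k] by simp
qed (simp add: emon_empty)

lemma prod_list_gen:
  "(\<not> distinct ys \<longrightarrow> prod_list (map gen ys) = (0 :: 'k::field ext)) \<and>
   (distinct ys \<longrightarrow> (\<exists>s. s \<noteq> 0 \<and> prod_list (map gen ys) = cst s * (emon (set ys) :: 'k ext)))"
proof (induction ys)
  case (Cons y ys)
  show ?case
  proof (cases "distinct ys")
    case True
    then obtain s where s: "s \<noteq> 0" "prod_list (map gen ys) = cst s * (emon (set ys) :: 'k ext)"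
      using Cons by blast
    have "prod_list (map gen (y # ys)) = cst s * (gen y * emon (set ys) :: 'k ext)"
      by (simp add: s gen_cst_left_commute)
    also have "\<dots> = (if y \<in> set ys then 0 else cst (s * ext_sign {y} (set ys)) * emon (insert y (set ys)))"
      by (auto simp: emon_mult cst_mult mult.assoc)
    finally have *: "prod_list (map gen (y # ys)) = (if y \<in> set ys then 0 else cst (s * ext_sign {y} (set ys)) * (emon (insert y (set ys)) :: 'k ext))" .
    have "s * ext_sign {y} (set ys) \<noteq> 0" using s by (simp add: ext_sign_def)
    then show ?thesis using * True by (auto intro!: exI[of _ "s * ext_sign {y} (set ys)"])
  qed (use Cons in auto)
qed (use emon_empty in \<open>auto intro!: exI[of _ 1]\<close>)


subsection \<open>Truncation and homogeneous components\<close>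

text \<open>This is the ring endomorphism that kills all generators outside \<open>{1..n}\<close>;
  its image is the exterior algebra on \<open>n\<close> generators.\<close>

definition trunc :: "nat \<Rightarrow> 'k::field ext \<Rightarrow> 'k ext" where
  "trunc n f = Ext (\<lambda>U. if U \<subseteq> {1..n} then coeff f U else 0)"

lemma coeff_trunc: "coeff (trunc n f) U = (if U \<subseteq> {1..n} then coeff f U else 0)"
  unfolding trunc_def by (subst coeff_Ext) (auto simp: coeff_infinite)

lemma trunc_add: "trunc n (f + g) = trunc n f + trunc n g"
  by (rule ext_eqI) (simp add: coeff_trunc)

lemma trunc_mult: "trunc n (f * g) = trunc n f * trunc n g"
proof (rule ext_eqI)
  fix U :: "nat set" assume "finite U"
  show "coeff (trunc n (f * g)) U = coeff (trunc n f * trunc n g) U"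
  proof (cases "U \<subseteq> {1..n}")
    case True
    have "S \<subseteq> {1..n}" "U - S \<subseteq> {1..n}" if "S \<in> Pow U" for S using True that by blast+
    then have "coeff (trunc n f * trunc n g) U = coeff (f * g) U"
      unfolding coeff_mult by (intro sum.cong) (simp_all add: coeff_trunc)
    then show ?thesis using True by (simp add: coeff_trunc)
  next
    case False
    have "coeff (trunc n f) S * coeff (trunc n g) (U - S) = 0" if "S \<subseteq> U" for S
      using False that by (auto simp: coeff_trunc)
    then have "coeff (trunc n f * trunc n g) U = 0"
      unfolding coeff_mult by (intro sum.neutral) (auto simp: mult.assoc)
    then show ?thesis using False by (simp add: coeff_trunc)
  qed
qed

lemma trunc_trunc [simp]: "trunc n (trunc n f) = trunc n f"
  by (rule ext_eqI) (simp add: coeff_trunc)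

lemma trunc_emon: "finite T \<Longrightarrow> trunc n (emon T) = (if T \<subseteq> {1..n} then emon T else 0)"
  by (rule ext_eqI) (auto simp add: coeff_trunc coeff_emon)

lemma trunc_cst [simp]: "trunc n (cst c) = cst c"
  by (rule ext_eqI) (simp add: coeff_trunc coeff_cst)

lemma trunc_expand: "trunc n f = (\<Sum>T\<in>Pow {1..n}. cst (coeff f T) * emon T)"
proof (rule ext_eqI)
  fix U :: "nat set" assume U: "finite U"
  have "(\<Sum>T\<in>Pow {1..n}. coeff (cst (coeff f T) * emon T) U) = (\<Sum>T\<in>Pow {1..n}. if T = U then coeff f U else 0)"
    by (rule sum.cong) (use U in \<open>auto simp: coeff_emon\<close>)
  then show "coeff (trunc n f) U = coeff (\<Sum>T\<in>Pow {1..n}. cst (coeff f T) * emon T) U"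
    by (simp add: coeff_trunc)
qed

definition hcomp :: "nat \<Rightarrow> 'k::field ext \<Rightarrow> 'k ext" where
  "hcomp p f = Ext (\<lambda>U. if card U = p then coeff f U else 0)"

definition hom_deg :: "nat \<Rightarrow> 'k::field ext \<Rightarrow> bool" where
  "hom_deg p f \<longleftrightarrow> (\<forall>U. card U \<noteq> p \<longrightarrow> coeff f U = 0)"

lemma coeff_hcomp: "coeff (hcomp p f) U = (if card U = p then coeff f U else 0)"
  unfolding hcomp_def by (subst coeff_Ext) (auto simp: coeff_infinite)

lemma hom_deg_hcomp [simp]: "hom_deg p (hcomp p f)"
  by (simp add: hom_deg_def coeff_hcomp)

lemma hcomp_hom_deg: "hom_deg p f \<Longrightarrow> hcomp p f = f"
  by (rule ext_eqI) (simp add: hom_deg_def coeff_hcomp)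

lemma hcomp_add: "hcomp p (f + g) = hcomp p f + hcomp p g"
  by (rule ext_eqI) (simp add: coeff_hcomp)

lemma hcomp_diff: "hcomp p (f - g) = hcomp p f - hcomp p g"
  by (rule ext_eqI) (simp add: coeff_hcomp)

lemma hcomp_zero [simp]: "hcomp p 0 = 0"
  by (rule ext_eqI) (simp add: coeff_hcomp)

lemma hcomp_sum: "hcomp p (sum f A) = (\<Sum>x\<in>A. hcomp p (f x))"
  by (induction A rule: infinite_finite_induct) (auto simp: hcomp_add)

lemma hcomp_trunc: "hcomp p (trunc n f) = trunc n (hcomp p f)"
  by (rule ext_eqI) (simp add: coeff_hcomp coeff_trunc)

lemma hcomp_0: "hcomp 0 f = cst (coeff f {})"
  by (rule ext_eqI) (auto simp: coeff_hcomp coeff_cst)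

lemma hom_deg_diff: "hom_deg p f \<Longrightarrow> hom_deg p g \<Longrightarrow> hom_deg p (f - g)"
  by (simp add: hom_deg_def)

lemma hom_deg_minus: "hom_deg p f \<Longrightarrow> hom_deg p (- f)"
  by (simp add: hom_deg_def)

lemma hom_deg_zero [simp]: "hom_deg p 0"
  by (simp add: hom_deg_def)

lemma hom_deg_sum: "(\<And>x. x \<in> A \<Longrightarrow> hom_deg p (f x)) \<Longrightarrow> hom_deg p (sum f A)"
  by (simp add: hom_deg_def)

lemma hom_deg_cst_mult: "hom_deg p f \<Longrightarrow> hom_deg p (cst c * f)"
  by (simp add: hom_deg_def)

lemma hom_deg_emon: "finite T \<Longrightarrow> hom_deg (card T) (emon T)"
  by (simp add: hom_deg_def coeff_emon')

lemma hom_deg_gen: "hom_deg 1 (gen i)"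
  using hom_deg_emon[of "{i}"] by simp

lemma hom_deg_trunc: "hom_deg p f \<Longrightarrow> hom_deg p (trunc n f)"
  by (simp add: hom_deg_def coeff_trunc)

text \<open>Used to replace the coefficients of a relation between homogeneous elements by their
  components of the right degree.\<close>

lemma hcomp_mult_right:
  assumes "hom_deg q r" shows "hcomp (p + q) (f * r) = hcomp p f * r"
proof (rule ext_eqI)
  fix U :: "nat set" assume U: "finite U"
  have "coeff (f * r) U = coeff (hcomp p f * r) U" if "card U = p + q"
    unfolding coeff_mult
  proof (rule sum.cong)
    fix S assume S: "S \<in> Pow U"
    then have "card S + card (U - S) = p + q"
      using that U by (metis PowD card_Diff_subset card_mono finite_subset le_add_diff_inverse)
    then have "coeff r (U - S) = 0" if "card S \<noteq> p" using assms that by (simp add: hom_deg_def)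
    then show "ext_sign S (U - S) * coeff f S * coeff r (U - S) =
      ext_sign S (U - S) * coeff (hcomp p f) S * coeff r (U - S)"
      by (simp add: coeff_hcomp)
  qed simp
  moreover have "coeff (hcomp p f * r) U = 0" if "card U \<noteq> p + q"
    unfolding coeff_mult
  proof (rule sum.neutral, rule ballI)
    fix S assume S: "S \<in> Pow U"
    then have "card S + card (U - S) = card U"
      using U by (metis PowD card_Diff_subset card_mono finite_subset le_add_diff_inverse)
    then have "card S \<noteq> p \<or> card (U - S) \<noteq> q" using that by auto
    then show "ext_sign S (U - S) * coeff (hcomp p f) S * coeff r (U - S) = 0"
      using assms by (auto simp: hom_deg_def coeff_hcomp)
  qed
  ultimately show "coeff (hcomp (p + q) (f * r)) U = coeff (hcomp p f * r) U"
    by (auto simp: coeff_hcomp)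
qed

lemma hom_deg_mult: "hom_deg p f \<Longrightarrow> hom_deg q g \<Longrightarrow> hom_deg (p + q) (f * g)"
  by (metis hcomp_hom_deg hcomp_mult_right hom_deg_hcomp)

lemma trunc_eq_sum_hcomp: "trunc n f = (\<Sum>p\<le>n. hcomp p (trunc n f))"
proof (rule ext_eqI)
  fix U :: "nat set" assume "finite U"
  show "coeff (trunc n f) U = coeff (\<Sum>p\<le>n. hcomp p (trunc n f)) U"
  proof (cases "U \<subseteq> {1..n}")
    case True
    then have "card U \<le> n" using card_mono[of "{1..n}" U] by simp
    then show ?thesis by (simp add: coeff_hcomp)
  qed (simp add: coeff_hcomp coeff_trunc)
qed


subsection \<open>Substitution of generators\<close>

text \<open>The homomorphism that sends generator \<open>i\<close> to generator \<open>l i\<close>,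
  extended linearly from sorted monomials. Values of \<open>l\<close> beyond \<open>n\<close> are
  allowed, as the maps used later send points to \<open>n + 1\<close>.\<close>

definition gsub :: "nat \<Rightarrow> (nat \<Rightarrow> nat) \<Rightarrow> 'k::field ext \<Rightarrow> 'k ext" where
  "gsub n l f = (\<Sum>T\<in>Pow {1..n}. cst (coeff f T) * prod_list (map (\<lambda>j. gen (l j)) (sorted_list_of_set T)))"

lemma gsub_add: "gsub n l (f + g) = gsub n l f + gsub n l g"
  by (simp add: gsub_def cst_add distrib_right sum.distrib)

lemma gsub_cst_mult: "gsub n l (cst c * f) = cst c * gsub n l f"
  by (simp add: gsub_def cst_mult sum_distrib_left mult.assoc)

lemma gsub_zero [simp]: "gsub n l 0 = 0"
  by (simp add: gsub_def)

lemma gsub_minus: "gsub n l (- f) = - gsub n l f"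
  using gsub_add[of n l f "- f"] by (simp add: eq_neg_iff_add_eq_0 add.commute)

lemma gsub_diff: "gsub n l (f - g) = gsub n l f - gsub n l g"
  using gsub_add[of n l f "- g"] by (simp add: gsub_minus)

lemma gsub_sum: "gsub n l (sum f A) = (\<Sum>x\<in>A. gsub n l (f x))"
  by (induction A rule: infinite_finite_induct) (auto simp: gsub_add)

lemma gsub_trunc: "gsub n l (trunc n f) = gsub n l f"
  unfolding gsub_def by (rule sum.cong) (auto simp: coeff_trunc)

lemma gsub_emon:
  assumes "T \<subseteq> {1..n}"
  shows "gsub n l (emon T) = prod_list (map (\<lambda>j. gen (l j)) (sorted_list_of_set T))"
proof -
  have fin: "finite S" if "S \<subseteq> {1..n}" for S using that finite_subset by blast
  have "gsub n l (emon T) = (\<Sum>S\<in>Pow {1..n}. if S = T then prod_list (map (\<lambda>j. gen (l j)) (sorted_list_of_set T)) else 0)"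
    unfolding gsub_def by (rule sum.cong) (auto simp: coeff_emon fin)
  then show ?thesis using assms by simp
qed

lemma gsub_gen_mult:
  fixes f :: "'k::field ext"
  assumes i: "i \<in> {1..n}" shows "gsub n l (gen i * f) = gen (l i) * gsub n l f"
proof -
  have m: "gsub n l (gen i * emon T) = gen (l i) * gsub n l (emon T :: 'k ext)" if T: "T \<subseteq> {1..n}" for T
  proof (cases "i \<in> T")
    \<comment> \<open>The left side is 0 here. On the right, \<open>gen (l i)\<close> is up to sign
      a factor at the front of the image of \<open>emon T\<close>, where it meets the other copy and
      squares to 0.\<close>
    case True
    have fin: "finite T" using T finite_subset by blast
    have T': "T - {i} \<subseteq> {1..n}" "finite (T - {i})" using T fin by auto
    have "insort i (sorted_list_of_set (T - {i})) = sorted_list_of_set T"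
      using True fin sorted_list_of_set_insert_remove[of "T - {i}" i] by (simp add: insert_absorb)
    then have e: "gen (l i) * gsub n l (emon (T - {i}) :: 'k ext) =
        cst ((- 1) ^ card {j \<in> T - {i}. j < i}) * gsub n l (emon T)"
      using prod_list_gen_insort[of "sorted_list_of_set (T - {i})" i l, where 'k='k] T T' fin
      by (simp add: gsub_emon)
    have "0 = gen (l i) * (gen (l i) * gsub n l (emon (T - {i}) :: 'k ext))" by simp
    also have "\<dots> = cst ((- 1) ^ card {j \<in> T - {i}. j < i}) * (gen (l i) * gsub n l (emon T))"
      unfolding e by (simp add: gen_cst_left_commute)
    finally have "cst ((- 1) ^ card {j \<in> T - {i}. j < i}) * (cst ((- 1) ^ card {j \<in> T - {i}. j < i}) * (gen (l i) * gsub n l (emon T :: 'k ext))) = 0"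
      by simp
    then have "gen (l i) * gsub n l (emon T :: 'k ext) = 0"
      unfolding mult.assoc[symmetric] cst_mult[symmetric] by (simp add: power_add[symmetric] mult.assoc)
    moreover have "gen i * emon T = (0 :: 'k ext)" using True fin by (simp add: emon_mult)
    ultimately show ?thesis by simp
  next
    case False
    have fin: "finite T" using T finite_subset by blast
    have "sorted_list_of_set (insert i T) = insort i (sorted_list_of_set T)"
      using False fin by (simp add: sorted_list_of_set_insert_remove)
    then show ?thesis
      using prod_list_gen_insort[of "sorted_list_of_set T" i l, where 'k='k] False fin T i
      by (simp add: gen_mult_emon gsub_cst_mult gsub_emon)
  qed
  have "gsub n l (gen i * f) = gsub n l (trunc n (gen i * f))" by (simp add: gsub_trunc)
  also have "trunc n (gen i * f) = (\<Sum>T\<in>Pow {1..n}. cst (coeff f T) * (gen i * emon T))"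
  proof -
    have "trunc n (gen i * f) = gen i * trunc n f" using i by (simp add: trunc_mult trunc_emon)
    then show ?thesis by (simp add: trunc_expand[of n f] sum_distrib_left gen_cst_left_commute)
  qed
  also have "gsub n l \<dots> = (\<Sum>T\<in>Pow {1..n}. cst (coeff f T) * (gen (l i) * gsub n l (emon T)))"
    unfolding gsub_sum by (rule sum.cong) (auto simp: gsub_cst_mult m)
  also have "\<dots> = gen (l i) * gsub n l (trunc n f)"
    by (simp add: trunc_expand[of n f] gsub_sum gsub_cst_mult sum_distrib_left gen_cst_left_commute)
  finally show ?thesis by (simp add: gsub_trunc)
qed

lemma gsub_mult: "gsub n l (f * g) = gsub n l f * gsub n l (g :: 'k::field ext)"
proof -
  have list: "gsub n l (prod_list (map gen xs) * g) = prod_list (map (\<lambda>j. gen (l j)) xs) * gsub n l g"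
    if "set xs \<subseteq> {1..n}" for xs
    using that by (induction xs) (auto simp: mult.assoc gsub_gen_mult)
  have "gsub n l (f * g) = gsub n l (trunc n f * trunc n g)" by (metis gsub_trunc trunc_mult)
  also have "\<dots> = gsub n l (trunc n f * g)" by (metis gsub_trunc trunc_mult trunc_trunc)
  also have "\<dots> = (\<Sum>T\<in>Pow {1..n}. cst (coeff f T) * gsub n l (emon T * g))"
    by (simp add: trunc_expand[of n f] sum_distrib_right gsub_sum mult.assoc gsub_cst_mult)
  also have "\<dots> = (\<Sum>T\<in>Pow {1..n}. cst (coeff f T) * (prod_list (map (\<lambda>j. gen (l j)) (sorted_list_of_set T)) * gsub n l g))"
  proof (rule sum.cong)
    fix T assume "T \<in> Pow {1..n}"
    then have T: "T \<subseteq> {1..n}" "finite T" using finite_subset by auto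
    show "cst (coeff f T) * gsub n l (emon T * g) = cst (coeff f T) * (prod_list (map (\<lambda>j. gen (l j)) (sorted_list_of_set T)) * gsub n l g)"
      unfolding emon_eq_prod_list[OF T(2)] using list[of "sorted_list_of_set T"] T by simp
  qed simp
  also have "\<dots> = gsub n l f * gsub n l g"
    by (simp add: gsub_def[of n l f] sum_distrib_right mult.assoc)
  finally show ?thesis .
qed

lemma gsub_gen: "i \<in> {1..n} \<Longrightarrow> gsub n l (gen i) = gen (l i)"
  by (simp add: gsub_emon)

lemma gsub_emon_cases:
  assumes "T \<subseteq> {1..n}"
  shows "\<not> inj_on l T \<Longrightarrow> gsub n l (emon T) = (0 :: 'k::field ext)"
    and "inj_on l T \<Longrightarrow> \<exists>s. s \<noteq> 0 \<and> gsub n l (emon T) = cst s * (emon (l ` T) :: 'k ext)"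
proof -
  have fin: "finite T" using assms finite_subset by blast
  have "gsub n l (emon T :: 'k ext) = prod_list (map gen (map l (sorted_list_of_set T)))"
    using gsub_emon[OF assms] by (simp add: comp_def)
  then show "\<not> inj_on l T \<Longrightarrow> gsub n l (emon T) = (0 :: 'k ext)"
    and "inj_on l T \<Longrightarrow> \<exists>s. s \<noteq> 0 \<and> gsub n l (emon T) = cst s * (emon (l ` T) :: 'k ext)"
    using prod_list_gen[of "map l (sorted_list_of_set T)", where 'k='k] fin
    by (auto simp: distinct_map)
qed

lemma coeff_mult_gen_notin: "i \<notin> U \<Longrightarrow> coeff (f * gen i) U = 0"
  unfolding coeff_mult
proof (rule sum.neutral, rule ballI)
  fix S assume "i \<notin> U" "S \<in> Pow U"
  then have "U - S \<noteq> {i}" by auto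
  then show "ext_sign S (U - S) * coeff f S * coeff (gen i) (U - S) = 0"
    by (simp add: coeff_emon')
qed


subsection \<open>The boundary of a monomial\<close>

definition bd :: "nat set \<Rightarrow> 'k::field ext" where
  "bd T = (\<Sum>i\<in>T. cst ((- 1) ^ card {j \<in> T. j < i}) * emon (T - {i}))"

lemma coeff_bd: "finite T \<Longrightarrow> coeff (bd T) = ext_boundary T"
  by (rule HOL.ext) (simp add: bd_def ext_boundary_def coeff_emon' ext_basis_def)

lemma hom_deg_bd: "finite T \<Longrightarrow> hom_deg (card T - 1) (bd T)"
  unfolding bd_def
proof (rule hom_deg_sum)
  fix i assume "finite T" "i \<in> T"
  then show "hom_deg (card T - 1) (cst ((- 1) ^ card {j \<in> T. j < i}) * emon (T - {i}))"
    using hom_deg_emon[of "T - {i}"] by (intro hom_deg_cst_mult) simp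
qed

lemma trunc_bd: "finite T \<Longrightarrow> T \<subseteq> {1..n} \<Longrightarrow> trunc n (bd T) = (bd T :: 'k::field ext)"
proof (rule ext_eqI)
  fix U :: "nat set" assume T: "T \<subseteq> {1..n}" and U: "finite U"
  have "coeff (bd T) U = (0 :: 'k)" if "\<not> U \<subseteq> {1..n}"
    using that T U by (auto simp: bd_def coeff_emon intro!: sum.neutral)
  then show "coeff (trunc n (bd T)) U = coeff (bd T :: 'k ext) U" by (simp add: coeff_trunc)
qed

lemma power_minus_one_square [simp]: "(- 1 :: 'k::field) ^ m * (- 1) ^ m = 1"
  by (simp add: power_add[symmetric])

lemma cst_sign_cancel: "cst ((- 1) ^ m) * (cst ((- 1) ^ m) * f) = (f :: 'k::field ext)"
  by (simp add: mult.assoc[symmetric] cst_mult[symmetric])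

text \<open>The sign is that of the permutation that moves \<open>x\<close> to the front.\<close>

lemma bd_insert:
  assumes T: "finite T" and x: "x \<notin> T"
  shows "cst ((- 1) ^ card {j \<in> T. j < x}) * bd (insert x T) = emon T - gen x * (bd T :: 'k::field ext)"
proof -
  let ?s = "\<lambda>S i. (- 1 :: 'k) ^ card {j \<in> S. j < i}"
  have x': "{j \<in> insert x T. j < x} = {j \<in> T. j < x}" by auto
  have "bd (insert x T) = cst (?s T x) * emon T + (\<Sum>i\<in>T. cst (?s (insert x T) i) * emon (insert x T - {i}))"
    using T x x' by (simp add: bd_def)
  also have "(\<Sum>i\<in>T. cst (?s (insert x T) i) * (emon (insert x T - {i}) :: 'k ext)) =
     - (cst (?s T x) * (gen x * bd T))"
    unfolding bd_def sum_distrib_left sum_negf[symmetric]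
  proof (rule sum.cong)
    fix i assume i: "i \<in> T"
    have ins: "insert x T - {i} = insert x (T - {i})" using i x by auto
    have "gen x * emon (T - {i}) = cst (?s (T - {i}) x) * (emon (insert x T - {i}) :: 'k ext)"
      unfolding ins by (rule gen_mult_emon) (use T x in auto)
    note A = this
    have B: "?s (insert x T) i = - (?s T x * (?s T i * ?s (T - {i}) x))"
    proof (cases "x < i")
      case True
      then have "{j \<in> insert x T. j < i} = insert x {j \<in> T. j < i}" "{j \<in> T - {i}. j < x} = {j \<in> T. j < x}" by auto
      then show ?thesis using x T by (simp add: mult.left_commute[of _ "(- 1) ^ card {j \<in> T. j < i}"])
    next
      case False
      then have "i < x" using i x by (metis linorder_neqE)
      then have "{j \<in> insert x T. j < i} = {j \<in> T. j < i}" "{j \<in> T. j < x} = insert i {j \<in> T - {i}. j < x}" using i by auto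
      then show ?thesis using T by (simp add: mult.left_commute[of _ "(- 1) ^ card {j \<in> T. j < i}"])
    qed
    show "cst (?s (insert x T) i) * (emon (insert x T - {i}) :: 'k ext) =
       - (cst (?s T x) * (gen x * (cst (?s T i) * emon (T - {i}))))"
      unfolding gen_cst_left_commute A B cst_minus cst_mult by (simp add: mult.assoc)
  qed simp
  finally have "bd (insert x T) = cst (?s T x) * (emon T - gen x * (bd T :: 'k ext))"
    by (simp add: right_diff_distrib)
  then show ?thesis by (simp add: cst_sign_cancel)
qed

text \<open>With \<open>R\<close> the rest of \<open>T\<close>, two uses of \<open>bd_insert\<close>
  show that \<open>bd T\<close> is up to sign \<open>(e_y - e_x) * e_R + e_x * e_y * bd R\<close>.
  Both terms vanish once \<open>e_x\<close> and \<open>e_y\<close> have the same image.\<close>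

lemma gsub_bd_collision:
  assumes T: "T \<subseteq> {1..n}" and ni: "\<not> inj_on l T"
  shows "gsub n l (bd T) = (0 :: 'k::field ext)"
proof -
  obtain x y where xy: "x \<in> T" "y \<in> T" "x \<noteq> y" "l x = l y" using ni by (auto simp: inj_on_def)
  define R where "R = T - {x, y}"
  have fin: "finite T" using T finite_subset by blast
  then have R: "finite R" "y \<notin> R" "x \<notin> insert y R" "T = insert x (insert y R)" "R \<subseteq> {1..n}"
    using xy T by (auto simp: R_def)
  have un: "f = 0" if "cst ((- 1) ^ m) * f = (0 :: 'k ext)" for m f
  proof -
    show ?thesis using cst_sign_cancel[of m f] that by simp
  qed
  let ?a = "card {j \<in> insert y R. j < x}" and ?b = "card {j \<in> R. j < y}"
  have 1: "cst ((- 1) ^ ?a) * bd T = emon (insert y R) - gen x * (bd (insert y R) :: 'k ext)"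
    unfolding R(4) by (rule bd_insert) (use R in auto)
  have 2: "cst ((- 1) ^ ?b) * bd (insert y R) = emon R - gen y * (bd R :: 'k ext)"
    by (rule bd_insert) (use R in auto)
  have 3: "cst ((- 1) ^ ?b) * emon (insert y R) = gen y * (emon R :: 'k ext)"
    using R by (simp add: gen_mult_emon)
  have "cst ((- 1) ^ ?b) * (cst ((- 1) ^ ?a) * bd T) = gen y * emon R - gen x * (emon R - gen y * (bd R :: 'k ext))"
    unfolding 1 right_diff_distrib 3 gen_cst_left_commute[symmetric] 2 by simp
  moreover have "x \<in> {1..n}" "y \<in> {1..n}" using xy T by auto
  note inn = this[THEN gsub_gen_mult, of l, where 'k='k]
  have "gsub n l (gen y * emon R - gen x * (emon R - gen y * (bd R :: 'k ext))) = 0"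
    unfolding gsub_diff inn right_diff_distrib xy(4) by simp
  ultimately have "gsub n l (cst ((- 1) ^ ?b) * (cst ((- 1) ^ ?a) * bd T)) = (0 :: 'k ext)"
    by simp
  then show ?thesis unfolding gsub_cst_mult using un by blast
qed


section \<open>The Orlik-Solomon algebra as a quotient\<close>

lemma ext_algebra_carrier: "carrier (ext_algebra n) = range (\<lambda>f :: 'k::field ext. coeff (trunc n f))"
proof
  show "carrier (ext_algebra n) \<subseteq> range (\<lambda>f :: 'k ext. coeff (trunc n f))"
  proof
    fix f :: "nat set \<Rightarrow> 'k" assume "f \<in> carrier (ext_algebra n)"
    then have f: "f U = 0" if "\<not> U \<subseteq> {1..n}" for U using that by (simp add: ext_algebra_def)
    have "coeff (Ext f) = f"
    proof (rule coeff_Ext)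
      fix U :: "nat set" assume "infinite U"
      then have "\<not> U \<subseteq> {1..n}" using finite_subset by blast
      then show "f U = 0" by (rule f)
    qed
    then have "f = coeff (trunc n (Ext f))" using f by (auto simp: coeff_trunc)
    then show "f \<in> range (\<lambda>f. coeff (trunc n f))" by blast
  qed
  show "range (\<lambda>f :: 'k ext. coeff (trunc n f)) \<subseteq> carrier (ext_algebra n)"
    by (simp add: ext_algebra_def coeff_trunc image_subset_iff)
qed

lemma ext_algebra_mult: "coeff f \<otimes>\<^bsub>ext_algebra n\<^esub> coeff g = coeff (f * g)"
  by (rule HOL.ext) (simp add: ext_algebra_def coeff_mult)

lemma ext_algebra_add: "coeff f \<oplus>\<^bsub>ext_algebra n\<^esub> coeff g = coeff (f + g)"
  by (rule HOL.ext) (simp add: ext_algebra_def)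

lemma ext_algebra_one: "\<one>\<^bsub>ext_algebra n\<^esub> = coeff 1"
  by (rule HOL.ext) (simp add: ext_algebra_def coeff_one)

lemma ext_algebra_zero: "\<zero>\<^bsub>ext_algebra n\<^esub> = coeff 0"
  by (rule HOL.ext) (simp add: ext_algebra_def)

lemma trunc_one [simp]: "trunc n 1 = 1"
  using trunc_cst[of n 1] by simp

lemma trunc_zero [simp]: "trunc n 0 = 0"
  using trunc_cst[of n 0] by simp

lemma trunc_minus: "trunc n (- f) = - trunc n f"
  by (rule ext_eqI) (simp add: coeff_trunc)

lemma trunc_diff: "trunc n (f - g) = trunc n f - trunc n g"
  by (rule ext_eqI) (simp add: coeff_trunc)

lemma trunc_in_carrier: "coeff (trunc n f) \<in> carrier (ext_algebra n)"
  by (auto simp: ext_algebra_carrier)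

lemma ext_algebra_ring: "ring (ext_algebra n :: (nat set \<Rightarrow> 'k::field) ring)"
proof (rule ringI)
  let ?R = "ext_algebra n :: (nat set \<Rightarrow> 'k) ring"
  note ops = ext_algebra_mult ext_algebra_add ext_algebra_one ext_algebra_zero
    trunc_mult[symmetric] trunc_add[symmetric]
  have ex: "\<exists>f :: 'k ext. x = coeff (trunc n f)" if "x \<in> carrier ?R" for x
    using that by (auto simp: ext_algebra_carrier)
  have in0: "coeff (0 :: 'k ext) \<in> carrier ?R" "coeff (1 :: 'k ext) \<in> carrier ?R"
    using trunc_in_carrier[of n 0] trunc_in_carrier[of n 1] by simp_all
  show "abelian_group ?R"
  proof (rule abelian_groupI)
    fix x assume "x \<in> carrier ?R"
    then obtain f :: "'k ext" where "x = coeff (trunc n f)" using ex by blast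
    then have "coeff (trunc n (- f)) \<oplus>\<^bsub>?R\<^esub> x = \<zero>\<^bsub>?R\<^esub>" by (simp add: ops)
    then show "\<exists>y\<in>carrier ?R. y \<oplus>\<^bsub>?R\<^esub> x = \<zero>\<^bsub>?R\<^esub>" using trunc_in_carrier by blast
  next
    show "\<zero>\<^bsub>?R\<^esub> \<in> carrier ?R" using in0 by (simp add: ops)
    fix x y assume "x \<in> carrier ?R" "y \<in> carrier ?R"
    then obtain f g :: "'k ext" where fg: "x = coeff (trunc n f)" "y = coeff (trunc n g)" using ex by blast
    show "x \<oplus>\<^bsub>?R\<^esub> y \<in> carrier ?R" "x \<oplus>\<^bsub>?R\<^esub> y = y \<oplus>\<^bsub>?R\<^esub> x"
      by (simp_all add: fg ops trunc_in_carrier add.commute)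
    show "\<zero>\<^bsub>?R\<^esub> \<oplus>\<^bsub>?R\<^esub> x = x" by (simp add: fg ext_algebra_add ext_algebra_zero)
    fix z assume "z \<in> carrier ?R"
    then obtain h :: "'k ext" where h: "z = coeff (trunc n h)" using ex by blast
    show "x \<oplus>\<^bsub>?R\<^esub> y \<oplus>\<^bsub>?R\<^esub> z = x \<oplus>\<^bsub>?R\<^esub> (y \<oplus>\<^bsub>?R\<^esub> z)"
      by (simp add: fg h ops add.assoc)
  qed
  show "monoid ?R"
  proof (rule monoidI)
    show "\<one>\<^bsub>?R\<^esub> \<in> carrier ?R" using in0 by (simp add: ops)
    fix x y assume "x \<in> carrier ?R" "y \<in> carrier ?R"
    then obtain f g :: "'k ext" where fg: "x = coeff (trunc n f)" "y = coeff (trunc n g)" using ex by blast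
    show "x \<otimes>\<^bsub>?R\<^esub> y \<in> carrier ?R" by (simp add: fg ops trunc_in_carrier)
    show "\<one>\<^bsub>?R\<^esub> \<otimes>\<^bsub>?R\<^esub> x = x" "x \<otimes>\<^bsub>?R\<^esub> \<one>\<^bsub>?R\<^esub> = x"
      by (simp_all add: fg ext_algebra_mult ext_algebra_one)
    fix z assume "z \<in> carrier ?R"
    then obtain h :: "'k ext" where h: "z = coeff (trunc n h)" using ex by blast
    show "x \<otimes>\<^bsub>?R\<^esub> y \<otimes>\<^bsub>?R\<^esub> z = x \<otimes>\<^bsub>?R\<^esub> (y \<otimes>\<^bsub>?R\<^esub> z)"
      by (simp add: fg h ops mult.assoc)
  qed
qed (auto simp: ext_algebra_carrier ext_algebra_mult ext_algebra_add distrib_left distrib_right)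

locale orlik_solomon = simple_matroid_locale "{1..n}" indep for n :: nat and indep :: "nat set \<Rightarrow> bool"
begin

text \<open>The preimage of the Orlik-Solomon ideal under truncation. The algebra \<open>A\<close>
  becomes the quotient of the type \<open>ext\<close> by \<open>N\<close>, with quotient map
  \<open>proj\<close>, so that all later computations are congruences modulo
  \<open>N\<close>.\<close>

definition N :: "'k::field ext set" where
  "N = {f. coeff (trunc n f) \<in> OS_ideal n indep}"

definition proj :: "'k::field ext \<Rightarrow> (nat set \<Rightarrow> 'k) set" where
  "proj f = OS_coset n indep (coeff (trunc n f))"

abbreviation A :: "(nat set \<Rightarrow> 'k::field) set ring" where
  "A \<equiv> OS_algebra n indep"

lemma generator_eq: "dependent_set {1..n} indep T \<Longrightarrow> ext_boundary T = coeff (trunc n (bd T))"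
  using finite_if_ground[of T] by (simp add: dependent_set_def trunc_bd coeff_bd)

lemma generators_carrier:
  "{ext_boundary T | T. dependent_set {1..n} indep T} \<subseteq> carrier (ext_algebra n)"
  by (auto simp: generator_eq trunc_in_carrier)

lemma OS_ideal_ideal: "ideal (OS_ideal n indep) (ext_algebra n)"
  unfolding OS_ideal_def by (rule ring.genideal_ideal[OF ext_algebra_ring generators_carrier])

lemma A_ring: "ring A"
  unfolding OS_algebra_def by (rule ideal.quotient_is_ring[OF OS_ideal_ideal])

lemma coset_hom: "OS_coset n indep \<in> ring_hom (ext_algebra n) A"
  unfolding OS_algebra_def OS_coset_def by (rule ideal.rcos_ring_hom[OF OS_ideal_ideal])

lemma proj_add: "proj (f + g) = proj f \<oplus>\<^bsub>A\<^esub> proj g"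
  unfolding proj_def trunc_add
  using ring_hom_add[OF coset_hom trunc_in_carrier trunc_in_carrier, of f g]
  by (simp add: ext_algebra_add)

lemma proj_mult: "proj (f * g) = proj f \<otimes>\<^bsub>A\<^esub> proj g"
  unfolding proj_def trunc_mult
  using ring_hom_mult[OF coset_hom trunc_in_carrier trunc_in_carrier, of f g]
  by (simp add: ext_algebra_mult)

lemma proj_one: "proj 1 = \<one>\<^bsub>A\<^esub>"
  unfolding proj_def using ring_hom_one[OF coset_hom] by (simp add: ext_algebra_one)

lemma proj_closed [simp]: "proj f \<in> carrier A"
  unfolding proj_def by (rule ring_hom_closed[OF coset_hom trunc_in_carrier])

lemma carrier_A: "carrier (A :: (nat set \<Rightarrow> 'k::field) set ring) = range proj"
proof
  show "carrier (A :: (nat set \<Rightarrow> 'k) set ring) \<subseteq> range proj"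
  proof
    fix x :: "(nat set \<Rightarrow> 'k) set" assume "x \<in> carrier A"
    then obtain h where "h \<in> carrier (ext_algebra n)" "x = OS_coset n indep h"
      by (auto simp: OS_algebra_def OS_coset_def FactRing_def A_RCOSETS_def')
    then show "x \<in> range proj" by (auto simp: ext_algebra_carrier proj_def)
  qed
qed auto

lemma proj_eq_iff: "proj f = proj g \<longleftrightarrow> f - g \<in> N"
proof -
  let ?R = "ext_algebra n"
  interpret R: ring ?R by (rule ext_algebra_ring)
  have "coeff (trunc n (- g)) \<oplus>\<^bsub>?R\<^esub> coeff (trunc n g) = \<zero>\<^bsub>?R\<^esub>"
    by (simp add: ext_algebra_add ext_algebra_zero trunc_add[symmetric])
  then have "\<ominus>\<^bsub>?R\<^esub> coeff (trunc n g) = coeff (trunc n (- g))"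
    by (intro R.minus_equality) (auto simp: trunc_in_carrier)
  then have "coeff (trunc n f) \<ominus>\<^bsub>?R\<^esub> coeff (trunc n g) = coeff (trunc n (f - g))"
    by (simp add: R.minus_eq ext_algebra_add trunc_minus trunc_diff)
  then show ?thesis
    using R.quotient_eq_iff_same_a_r_cos[OF OS_ideal_ideal trunc_in_carrier trunc_in_carrier, of f g]
    by (auto simp: N_def proj_def OS_coset_def)
qed

lemma proj_zero: "proj 0 = \<zero>\<^bsub>A\<^esub>"
  using ring_hom_zero[OF coset_hom ext_algebra_ring A_ring] by (simp add: proj_def ext_algebra_zero)

lemma proj_eq_zero_iff: "proj f = \<zero>\<^bsub>A\<^esub> \<longleftrightarrow> f \<in> N"
  using proj_eq_iff[of f 0] by (simp add: proj_zero)

lemma N_zero [simp]: "0 \<in> N"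
  using proj_eq_zero_iff proj_zero by blast

lemma N_add: "f \<in> N \<Longrightarrow> g \<in> N \<Longrightarrow> f + g \<in> N"
proof -
  interpret A: ring A by (rule A_ring)
  show "f \<in> N \<Longrightarrow> g \<in> N \<Longrightarrow> f + g \<in> N"
    unfolding proj_eq_zero_iff[symmetric] proj_add by simp
qed

lemma N_mult_left: "g \<in> N \<Longrightarrow> f * g \<in> N"
proof -
  interpret A: ring A by (rule A_ring)
  show "g \<in> N \<Longrightarrow> f * g \<in> N"
    unfolding proj_eq_zero_iff[symmetric] proj_mult by simp
qed

lemma N_mult_right: "f \<in> N \<Longrightarrow> f * g \<in> N"
proof -
  interpret A: ring A by (rule A_ring)
  show "f \<in> N \<Longrightarrow> f * g \<in> N"
    unfolding proj_eq_zero_iff[symmetric] proj_mult by simp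
qed

lemma N_minus: "f \<in> N \<Longrightarrow> - f \<in> N"
  using N_mult_left[of f "- 1"] by simp

lemma N_diff: "f \<in> N \<Longrightarrow> g \<in> N \<Longrightarrow> f - g \<in> N"
  using N_add[of f "- g"] N_minus[of g] by simp

lemma N_sum: "(\<And>x. x \<in> X \<Longrightarrow> f x \<in> N) \<Longrightarrow> sum f X \<in> N"
  by (induction X rule: infinite_finite_induct) (auto intro: N_add)

lemma N_trunc: "trunc n f \<in> N \<longleftrightarrow> f \<in> N"
  by (simp add: N_def)

lemma N_diff_trunc: "f - trunc n f \<in> N"
proof -
  have "trunc n (f - trunc n f) = 0" by (simp add: trunc_diff)
  then show ?thesis using N_trunc[of "f - trunc n f"] by simp
qed

lemma proj_trunc: "proj (trunc n f) = proj f"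
  by (simp add: proj_def)

lemma bd_in_N: "T \<subseteq> {1..n} \<Longrightarrow> \<not> indep T \<Longrightarrow> bd T \<in> N"
proof -
  assume "T \<subseteq> {1..n}" "\<not> indep T"
  then have d: "dependent_set {1..n} indep T" by (simp add: dependent_set_def)
  then have "coeff (trunc n (bd T)) \<in> OS_ideal n indep"
    unfolding OS_ideal_def generator_eq[OF d, symmetric]
    using ring.genideal_self[OF ext_algebra_ring generators_carrier] by blast
  then show ?thesis by (simp add: N_def)
qed

text \<open>The kernel of the substitution, transported to the concrete ring as \<open>I\<close>, is
  an ideal. It contains the generators because a dependent set contains a circuit and inherits its
  collision.\<close>

lemma gsub_N:
  assumes coll: "\<And>C. circ C \<Longrightarrow> \<not> inj_on l C" and f: "f \<in> N"
  shows "gsub n l f = (0 :: 'k::field ext)"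
proof -
  let ?R = "ext_algebra n :: (nat set \<Rightarrow> 'k) ring"
  interpret R: ring ?R by (rule ext_algebra_ring)
  define I where "I = (\<lambda>h. coeff (trunc n h)) ` {h :: 'k ext. gsub n l h = 0}"
  have I: "coeff (trunc n h) \<in> I \<longleftrightarrow> gsub n l h = 0" for h :: "'k ext"
  proof
    assume "coeff (trunc n h) \<in> I"
    then obtain g where "coeff (trunc n h) = coeff (trunc n g)" "gsub n l g = 0"
      by (auto simp: I_def)
    then show "gsub n l h = 0" by (metis coeff_inject gsub_trunc)
  qed (auto simp: I_def)
  have "ideal I ?R"
  proof (rule idealI[OF ext_algebra_ring])
    show "subgroup I (add_monoid ?R)"
    proof (rule subgroup.intro)
      show "I \<subseteq> carrier (add_monoid ?R)" by (auto simp: I_def trunc_in_carrier)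
      fix x y assume "x \<in> I" "y \<in> I"
      then obtain f g :: "'k ext" where fg: "x = coeff (trunc n f)" "gsub n l f = 0" "y = coeff (trunc n g)" "gsub n l g = 0"
        by (auto simp: I_def)
      then have "x \<oplus>\<^bsub>?R\<^esub> y = coeff (trunc n (f + g))" by (simp add: ext_algebra_add trunc_add)
      then show "x \<otimes>\<^bsub>add_monoid ?R\<^esub> y \<in> I" using fg by (simp add: I gsub_add)
    next
      have "\<zero>\<^bsub>?R\<^esub> = coeff (trunc n 0)" by (simp add: ext_algebra_zero)
      then have "\<zero>\<^bsub>?R\<^esub> \<in> I" using I[of 0] by simp
      then show "\<one>\<^bsub>add_monoid ?R\<^esub> \<in> I" by simp
    next
      fix x assume "x \<in> I"
      then obtain f :: "'k ext" where f: "x = coeff (trunc n f)" "gsub n l f = 0" by (auto simp: I_def)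
      have "coeff (trunc n (- f)) \<oplus>\<^bsub>?R\<^esub> x = \<zero>\<^bsub>?R\<^esub>"
        by (simp add: f ext_algebra_add ext_algebra_zero trunc_add[symmetric])
      then have "\<ominus>\<^bsub>?R\<^esub> x = coeff (trunc n (- f))"
        using f by (intro R.minus_equality) (auto simp: trunc_in_carrier)
      then have "\<ominus>\<^bsub>?R\<^esub> x \<in> I" using f by (simp add: I gsub_minus)
      then show "inv\<^bsub>add_monoid ?R\<^esub> x \<in> I" by (simp add: a_inv_def)
    qed
    fix a x assume "a \<in> I" "x \<in> carrier ?R"
    then obtain f g :: "'k ext" where fg: "a = coeff (trunc n f)" "gsub n l f = 0" "x = coeff (trunc n g)"
      by (auto simp: I_def ext_algebra_carrier)
    have "x \<otimes>\<^bsub>?R\<^esub> a = coeff (trunc n (g * f))" "a \<otimes>\<^bsub>?R\<^esub> x = coeff (trunc n (f * g))"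
      by (simp_all add: fg ext_algebra_mult trunc_mult)
    then show "x \<otimes>\<^bsub>?R\<^esub> a \<in> I" "a \<otimes>\<^bsub>?R\<^esub> x \<in> I" using fg by (simp_all add: I gsub_mult)
  qed
  moreover have "{ext_boundary T | T. dependent_set {1..n} indep T} \<subseteq> I"
  proof clarify
    fix T assume T: "dependent_set {1..n} indep T"
    then obtain C where "circ C" "C \<subseteq> T" using obtain_circuit[of T] by (auto simp: dependent_set_def)
    then have "\<not> inj_on l T" using coll inj_on_subset by blast
    then have "gsub n l (bd T) = (0 :: 'k ext)" using T by (intro gsub_bd_collision) (auto simp: dependent_set_def)
    then show "ext_boundary T \<in> I" unfolding generator_eq[OF T] I .
  qed
  ultimately have "OS_ideal n indep \<subseteq> I" unfolding OS_ideal_def by (rule R.genideal_minimal)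
  then show ?thesis using f I by (auto simp: N_def)
qed

end

text \<open>A numerical weight in place of an order can be summed over a set; these sums drive both
  the rewriting and the triangularity argument. It is instantiated by the position in
  \<open>prec\<close> and by a weight that runs through the fibres of a fibration.\<close>

locale weighted_orlik_solomon = orlik_solomon n indep for n indep +
  fixes w :: "nat \<Rightarrow> nat"
  assumes w_inj: "inj_on w {1..n}"
begin

definition nbc :: "nat set \<Rightarrow> bool" where
  "nbc T \<longleftrightarrow> T \<subseteq> {1..n} \<and> (\<forall>C c. circ C \<longrightarrow> c \<in> C \<longrightarrow> (\<forall>x\<in>C. w c \<le> w x) \<longrightarrow> \<not> C - {c} \<subseteq> T)"

lemma nbc_subset: "nbc T \<Longrightarrow> T \<subseteq> {1..n}"
  by (simp add: nbc_def)

lemma finite_nbc: "finite {T. nbc T \<and> P T}"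
  by (rule finite_subset[of _ "Pow {1..n}"]) (auto simp: nbc_def)

text \<open>Multiplying the boundary of a circuit by the remaining variables trades an element of
  the broken circuit for the lightest element, which lowers the weight. A broken circuit inside a
  set of size \<open>p\<close> comes from a circuit of size at most \<open>p + 1\<close>, so only
  these are required to be relations. The set \<open>Z\<close> is left open because, besides
  \<open>N\<close>, the part of \<open>N\<close> killed by a substitution is used.\<close>

lemma straighten:
  fixes Z :: "'k::field ext set"
  assumes Z0: "0 \<in> Z" and Zadd: "\<And>f g. f \<in> Z \<Longrightarrow> g \<in> Z \<Longrightarrow> f + g \<in> Z"
    and Zmult: "\<And>f g. f \<in> Z \<Longrightarrow> g * f \<in> Z"
    and Zbd: "\<And>C. circ C \<Longrightarrow> card C \<le> p + 1 \<Longrightarrow> bd C \<in> Z"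
    and f: "trunc n f = f" "hom_deg p f"
  shows "\<exists>a. f - (\<Sum>T | nbc T \<and> card T = p. cst (a T) * emon T) \<in> Z"
proof -
  let ?B = "{T. nbc T \<and> card T = p}"
  define G where "G = {f. \<exists>a. f - (\<Sum>T\<in>?B. cst (a T) * emon T) \<in> Z}"
  have ZG: "f \<in> G" if "f \<in> Z" for f
    unfolding G_def using that by (intro CollectI exI[of _ "\<lambda>_. 0"]) simp
  have Gadd: "f + g \<in> G" if "f \<in> G" "g \<in> G" for f g
  proof -
    obtain a where a: "f - (\<Sum>T\<in>?B. cst (a T) * emon T) \<in> Z" using \<open>f \<in> G\<close> by (auto simp: G_def)
    obtain b where b: "g - (\<Sum>T\<in>?B. cst (b T) * emon T) \<in> Z" using \<open>g \<in> G\<close> by (auto simp: G_def)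
    from a b have "(f - (\<Sum>T\<in>?B. cst (a T) * emon T)) + (g - (\<Sum>T\<in>?B. cst (b T) * emon T)) \<in> Z" by (rule Zadd)
    then have "f + g - (\<Sum>T\<in>?B. cst (a T + b T) * emon T) \<in> Z"
      by (simp add: cst_add distrib_right sum.distrib algebra_simps)
    then show ?thesis unfolding G_def by (intro CollectI exI[of _ "\<lambda>T. a T + b T"])
  qed
  have Gcst: "cst c * f \<in> G" if "f \<in> G" for c f
  proof -
    obtain a where "f - (\<Sum>T\<in>?B. cst (a T) * emon T) \<in> Z" using \<open>f \<in> G\<close> by (auto simp: G_def)
    then have "cst c * (f - (\<Sum>T\<in>?B. cst (a T) * emon T)) \<in> Z" by (rule Zmult)
    then have "cst c * f - (\<Sum>T\<in>?B. cst (c * a T) * emon T) \<in> Z"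
      by (simp add: cst_mult right_diff_distrib sum_distrib_left mult.assoc)
    then show ?thesis unfolding G_def by (intro CollectI exI[of _ "\<lambda>T. c * a T"])
  qed
  have Gdiff: "f - g \<in> G" if "f \<in> G" "g \<in> G" for f g
    using Gadd[OF that(1) Gcst[OF that(2), of "- 1"]] by (simp add: cst_minus)
  have Gsum: "sum f X \<in> G" if "\<And>x. x \<in> X \<Longrightarrow> f x \<in> G" for X :: "'b set" and f
    using that by (induction X rule: infinite_finite_induct) (auto intro: Gadd ZG Z0)
  have Gemon: "emon U \<in> G" if "U \<subseteq> {1..n}" "card U = p" for U
    using that
  proof (induction "sum w U" arbitrary: U rule: less_induct)
    case less
    have finU: "finite U" using less.prems finite_if_ground by blast
    show ?case
    proof (cases "nbc U")
      case True
      have "(\<Sum>T\<in>?B. cst (if T = U then 1 else 0) * emon T) = (\<Sum>T\<in>?B. if T = U then (emon U :: 'k ext) else 0)"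
        by (rule sum.cong) auto
      also have "\<dots> = emon U" using True less.prems finite_nbc[of "\<lambda>T. card T = p"] by simp
      finally show ?thesis unfolding G_def using Z0
        by (intro CollectI exI[of _ "\<lambda>T. if T = U then 1 else 0"]) simp
    next
      case False
      then obtain C c where C: "circ C" "c \<in> C" "\<And>x. x \<in> C \<Longrightarrow> w c \<le> w x" "C - {c} \<subseteq> U"
        using less.prems by (auto simp: nbc_def)
      have finC: "finite C" and Cg: "C \<subseteq> {1..n}" using C circuit_finite circuit_ground by auto
      define R where "R = U - (C - {c})"
      have finR: "finite R" using finU by (simp add: R_def)
      have "card C \<le> p + 1"
        using card_mono[OF finU C(4)] less.prems finC C(2) by simp
      then have "emon R * bd C \<in> Z" using C(1) by (intro Zmult Zbd)
      moreover have "emon R * bd C = (\<Sum>i\<in>C. cst ((- 1) ^ card {j \<in> C. j < i}) * (emon R * (emon (C - {i}) :: 'k ext)))"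
        by (simp add: bd_def sum_distrib_left gen_cst_left_commute)
      ultimately have tot: "(\<Sum>i\<in>C. cst ((- 1) ^ card {j \<in> C. j < i}) * (emon R * (emon (C - {i}) :: 'k ext))) \<in> G"
        using ZG by simp
      \<comment> \<open>If the product is nonzero, the new set arises from \<open>U\<close> by
        exchanging \<open>i\<close> for the lighter \<open>c\<close>, and the induction hypothesis
        applies.\<close>
      have small: "emon R * emon (C - {i}) \<in> G" if i: "i \<in> C - {c}" for i
      proof (cases "R \<inter> (C - {i}) = {}")
        case True
        have cU: "c \<notin> U" using True i C(2) by (auto simp: R_def)
        have eq: "R \<union> (C - {i}) = insert c (U - {i})" using C(2,4) i by (auto simp: R_def)
        have iU: "i \<in> U" using C(4) i by blast
        have "w c < w i"
        proof -
          have "c \<in> {1..n}" "i \<in> {1..n}" using C(2) Cg i by blast+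
          then have "w c \<noteq> w i" using inj_onD[OF w_inj, of c i] i by blast
          moreover have "w c \<le> w i" using C(3) i by simp
          ultimately show ?thesis by simp
        qed
        then have "sum w (R \<union> (C - {i})) < sum w U"
          unfolding eq using cU iU finU by (simp add: sum.remove[of U i])
        moreover have "R \<union> (C - {i}) \<subseteq> {1..n}" using less.prems Cg by (auto simp: R_def)
        moreover have "card (R \<union> (C - {i})) = p"
          unfolding eq using cU card_Suc_Diff1[OF finU iU] finU less.prems(2)
          by (simp del: card_Diff_insert card_Diff_singleton)
        ultimately have "emon (R \<union> (C - {i})) \<in> G" by (rule less.hyps)
        then show ?thesis using True finR finC by (simp add: emon_mult Gcst)
      next
        case False
        then show ?thesis using finR finC by (simp add: emon_mult ZG Z0)
      qed
      have "(\<Sum>i\<in>C - {c}. cst ((- 1) ^ card {j \<in> C. j < i}) * (emon R * (emon (C - {i}) :: 'k ext))) \<in> G"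
        by (intro Gsum Gcst small)
      from Gdiff[OF tot this]
      have "cst ((- 1) ^ card {j \<in> C. j < c}) * (emon R * (emon (C - {c}) :: 'k ext)) \<in> G"
        unfolding sum.remove[OF finC C(2)] by simp
      then have "cst ((- 1) ^ card {j \<in> C. j < c}) * (cst ((- 1) ^ card {j \<in> C. j < c}) * (emon R * (emon (C - {c}) :: 'k ext))) \<in> G"
        by (rule Gcst)
      then have "emon R * (emon (C - {c}) :: 'k ext) \<in> G" by (simp add: cst_sign_cancel)
      moreover have "emon R * emon (C - {c}) = cst (ext_sign R (C - {c})) * (emon U :: 'k ext)"
        using finR finC C(4) by (auto simp: emon_mult R_def Un_absorb2)
      ultimately have "cst (ext_sign R (C - {c})) * (cst (ext_sign R (C - {c})) * (emon U :: 'k ext)) \<in> G"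
        using Gcst by simp
      then show ?thesis by (simp add: ext_sign_def cst_sign_cancel)
    qed
  qed
  have "f = (\<Sum>T\<in>Pow {1..n}. cst (coeff f T) * emon T)"
    using trunc_expand[of n f] f(1) by simp
  also have "\<dots> \<in> G"
  proof (rule Gsum)
    fix T assume T: "T \<in> Pow {1..n}"
    show "cst (coeff f T) * emon T \<in> G"
    proof (cases "card T = p")
      case True
      then show ?thesis using T by (intro Gcst Gemon) auto
    next
      case False
      then have "coeff f T = 0" using f(2) by (simp add: hom_deg_def)
      then show ?thesis using ZG Z0 by simp
    qed
  qed
  finally show ?thesis by (simp add: G_def)
qed

lemma straighten_N:
  assumes "hom_deg p f" "trunc n f = f"
  shows "\<exists>a. f - (\<Sum>T | nbc T \<and> card T = p. cst (a T) * emon T) \<in> N"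
  by (rule straighten) (use assms in \<open>auto intro: N_add N_mult_left bd_in_N[OF circuit_ground circuit_not_indep]\<close>)


subsection \<open>Independence of monomials\<close>

text \<open>A good set \<open>B\<close> determines a flag of flats spanned by its largest elements, from which it is
  recovered as the set of minima.\<close>

definition good :: "nat set \<Rightarrow> bool" where
  "good B \<longleftrightarrow> B \<subseteq> {1..n} \<and> (\<forall>b\<in>B. \<forall>s\<in>cl {b' \<in> B. w b \<le> w b'}. w b \<le> w s)"

lemma nbc_indep: "nbc T \<Longrightarrow> indep T"
proof (rule ccontr)
  assume T: "nbc T" "\<not> indep T"
  then obtain C where C: "circ C" "C \<subseteq> T" using obtain_circuit nbc_subset by blast
  then have "finite C" "C \<noteq> {}" using circuit_not_indep indep_empty circuit_finite by auto
  then obtain c where "c \<in> C" "\<forall>x\<in>C. w c \<le> w x" by (rule obtain_min)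
  then show False using T C unfolding nbc_def by blast
qed

text \<open>A lighter \<open>s\<close> in such a span would close a circuit whose lightest element
  is \<open>s\<close> and whose other elements lie in \<open>B\<close>, that is, a broken circuit
  inside \<open>B\<close>.\<close>

lemma nbc_good:
  assumes "nbc B" shows "good B"
  unfolding good_def
proof (intro conjI ballI)
  show "B \<subseteq> {1..n}" using assms nbc_subset by simp
  fix b s assume b: "b \<in> B" and s: "s \<in> cl {b' \<in> B. w b \<le> w b'}"
  let ?D = "{b' \<in> B. w b \<le> w b'}"
  show "w b \<le> w s"
  proof (rule ccontr)
    assume lt: "\<not> w b \<le> w s"
    have D: "indep ?D" using indep_mono[OF nbc_indep[OF assms]] by auto
    have sg: "s \<in> {1..n}" using s closure_subset_ground by blast
    have sD: "s \<notin> ?D" using lt by auto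
    then have "\<not> indep (insert s ?D)" using closure_indep_iff[OF D sg] s by simp
    moreover have "insert s ?D \<subseteq> {1..n}" using sg nbc_subset[OF assms] by auto
    ultimately obtain C where C: "circ C" "C \<subseteq> insert s ?D" using obtain_circuit by blast
    have "s \<in> C" using C D circuit_not_indep[OF C(1)] indep_mono[OF D, of C] by blast
    moreover have "\<forall>x\<in>C. w s \<le> w x" using C lt by auto
    moreover have "C - {s} \<subseteq> B" using C by auto
    ultimately show False using assms C(1) unfolding nbc_def by blast
  qed
qed

text \<open>Labels \<open>s\<close> by the smallest flat of the flag of \<open>B\<close> that
  contains it, named by the lightest of its spanning elements. The label \<open>n + 1\<close> marks
  the points outside the whole flag and is not a member of \<open>B\<close> when \<open>B\<close> is
  contained in \<open>{1..n}\<close>.\<close>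

definition lev :: "nat set \<Rightarrow> nat \<Rightarrow> nat" where
  "lev B s = (let P = {b \<in> B. s \<in> cl {b' \<in> B. w b \<le> w b'}} in
     if P = {} then n + 1 else SOME b. b \<in> P \<and> (\<forall>b'\<in>P. w b' \<le> w b))"

lemma lev_cases:
  assumes "good B"
  obtains (outside) "lev B s = n + 1" "\<And>b. b \<in> B \<Longrightarrow> s \<notin> cl {b' \<in> B. w b \<le> w b'}"
  | (inside) "lev B s \<in> B" "lev B s \<in> {1..n}" "s \<in> cl {b' \<in> B. w (lev B s) \<le> w b'}"
      "\<And>b. b \<in> B \<Longrightarrow> s \<in> cl {b' \<in> B. w b \<le> w b'} \<Longrightarrow> w b \<le> w (lev B s)"
      "w (lev B s) \<le> w s"
proof -
  let ?P = "{b \<in> B. s \<in> cl {b' \<in> B. w b \<le> w b'}}"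
  have B: "B \<subseteq> {1..n}" using assms by (simp add: good_def)
  show thesis
  proof (cases "?P = {}")
    case True
    then have "lev B s = n + 1" by (simp add: lev_def)
    moreover have "s \<notin> cl {b' \<in> B. w b \<le> w b'}" if "b \<in> B" for b using True that by blast
    ultimately show thesis by (rule outside)
  next
    case False
    have "finite ?P" using finite_if_ground[OF B] by simp
    then have ex: "\<exists>b. b \<in> ?P \<and> (\<forall>b'\<in>?P. w b' \<le> w b)"
      by (rule obtain_max[OF _ False, of w]) blast
    have "lev B s = (SOME b. b \<in> ?P \<and> (\<forall>b'\<in>?P. w b' \<le> w b))"
      unfolding lev_def Let_def using False by (rule if_not_P)
    then have l: "lev B s \<in> ?P" "\<forall>b'\<in>?P. w b' \<le> w (lev B s)" using someI_ex[OF ex] by simp_all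
    show thesis
    proof (rule inside)
      show "lev B s \<in> B" "s \<in> cl {b' \<in> B. w (lev B s) \<le> w b'}" using l(1) by auto
      then show "lev B s \<in> {1..n}" "w (lev B s) \<le> w s" using B assms unfolding good_def by blast+
      show "w b \<le> w (lev B s)" if "b \<in> B" "s \<in> cl {b' \<in> B. w b \<le> w b'}" for b
        using l(2) that by blast
    qed
  qed
qed

lemma lev_self:
  assumes B: "good B" and b: "b \<in> B" shows "lev B b = b"
proof -
  have Bg: "B \<subseteq> {1..n}" using B by (simp add: good_def)
  then have "{b' \<in> B. w b \<le> w b'} \<subseteq> {1..n}" by auto
  then have bcl: "b \<in> cl {b' \<in> B. w b \<le> w b'}" using subset_closure b by blast
  show ?thesis
    using B
  proof (cases rule: lev_cases[of B b])
    case outside then show ?thesis using b bcl by blast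
  next
    case inside
    then have "w (lev B b) = w b" using b bcl by (meson le_antisym)
    then show ?thesis using inj_onD[OF w_inj] inside(2) b Bg by blast
  qed
qed

text \<open>If the labels on a circuit are distinct, one element \<open>c\<close> has a strictly
  larger flat than all the others or lies outside the flag. The others then lie in the largest of
  their own flats, which contains \<open>c\<close> as well because \<open>c\<close> is in the
  closure of the rest of the circuit.\<close>

lemma lev_collision:
  assumes B: "good B" and C: "circ C"
  shows "\<not> inj_on (lev B) C"
proof
  assume inj: "inj_on (lev B) C"
  have Bg: "B \<subseteq> {1..n}" using B by (simp add: good_def)
  have finC: "finite C" using C circuit_finite by simp
  have cardC: "3 \<le> card C" using C circuit_card by simp
  have "\<exists>c\<in>C. \<forall>y\<in>C - {c}. lev B y \<in> B \<and> (lev B c \<in> B \<longrightarrow> w (lev B c) < w (lev B y))"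
  proof (cases "\<exists>c\<in>C. lev B c \<notin> B")
    case True
    then obtain c where c: "c \<in> C" "lev B c \<notin> B" by blast
    have l: "lev B x = n + 1" if "lev B x \<notin> B" for x
      by (cases rule: lev_cases[OF B, of x]) (use that in auto)
    have "lev B y \<in> B" if "y \<in> C - {c}" for y
      using inj_onD[OF inj, of y c] l[of y] l[of c] c that by auto
    then show ?thesis using c by blast
  next
    case False
    have "C \<noteq> {}" using cardC by auto
    then obtain c where c: "c \<in> C" "\<forall>y\<in>C. w (lev B c) \<le> w (lev B y)"
      by (rule obtain_min[OF finC])
    have "w (lev B c) < w (lev B y)" if y: "y \<in> C - {c}" for y
    proof -
      have "w (lev B c) \<le> w (lev B y)" using c(2) y by simp
      moreover have "lev B c \<in> {1..n}" "lev B y \<in> {1..n}" using False c y Bg by auto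
      then have "w (lev B c) \<noteq> w (lev B y)"
        using inj_onD[OF w_inj] inj_onD[OF inj, of y c] y c(1) by auto
      ultimately show ?thesis by simp
    qed
    then show ?thesis using False c by blast
  qed
  then obtain c where c: "c \<in> C" and oth: "\<And>y. y \<in> C - {c} \<Longrightarrow> lev B y \<in> B \<and> (lev B c \<in> B \<longrightarrow> w (lev B c) < w (lev B y))"
    by blast
  have "card (C - {c}) \<noteq> 0" using cardC c by (simp add: card_Diff_singleton)
  then have ne: "C - {c} \<noteq> {}" by (metis card.empty)
  obtain m where m: "m \<in> C - {c}" "\<forall>y\<in>C - {c}. w (lev B m) \<le> w (lev B y)"
    by (rule obtain_min[OF finite_Diff[OF finC] ne])
  let ?D = "{b' \<in> B. w (lev B m) \<le> w b'}"
  have Dg: "?D \<subseteq> {1..n}" using Bg by auto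
  have "C - {c} \<subseteq> cl ?D"
  proof
    fix y assume y: "y \<in> C - {c}"
    have le: "w (lev B m) \<le> w (lev B y)" by (rule bspec[OF m(2) y])
    have "y \<in> cl {b' \<in> B. w (lev B y) \<le> w b'}"
      by (cases rule: lev_cases[OF B, of y]) (use oth[OF y] Bg in auto)
    moreover have "{b' \<in> B. w (lev B y) \<le> w b'} \<subseteq> ?D" using le by auto
    ultimately show "y \<in> cl ?D" using closure_mono by blast
  qed
  from closure_mono[OF this] have "cl (C - {c}) \<subseteq> cl ?D" unfolding closure_idem[OF Dg] .
  then have cD: "c \<in> cl ?D" using circuit_in_closure[OF C c] by blast
  have mB: "lev B m \<in> B" using oth m by blast
  show False
    using B
  proof (cases rule: lev_cases[of B c])
    case outside then show False using cD mB by blast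
  next
    case inside
    then have "w (lev B m) \<le> w (lev B c)" using cD mB by blast
    moreover have "w (lev B c) < w (lev B m)" using oth[OF m(1)] inside(1) by simp
    ultimately show False by simp
  qed
qed

text \<open>It descends to \<open>A\<close> because \<open>lev B\<close> collides on every circuit,
  and it detects \<open>emon B\<close> because \<open>lev B\<close> fixes \<open>B\<close>
  pointwise.\<close>

definition func :: "nat set \<Rightarrow> 'k::field ext \<Rightarrow> 'k" where
  "func B f = coeff (gsub n (lev B) f) B"

lemma func_N: "good B \<Longrightarrow> f \<in> N \<Longrightarrow> func B f = 0"
  using gsub_N[of "lev B" f] lev_collision by (simp add: func_def)

lemma func_add: "func B (f + g) = func B f + func B g"
  by (simp add: func_def gsub_add)

lemma func_cst_mult: "func B (cst c * f) = c * func B f"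
  by (simp add: func_def gsub_cst_mult)

lemma func_sum: "func B (sum f X) = (\<Sum>x\<in>X. func B (f x))"
  by (simp add: func_def gsub_sum)

lemma func_self:
  assumes "good B" shows "func B (emon B) \<noteq> (0 :: 'k::field)"
proof -
  have Bg: "B \<subseteq> {1..n}" using assms by (simp add: good_def)
  have im: "lev B ` B = B" and inj: "inj_on (lev B) B" using lev_self[OF assms] by (auto simp: inj_on_def image_iff)
  obtain s where "s \<noteq> 0" "gsub n (lev B) (emon B) = cst s * (emon (lev B ` B) :: 'k ext)"
    using gsub_emon_cases(2)[OF Bg inj] by blast
  then show ?thesis using finite_if_ground[OF Bg] unfolding im by (simp add: func_def coeff_emon)
qed

text \<open>Triangularity: a label in \<open>B\<close> is never heavier than the point it labels. If
  the labels map \<open>T\<close> bijectively to \<open>B\<close>, then \<open>B\<close> is at most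
  as heavy as \<open>T\<close>, with equality only if every point is its own label.\<close>

lemma func_emon:
  assumes B: "good B" and T: "T \<subseteq> {1..n}" and nz: "func B (emon T) \<noteq> (0 :: 'k::field)"
  shows "T = B \<or> sum w B < sum w T"
proof -
  have Bg: "B \<subseteq> {1..n}" using B by (simp add: good_def)
  have inj: "inj_on (lev B) T"
  proof (rule ccontr)
    assume "\<not> inj_on (lev B) T"
    then have "gsub n (lev B) (emon T) = (0 :: 'k ext)" by (rule gsub_emon_cases(1)[OF T])
    then show False using nz by (simp add: func_def)
  qed
  obtain s where s: "gsub n (lev B) (emon T) = cst s * (emon (lev B ` T) :: 'k ext)"
    using gsub_emon_cases(2)[OF T inj] by blast
  have im: "lev B ` T = B"
    using nz finite_if_ground[OF Bg] by (auto simp: func_def s coeff_emon split: if_splits)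
  have le: "w (lev B t) \<le> w t" if "t \<in> T" for t
  proof -
    have "lev B t \<in> B" using that im by blast
    then show ?thesis using Bg by (cases rule: lev_cases[OF B, of t]) auto
  qed
  have eq: "sum w B = (\<Sum>t\<in>T. w (lev B t))"
    using sum.reindex[OF inj, of w] im by (simp add: comp_def)
  show ?thesis
  proof (cases "\<exists>t\<in>T. w (lev B t) < w t")
    case True
    then have "sum w B < sum w T"
      unfolding eq using finite_if_ground[OF T] le by (intro sum_strict_mono_ex1) auto
    then show ?thesis by simp
  next
    case False
    have "lev B t = t" if t: "t \<in> T" for t
    proof (rule inj_onD[OF w_inj])
      show "w (lev B t) = w t" using False le[OF t] t by (meson le_neq_implies_less)
      show "t \<in> {1..n}" using T t by blast
      have "lev B t \<in> B" using im t by blast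
      then show "lev B t \<in> {1..n}" using Bg by blast
    qed
    then show ?thesis using im by simp
  qed
qed

text \<open>The functional of a monomial of maximal weight among those with a nonzero coefficient
  vanishes on all the others.\<close>

lemma good_independent:
  fixes a :: "nat set \<Rightarrow> 'k::field"
  assumes fin: "finite F" and F: "\<And>T. T \<in> F \<Longrightarrow> good T"
    and N: "(\<Sum>T\<in>F. cst (a T) * emon T) \<in> N" and T: "T \<in> F"
  shows "a T = 0"
proof (rule ccontr)
  assume "a T \<noteq> 0"
  let ?S = "{T \<in> F. a T \<noteq> 0}"
  have S: "finite ?S" "?S \<noteq> {}" using fin T \<open>a T \<noteq> 0\<close> by auto
  obtain B where B: "B \<in> ?S" and mx[rule_format]: "\<forall>T\<in>?S. sum w T \<le> sum w B"
    by (rule obtain_max[OF S])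
  have gB: "good B" using B F by simp
  have "0 = func B (\<Sum>T\<in>F. cst (a T) * emon T)" using func_N[OF gB N] by simp
  also have "\<dots> = (\<Sum>T\<in>F. a T * func B (emon T))" by (simp add: func_sum func_cst_mult)
  also have "\<dots> = (\<Sum>T\<in>F. if T = B then a B * func B (emon B) else 0)"
  proof (rule sum.cong)
    fix T assume T: "T \<in> F"
    have "func B (emon T) = (0 :: 'k)" if "T \<noteq> B" "a T \<noteq> 0"
    proof (rule ccontr)
      assume nz: "func B (emon T) \<noteq> (0 :: 'k)"
      have "T \<subseteq> {1..n}" using F[OF T] by (simp add: good_def)
      then show False using func_emon[OF gB _ nz] mx[of T] T that by auto
    qed
    then show "a T * func B (emon T) = (if T = B then a B * func B (emon B) else 0)" by auto
  qed simp
  also have "\<dots> = a B * func B (emon B)" using B fin by simp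
  finally show False using B func_self[OF gB, where 'k='k] by auto
qed

text \<open>A single coefficient function serves the element and all its homogeneous components at
  once; this is what \<open>N_hcomp\<close> relies on.\<close>

lemma nbc_span:
  fixes f :: "'k::field ext"
  shows "\<exists>b. f - (\<Sum>T | nbc T. cst (b T) * emon T) \<in> N \<and>
    (\<forall>p. hcomp p (trunc n f) - (\<Sum>T | nbc T \<and> card T = p. cst (b T) * emon T) \<in> N)"
proof -
  have "\<forall>q. \<exists>a. hcomp q (trunc n f) - (\<Sum>T | nbc T \<and> card T = q. cst (a T) * emon T) \<in> N"
    by (intro allI straighten_N) (simp_all add: hcomp_trunc[symmetric])
  then obtain a where a: "\<And>q. hcomp q (trunc n f) - (\<Sum>T | nbc T \<and> card T = q. cst (a q T) * emon T) \<in> N"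
    by metis
  define b where "b T = a (card T) T" for T
  have b: "hcomp q (trunc n f) - (\<Sum>T | nbc T \<and> card T = q. cst (b T) * emon T) \<in> N" for q
  proof -
    have "(\<Sum>T | nbc T \<and> card T = q. cst (b T) * (emon T :: 'k ext)) = (\<Sum>T | nbc T \<and> card T = q. cst (a q T) * emon T)"
      by (rule sum.cong) (auto simp: b_def)
    then show ?thesis using a by simp
  qed
  have cardn: "card T \<le> n" if "nbc T" for T
    using card_mono[of "{1..n}" T] nbc_subset[OF that] by simp
  have "(\<Sum>q\<le>n. hcomp q (trunc n f) - (\<Sum>T | nbc T \<and> card T = q. cst (b T) * emon T)) \<in> N"
    by (rule N_sum) (rule b)
  moreover have "(\<Sum>q\<le>n. \<Sum>T\<in>{T \<in> {T. nbc T}. card T = q}. cst (b T) * emon T) = (\<Sum>T | nbc T. cst (b T) * (emon T :: 'k ext))"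
    by (rule sum.group) (use finite_nbc[of "\<lambda>_. True"] cardn in auto)
  ultimately have "trunc n f - (\<Sum>T | nbc T. cst (b T) * emon T) \<in> N"
    using trunc_eq_sum_hcomp[of n f] by (simp add: sum_subtractf)
  from N_add[OF N_diff_trunc[of f] this]
  have "f - (\<Sum>T | nbc T. cst (b T) * emon T) \<in> N" by simp
  then show ?thesis using b by (intro exI[of _ b] conjI allI)
qed

text \<open>The normal form of an element of \<open>N\<close> has zero coefficients by independence,
  and these are also the coefficients of the normal forms of its components.\<close>

lemma N_hcomp:
  assumes f: "f \<in> N" shows "hcomp p f \<in> (N :: 'k::field ext set)"
proof -
  obtain b where b: "f - (\<Sum>T | nbc T. cst (b T) * emon T) \<in> N"
    "\<forall>p. hcomp p (trunc n f) - (\<Sum>T | nbc T \<and> card T = p. cst (b T) * emon T) \<in> N"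
    using nbc_span[of f] by (elim exE conjE)
  have "(\<Sum>T | nbc T. cst (b T) * emon T) \<in> N" using N_diff[OF f b(1)] by simp
  then have b0: "b T = 0" if "nbc T" for T
    using good_independent[of "{T. nbc T}" b] finite_nbc[of "\<lambda>_. True"] nbc_good that by auto
  have "(\<Sum>T | nbc T \<and> card T = p. cst (b T) * (emon T :: 'k ext)) = 0"
    using b0 by (intro sum.neutral) auto
  then have "hcomp p (trunc n f) \<in> N" using b(2)[rule_format, of p] by simp
  then show ?thesis by (simp add: hcomp_trunc N_trunc)
qed

end


section \<open>The Poincare polynomial\<close>

context weighted_orlik_solomon
begin

lemma empty_nbc: "nbc {}"
  unfolding nbc_def
proof (intro conjI allI impI)
  fix C c assume "circ C" "c \<in> C"
  then have "3 \<le> card C" using circuit_card by simp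
  then have "card (C - {c}) \<noteq> card {}" using \<open>c \<in> C\<close> by simp
  then show "\<not> C - {c} \<subseteq> {}" by (metis subset_empty)
qed simp

text \<open>Independence of the empty monomial. It says that the field embeds into \<open>A\<close>,
  so that dimensions over its image make sense.\<close>

lemma cst_in_N: "cst c \<in> N \<longleftrightarrow> c = (0 :: 'k::field)"
proof
  assume "cst c \<in> (N :: 'k ext set)"
  then have "(\<Sum>T\<in>{{}}. cst c * (emon T :: 'k ext)) \<in> N" by (simp add: emon_empty)
  from good_independent[of "{{}}" "\<lambda>_. c" "{}", OF _ _ this] show "c = 0"
    by (simp add: nbc_good empty_nbc)
qed simp

lemma OS_scalars_eq: "OS_scalars n indep = range (\<lambda>c :: 'k::field. proj (cst c))"
proof -
  have "coeff (trunc n (cst c)) = (\<lambda>U. c * ext_basis {} U)" for c :: 'k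
    by (rule HOL.ext) (simp add: coeff_cst ext_basis_def)
  then show ?thesis by (simp add: OS_scalars_def ext_scalars_def proj_def image_image)
qed

lemma OS_homogeneous_eq: "OS_homogeneous n indep p = proj ` {f :: 'k::field ext. hom_deg p f}"
proof
  show "OS_homogeneous n indep p \<subseteq> proj ` {f :: 'k ext. hom_deg p f}"
  proof
    fix x :: "(nat set \<Rightarrow> 'k) set" assume "x \<in> OS_homogeneous n indep p"
    then obtain h where h: "h \<in> carrier (ext_algebra n)" "\<And>U. card U \<noteq> p \<Longrightarrow> h U = 0" "x = OS_coset n indep h"
      by (auto simp: OS_homogeneous_def ext_homogeneous_def)
    then obtain f :: "'k ext" where f: "h = coeff (trunc n f)" by (auto simp: ext_algebra_carrier)
    have "hom_deg p (trunc n f)" using h(2) f by (simp add: hom_deg_def)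
    moreover have "x = proj (trunc n f)" using h f by (simp add: proj_def)
    ultimately show "x \<in> proj ` {f. hom_deg p f}" by blast
  qed
  show "proj ` {f :: 'k ext. hom_deg p f} \<subseteq> OS_homogeneous n indep p"
  proof clarify
    fix f :: "'k ext" assume "hom_deg p f"
    then have "hom_deg p (trunc n f)" by (rule hom_deg_trunc)
    then have "coeff (trunc n f) \<in> ext_homogeneous n p"
      using trunc_in_carrier[of n f] by (simp add: ext_homogeneous_def hom_deg_def)
    then show "proj f \<in> OS_homogeneous n indep p"
      unfolding OS_homogeneous_def proj_def by (rule imageI)
  qed
qed

lemma OS_scalars_subfield: "subfield (OS_scalars n indep) (A :: (nat set \<Rightarrow> 'k::field) set ring)"
proof -
  interpret A: ring "A :: (nat set \<Rightarrow> 'k) set ring" by (rule A_ring)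
  let ?K = "OS_scalars n indep :: (nat set \<Rightarrow> 'k) set set"
  have K: "?K = range (\<lambda>c. proj (cst c))" by (rule OS_scalars_eq)
  have one: "\<one>\<^bsub>A\<^esub> = proj (cst 1 :: 'k ext)" and zero: "\<zero>\<^bsub>A\<^esub> = proj (cst 0 :: 'k ext)"
    by (simp_all add: proj_one proj_zero)
  have sc: "subcring ?K A"
  proof (rule A.subcringI[OF A.subringI])
    show "?K \<subseteq> carrier A" by (auto simp: K)
    show "\<one>\<^bsub>A\<^esub> \<in> ?K" unfolding K one by blast
    fix h assume "h \<in> ?K"
    then obtain c where h: "h = proj (cst c)" by (auto simp: K)
    have "proj (cst (- c)) \<oplus>\<^bsub>A\<^esub> h = \<zero>\<^bsub>A\<^esub>"
      by (simp add: h proj_add[symmetric] cst_minus proj_zero)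
    then have "\<ominus>\<^bsub>A\<^esub> h = proj (cst (- c))" using h by (intro A.minus_equality) auto
    then show "\<ominus>\<^bsub>A\<^esub> h \<in> ?K" by (auto simp: K)
  next
    fix h1 h2 assume "h1 \<in> ?K" "h2 \<in> ?K"
    then obtain c d where h: "h1 = proj (cst c)" "h2 = proj (cst d)" by (auto simp: K)
    show "h1 \<otimes>\<^bsub>A\<^esub> h2 \<in> ?K" "h1 \<oplus>\<^bsub>A\<^esub> h2 \<in> ?K"
      unfolding h proj_mult[symmetric] proj_add[symmetric] cst_mult[symmetric] cst_add[symmetric] K by blast+
    show "h1 \<otimes>\<^bsub>A\<^esub> h2 = h2 \<otimes>\<^bsub>A\<^esub> h1"
      unfolding h proj_mult[symmetric] cst_commute[of "cst c" d] ..
  qed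
  have inj: "proj (cst c) = proj (cst d) \<longleftrightarrow> c = d" for c d :: 'k
  proof -
    have "cst c - cst d = cst (c - d)" using cst_add[of c "- d"] by (simp add: cst_minus)
    then show ?thesis by (simp add: proj_eq_iff cst_in_N)
  qed
  show ?thesis
  proof (rule A.subfieldI[OF sc])
    show "Units (A\<lparr>carrier := ?K\<rparr>) = ?K - {\<zero>\<^bsub>A\<^esub>}"
    proof
      show "Units (A\<lparr>carrier := ?K\<rparr>) \<subseteq> ?K - {\<zero>\<^bsub>A\<^esub>}"
      proof
        fix u assume u: "u \<in> Units (A\<lparr>carrier := ?K\<rparr>)"
        then have "u \<in> ?K" "\<exists>v\<in>?K. v \<otimes>\<^bsub>A\<^esub> u = \<one>\<^bsub>A\<^esub>" by (simp_all add: Units_def) blast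
        then obtain c d where cd: "u = proj (cst c)" "proj (cst d) \<otimes>\<^bsub>A\<^esub> u = \<one>\<^bsub>A\<^esub>"
          unfolding K by blast
        have "proj (cst (d * c)) = proj (cst 1 :: 'k ext)"
          using cd by (simp add: one proj_mult cst_mult)
        then have "c \<noteq> 0" unfolding inj by auto
        then have "proj (cst c) \<noteq> proj (cst 0 :: 'k ext)" unfolding inj .
        then show "u \<in> ?K - {\<zero>\<^bsub>A\<^esub>}" unfolding zero cd(1) K by blast
      qed
      show "?K - {\<zero>\<^bsub>A\<^esub>} \<subseteq> Units (A\<lparr>carrier := ?K\<rparr>)"
      proof
        fix u assume u: "u \<in> ?K - {\<zero>\<^bsub>A\<^esub>}"
        then have "u \<in> ?K" by blast
        then obtain c where c: "u = proj (cst c)" unfolding K by blast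
        moreover have "c \<noteq> 0" using u c unfolding zero by blast
        note c = c this
        have "proj (cst (inverse c)) \<otimes>\<^bsub>A\<^esub> u = \<one>\<^bsub>A\<^esub>" "u \<otimes>\<^bsub>A\<^esub> proj (cst (inverse c)) = \<one>\<^bsub>A\<^esub>"
          using c by (simp_all add: one proj_mult[symmetric] cst_mult[symmetric])
        moreover have "proj (cst (inverse c)) \<in> ?K" unfolding K by blast
        ultimately show "u \<in> Units (A\<lparr>carrier := ?K\<rparr>)"
          unfolding Units_def using u by (simp; blast)
      qed
    qed
  qed
qed

lemma dim_OS_homogeneous:
  "ring.dim (A :: (nat set \<Rightarrow> 'k::field) set ring) (OS_scalars n indep) (OS_homogeneous n indep p)
     = card {T. nbc T \<and> card T = p}"
proof -
  interpret A: ring "A :: (nat set \<Rightarrow> 'k) set ring" by (rule A_ring)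
  let ?K = "OS_scalars n indep :: (nat set \<Rightarrow> 'k) set set"
  let ?u = "\<lambda>T. proj (emon T :: 'k ext)"
  let ?c = "\<lambda>Ts a. \<Sum>T\<in>set Ts. cst (a T) * (emon T :: 'k ext)"
  have span: "A.Span ?K (map ?u Ts) = range (\<lambda>a. proj (?c Ts a))" if "distinct Ts" for Ts
    using that
  proof (induction Ts)
    case Nil
    then show ?case by (simp add: proj_zero)
  next
    case (Cons T Ts)
    have "x \<in> A.Span ?K (map ?u (T # Ts)) \<longleftrightarrow> x \<in> range (\<lambda>a. proj (?c (T # Ts) a))" for x
    proof
      assume "x \<in> A.Span ?K (map ?u (T # Ts))"
      then obtain k v where kv: "k \<in> ?K" "v \<in> A.Span ?K (map ?u Ts)" "x = k \<otimes>\<^bsub>A\<^esub> ?u T \<oplus>\<^bsub>A\<^esub> v"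
        by (auto simp: A.line_extension_mem_iff)
      obtain c where c: "k = proj (cst c)" using kv(1) by (auto simp: OS_scalars_eq)
      obtain a where a: "v = proj (?c Ts a)" using Cons kv(2) by auto
      have "?c (T # Ts) (a(T := c)) = cst c * emon T + ?c Ts a"
        using Cons.prems by (auto intro!: sum.cong)
      then have "x = proj (?c (T # Ts) (a(T := c)))"
        unfolding kv(3) c a by (simp add: proj_add proj_mult)
      then show "x \<in> range (\<lambda>a. proj (?c (T # Ts) a))" by blast
    next
      assume "x \<in> range (\<lambda>a. proj (?c (T # Ts) a))"
      then obtain a where "x = proj (?c (T # Ts) a)" by blast
      then have "x = proj (cst (a T)) \<otimes>\<^bsub>A\<^esub> ?u T \<oplus>\<^bsub>A\<^esub> proj (?c Ts a)"
        using Cons.prems by (simp add: proj_add proj_mult)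
      moreover have "proj (cst (a T)) \<in> ?K" by (simp add: OS_scalars_eq)
      moreover have "proj (?c Ts a) \<in> A.Span ?K (map ?u Ts)" using Cons by auto
      ultimately show "x \<in> A.Span ?K (map ?u (T # Ts))" by (auto simp: A.line_extension_mem_iff)
    qed
    then show ?case by blast
  qed
  have ind: "A.independent ?K (map ?u Ts)" if "distinct Ts" "\<And>T. T \<in> set Ts \<Longrightarrow> nbc T" for Ts
    using that
  proof (induction Ts)
    case (Cons T Ts)
    have "?u T \<notin> A.Span ?K (map ?u Ts)"
    proof
      assume "?u T \<in> A.Span ?K (map ?u Ts)"
      then obtain a where "?u T = proj (?c Ts a)" using span Cons.prems(1) by auto
      then have "emon T - ?c Ts a \<in> N" by (simp add: proj_eq_iff)
      moreover have "emon T - ?c Ts a = ?c (T # Ts) ((\<lambda>S. - a S)(T := 1))"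
      proof -
        have "?c Ts ((\<lambda>S. - a S)(T := 1)) = - ?c Ts a"
          unfolding sum_negf[symmetric] using Cons.prems(1) by (intro sum.cong) (auto simp: cst_minus)
        then show ?thesis using Cons.prems(1) by simp
      qed
      ultimately have "(\<Sum>S\<in>set (T # Ts). cst (((\<lambda>S. - a S)(T := 1)) S) * (emon S :: 'k ext)) \<in> N" by simp
      then have "((\<lambda>S. - a S)(T := 1)) T = (0 :: 'k)"
        by (rule good_independent[rotated 2]) (use Cons.prems nbc_good in auto)
      then show False by simp
    qed
    then show ?case using Cons by (simp add: A.li_Cons)
  qed simp
  obtain Ts where Ts: "distinct Ts" "set Ts = {T. nbc T \<and> card T = p}"
    using finite_distinct_list[OF finite_nbc] by metis
  have "A.Span ?K (map ?u Ts) = OS_homogeneous n indep p"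
    unfolding span[OF Ts(1)] OS_homogeneous_eq
  proof
    show "range (\<lambda>a. proj (?c Ts a)) \<subseteq> proj ` {f. hom_deg p f}"
    proof clarify
      fix a
      have "hom_deg p (?c Ts a)"
      proof (rule hom_deg_sum)
        fix T assume "T \<in> set Ts"
        then have "finite T" "card T = p" using Ts nbc_subset finite_if_ground by auto
        then show "hom_deg p (cst (a T) * emon T)" using hom_deg_emon[of T] by (intro hom_deg_cst_mult) simp
      qed
      then show "proj (?c Ts a) \<in> proj ` {f. hom_deg p f}" by blast
    qed
    show "proj ` {f. hom_deg p f} \<subseteq> range (\<lambda>a. proj (?c Ts a))"
    proof clarify
      fix f :: "'k ext" assume "hom_deg p f"
      then have "hom_deg p (trunc n f)" by (rule hom_deg_trunc)
      then obtain a where "trunc n f - ?c Ts a \<in> N" using straighten_N[of p "trunc n f"] Ts by auto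
      then have "proj f = proj (?c Ts a)" by (simp add: proj_eq_iff[symmetric] proj_trunc)
      then show "proj f \<in> range (\<lambda>a. proj (?c Ts a))" by blast
    qed
  qed
  then have "A.dimension (length (map ?u Ts)) ?K (OS_homogeneous n indep p)"
    using A.dimension_independent[OF ind[OF Ts(1)]] Ts by auto
  then have "A.dim ?K (OS_homogeneous n indep p) = length (map ?u Ts)"
    using A.dimI[OF OS_scalars_subfield] by (simp add: over_def)
  also have "\<dots> = card {T. nbc T \<and> card T = p}"
    using distinct_card[OF Ts(1)] Ts(2) by simp
  finally show ?thesis .
qed

lemma OS_poincare_nbc: "OS_poincare TYPE('k::field) n indep = (\<Sum>T | nbc T. [:0, 1:] ^ card T)"
proof -
  have "OS_poincare TYPE('k) n indep =
      (\<Sum>p\<le>rk {1..n}. Polynomial.monom (int (card {T. nbc T \<and> card T = p})) p)"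
    unfolding OS_poincare_def dim_OS_homogeneous ..
  also have "\<dots> = (\<Sum>p\<le>rk {1..n}. \<Sum>T | nbc T \<and> card T = p. [:0, 1:] ^ card T)"
    by (rule sum.cong) (simp_all add: monom_altdef of_nat_poly)
  also have "\<dots> = (\<Sum>p\<le>rk {1..n}. \<Sum>T\<in>{T \<in> {T. nbc T}. card T = p}. [:0, 1:] ^ card T)"
    by simp
  also have "\<dots> = (\<Sum>T | nbc T. [:0, 1:] ^ card T)"
    by (rule sum.group) (use finite_nbc[of "\<lambda>_. True"] rank_ge[OF nbc_subset nbc_indep] in auto)
  finally show ?thesis .
qed

end

section \<open>Counting the sets that contain no member of a disjoint family\<close>

lemma sum_Pow_power_card:
  fixes x :: "'a::comm_ring_1"
  assumes "finite X" shows "(\<Sum>T\<in>Pow X. x ^ card T) = (1 + x) ^ card X"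
  using assms
proof (induction X)
  case (insert a X)
  have "(\<Sum>T\<in>Pow (insert a X). x ^ card T) = (\<Sum>T\<in>Pow X. x ^ card T) + (\<Sum>T\<in>insert a ` Pow X. x ^ card T)"
    unfolding Pow_insert by (rule sum.union_disjoint) (use insert in auto)
  also have "(\<Sum>T\<in>insert a ` Pow X. x ^ card T) = (\<Sum>T\<in>Pow X. x ^ card (insert a T))"
    by (rule sum.reindex_cong[of "insert a"]) (use insert in \<open>auto simp: inj_on_def\<close>)
  also have "\<dots> = (\<Sum>T\<in>Pow X. x * x ^ card T)"
  proof (rule sum.cong)
    fix T assume "T \<in> Pow X"
    then have "finite T" "a \<notin> T" using insert finite_subset by auto
    then show "x ^ card (insert a T) = x * x ^ card T" by simp
  qed simp
  finally show ?case using insert by (simp add: sum_distrib_left[symmetric] algebra_simps)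
qed simp

text \<open>Since \<open>Q\<close> is disjoint from the other members, an avoiding set is a proper
  subset of \<open>Q\<close> together with an avoiding subset of the complement; the generating
  function factors accordingly.\<close>

lemma sum_avoiding_disjoint:
  fixes x :: "'a::comm_ring_1"
  assumes "finite QQ" "finite X" "\<And>Q. Q \<in> QQ \<Longrightarrow> Q \<subseteq> X" "pairwise disjnt QQ"
  shows "(\<Sum>T | T \<subseteq> X \<and> (\<forall>Q\<in>QQ. \<not> Q \<subseteq> T). x ^ card T) =
    (1 + x) ^ (card X - (\<Sum>Q\<in>QQ. card Q)) * (\<Prod>Q\<in>QQ. (1 + x) ^ card Q - x ^ card Q)"
  using assms
proof (induction QQ arbitrary: X rule: finite_induct)
  case empty
  then show ?case using sum_Pow_power_card[of X x] by (simp add: Pow_def)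
next
  case (insert Q QQ)
  let ?X = "X - Q" and ?P = "\<lambda>T. \<forall>Q\<in>QQ. \<not> Q \<subseteq> T"
  have disj: "P \<inter> Q = {}" if "P \<in> QQ" for P
    using insert.prems(3) insert.hyps(2) that by (auto simp: pairwise_def disjnt_def)
  have QX: "Q \<subseteq> X" using insert.prems(2) by simp
  then have QX: "Q \<subseteq> X" "finite Q" using insert.prems(1) by (simp_all add: finite_subset)
  have IH: "(\<Sum>T | T \<subseteq> ?X \<and> ?P T. x ^ card T) =
    (1 + x) ^ (card ?X - (\<Sum>Q\<in>QQ. card Q)) * (\<Prod>Q\<in>QQ. (1 + x) ^ card Q - x ^ card Q)"
    by (rule insert.IH) (use insert.prems disj in \<open>auto simp: pairwise_insert\<close>)
  have "(\<Sum>T | T \<subseteq> X \<and> (\<forall>Q\<in>insert Q QQ. \<not> Q \<subseteq> T). x ^ card T) =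
    (\<Sum>(U, T)\<in>(Pow Q - {Q}) \<times> {T. T \<subseteq> ?X \<and> ?P T}. x ^ card U * x ^ card T)"
  proof (rule sum.reindex_bij_witness[of _ "\<lambda>(U, T). U \<union> T" "\<lambda>T. (T \<inter> Q, T - Q)"])
    fix T assume T: "T \<in> {T. T \<subseteq> X \<and> (\<forall>Q\<in>insert Q QQ. \<not> Q \<subseteq> T)}"
    have "finite T" using T insert.prems(1) finite_subset by auto
    then have "card T = card (T \<inter> Q) + card (T - Q)" by (metis Int_Diff_disjoint Int_Diff_Un card_Un_disjoint finite_Diff finite_Int)
    then show "(case (T \<inter> Q, T - Q) of (U, T) \<Rightarrow> x ^ card U * x ^ card T) = x ^ card T"
      by (simp add: power_add)
    show "(case (T \<inter> Q, T - Q) of (U, T) \<Rightarrow> U \<union> T) = T" by auto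
    show "(T \<inter> Q, T - Q) \<in> (Pow Q - {Q}) \<times> {T. T \<subseteq> ?X \<and> ?P T}" using T by auto
  next
    fix p assume "p \<in> (Pow Q - {Q}) \<times> {T. T \<subseteq> ?X \<and> ?P T}"
    then obtain U T where p: "p = (U, T)" "U \<subset> Q" "T \<subseteq> ?X" "?P T" by auto
    show "(\<lambda>T. (T \<inter> Q, T - Q)) (case p of (U, T) \<Rightarrow> U \<union> T) = p" using p by auto
    have "\<not> P \<subseteq> U \<union> T" if "P \<in> QQ" for P
      using disj[OF that] p that by blast
    then show "(case p of (U, T) \<Rightarrow> U \<union> T) \<in> {T. T \<subseteq> X \<and> (\<forall>Q\<in>insert Q QQ. \<not> Q \<subseteq> T)}"
      using p QX by auto
  qed
  also have "\<dots> = (\<Sum>U\<in>Pow Q - {Q}. x ^ card U) * (\<Sum>T | T \<subseteq> ?X \<and> ?P T. x ^ card T)"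
    by (simp add: sum_product sum.cartesian_product)
  also have "(\<Sum>U\<in>Pow Q - {Q}. x ^ card U) = (1 + x) ^ card Q - x ^ card Q"
    using QX by (simp add: sum_diff1 sum_Pow_power_card)
  also note IH
  finally show ?case using insert.hyps QX by (simp add: card_Diff_subset mult_ac)
qed

section \<open>Minimal broken circuits of an ordered matroid\<close>

locale ordered_orlik_solomon = orlik_solomon n indep for n indep +
  fixes prec :: "nat rel"
  assumes prec_linear: "linear_order_on {1..n} prec"
begin

abbreviation MBC :: "nat set set" where
  "MBC \<equiv> minimal_broken_circuits {1..n} indep prec"

definition pos :: "nat \<Rightarrow> nat" where
  "pos x = card {y \<in> {1..n}. (y, x) \<in> prec}"

lemma pos_le_iff:
  assumes "x \<in> {1..n}" "y \<in> {1..n}" shows "pos x \<le> pos y \<longleftrightarrow> (x, y) \<in> prec"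
proof -
  have r: "refl_on {1..n} prec" "trans prec" "antisym prec" "total_on {1..n} prec"
    using prec_linear by (auto simp: order_on_defs)
  have le: "pos a \<le> pos b" if "(a, b) \<in> prec" for a b
    unfolding pos_def using r(2) that by (intro card_mono) (auto dest: transD)
  have lt: "pos a < pos b" if "(a, b) \<in> prec" "a \<noteq> b" "b \<in> {1..n}" for a b
    unfolding pos_def
  proof (rule psubset_card_mono)
    have "(b, b) \<in> prec" "(b, a) \<notin> prec" using r that by (auto dest: antisymD refl_onD)
    then have "b \<in> {y \<in> {1..n}. (y, b) \<in> prec}" "b \<notin> {y \<in> {1..n}. (y, a) \<in> prec}" using that by auto
    moreover have "{y \<in> {1..n}. (y, a) \<in> prec} \<subseteq> {y \<in> {1..n}. (y, b) \<in> prec}"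
      using r(2) that by (auto dest: transD)
    ultimately show "{y \<in> {1..n}. (y, a) \<in> prec} \<subset> {y \<in> {1..n}. (y, b) \<in> prec}" by blast
  qed simp
  show ?thesis
  proof (cases "x = y")
    case True then show ?thesis using r assms by (auto dest: refl_onD)
  next
    case False
    then have "(x, y) \<in> prec \<or> (y, x) \<in> prec" using r(4) assms by (auto simp: total_on_def)
    then show ?thesis using lt[of y x] le[of x y] False assms by auto
  qed
qed

lemma pos_inj: "inj_on pos {1..n}"
proof (rule inj_onI)
  fix x y assume xy: "x \<in> {1..n}" "y \<in> {1..n}" "pos x = pos y"
  then have "(x, y) \<in> prec" "(y, x) \<in> prec" using pos_le_iff[OF xy(1,2)] pos_le_iff[OF xy(2,1)] by auto
  then show "x = y" using prec_linear by (auto simp: order_on_defs dest: antisymD)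
qed

sublocale weighted_orlik_solomon n indep pos
  by unfold_locales (rule pos_inj)

lemma min_wrt_eq:
  assumes "C \<subseteq> {1..n}" "c \<in> C" "\<And>x. x \<in> C \<Longrightarrow> pos c \<le> pos x"
  shows "min_wrt prec C = c"
  unfolding min_wrt_def
proof (rule the_equality)
  have in_n: "x \<in> {1..n}" if "x \<in> C" for x using assms(1) that by blast
  show "c \<in> C \<and> (\<forall>x\<in>C. (c, x) \<in> prec)" using assms pos_le_iff in_n by blast
  fix m assume m: "m \<in> C \<and> (\<forall>x\<in>C. (m, x) \<in> prec)"
  then have "pos m = pos c" using assms(2,3) pos_le_iff[of m c] in_n by (meson le_antisym)
  then show "m = c" using inj_onD[OF pos_inj] m assms(2) in_n by blast
qed

lemma broken_circuit_iff:
  "B \<in> broken_circuits {1..n} indep prec \<longleftrightarrow>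
    (\<exists>C c. circ C \<and> c \<in> C \<and> (\<forall>x\<in>C. pos c \<le> pos x) \<and> B = C - {c})"
proof
  assume "B \<in> broken_circuits {1..n} indep prec"
  then obtain C where C: "circ C" "B = C - {min_wrt prec C}" by (auto simp: broken_circuits_def)
  have Cg: "C \<subseteq> {1..n}" "C \<noteq> {}" using C(1) circuit_ground circuit_card by force+
  obtain c where "c \<in> C" "\<forall>x\<in>C. pos c \<le> pos x"
    by (rule obtain_min[OF finite_if_ground[OF Cg(1)] Cg(2)])
  then show "\<exists>C c. circ C \<and> c \<in> C \<and> (\<forall>x\<in>C. pos c \<le> pos x) \<and> B = C - {c}"
    using C min_wrt_eq[OF Cg(1)] by blast
next
  assume "\<exists>C c. circ C \<and> c \<in> C \<and> (\<forall>x\<in>C. pos c \<le> pos x) \<and> B = C - {c}"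
  then obtain C c where C: "circ C" "c \<in> C" "\<And>x. x \<in> C \<Longrightarrow> pos c \<le> pos x" "B = C - {c}" by blast
  then have "min_wrt prec C = c" using min_wrt_eq circuit_ground by blast
  then show "B \<in> broken_circuits {1..n} indep prec" using C by (auto simp: broken_circuits_def)
qed

lemma broken_circuit_bounds:
  assumes "B \<in> broken_circuits {1..n} indep prec" shows "B \<subseteq> {1..n}" "2 \<le> card B"
proof -
  obtain C c where C: "circ C" "c \<in> C" "B = C - {c}" using assms broken_circuit_iff by blast
  show "B \<subseteq> {1..n}" using C circuit_ground by blast
  show "2 \<le> card B" using C circuit_card[OF C(1)] by simp
qed

lemma MBC_broken: "B \<in> MBC \<Longrightarrow> B \<in> broken_circuits {1..n} indep prec"
  by (simp add: minimal_broken_circuits_def)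

lemma finite_MBC: "finite MBC"
  by (rule finite_subset[of _ "Pow {1..n}"]) (use MBC_broken broken_circuit_bounds in auto)

lemma obtain_MBC:
  assumes "B \<in> broken_circuits {1..n} indep prec" obtains Q where "Q \<in> MBC" "Q \<subseteq> B"
proof -
  have "finite B" using broken_circuit_bounds(1)[OF assms] finite_if_ground by simp
  then have "\<exists>Q. Q \<in> MBC \<and> Q \<subseteq> B" using assms
  proof (induction B rule: finite_psubset_induct)
    case (psubset B)
    show ?case
    proof (cases "B \<in> MBC")
      case False
      then obtain B' where "B' \<in> broken_circuits {1..n} indep prec" "B' \<subset> B"
        using psubset.prems by (auto simp: minimal_broken_circuits_def)
      then show ?thesis using psubset.IH by (meson psubset_imp_subset subset_trans)
    qed blast
  qed
  then show ?thesis using that by blast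
qed

lemma nbc_iff_MBC: "nbc T \<longleftrightarrow> T \<subseteq> {1..n} \<and> (\<forall>Q\<in>MBC. \<not> Q \<subseteq> T)"
proof
  assume T: "nbc T"
  show "T \<subseteq> {1..n} \<and> (\<forall>Q\<in>MBC. \<not> Q \<subseteq> T)"
  proof (intro conjI ballI)
    fix Q assume "Q \<in> MBC"
    then obtain C c where "circ C" "c \<in> C" "\<forall>x\<in>C. pos c \<le> pos x" "Q = C - {c}"
      using MBC_broken broken_circuit_iff by blast
    then show "\<not> Q \<subseteq> T" using T unfolding nbc_def by blast
  qed (use T nbc_subset in blast)
next
  assume T: "T \<subseteq> {1..n} \<and> (\<forall>Q\<in>MBC. \<not> Q \<subseteq> T)"
  show "nbc T" unfolding nbc_def
  proof (intro conjI allI impI notI)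
    fix C c assume "circ C" "c \<in> C" "\<forall>x\<in>C. pos c \<le> pos x" and sub: "C - {c} \<subseteq> T"
    then have "C - {c} \<in> broken_circuits {1..n} indep prec" using broken_circuit_iff by blast
    then obtain Q where "Q \<in> MBC" "Q \<subseteq> C - {c}" by (rule obtain_MBC)
    then show False using T sub by blast
  qed (use T in blast)
qed

lemma poincare_formula:
  assumes "pairwise disjnt MBC"
  shows "OS_poincare TYPE('k::field) n indep =
    [:1, 1:] ^ (n - (\<Sum>Q\<in>MBC. card Q)) * (\<Prod>Q\<in>MBC. [:1, 1:] ^ card Q - [:0, 1:] ^ card Q)"
proof -
  have one: "1 + [:0, 1:] = [:1, 1 :: int:]" by (simp add: one_pCons)
  have "OS_poincare TYPE('k) n indep = (\<Sum>T | T \<subseteq> {1..n} \<and> (\<forall>Q\<in>MBC. \<not> Q \<subseteq> T). [:0, 1:] ^ card T)"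
    unfolding OS_poincare_nbc nbc_iff_MBC ..
  also have "\<dots> = (1 + [:0, 1:]) ^ (card {1..n} - (\<Sum>Q\<in>MBC. card Q)) * (\<Prod>Q\<in>MBC. (1 + [:0, 1:]) ^ card Q - [:0, 1:] ^ card Q)"
    by (rule sum_avoiding_disjoint)
      (use finite_MBC assms broken_circuit_bounds(1)[OF MBC_broken] in auto)
  finally show ?thesis unfolding one by simp
qed

end


subsection \<open>Linear factors\<close>

definition ceval :: "complex \<Rightarrow> int poly \<Rightarrow> complex" where
  "ceval z p = poly (map_poly of_int p) z"

lemma ceval_0 [simp]: "ceval z 0 = 0"
  by (simp add: ceval_def)

lemma ceval_pCons [simp]: "ceval z (pCons a p) = of_int a + z * ceval z p"
  by (simp add: ceval_def map_poly_pCons)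

lemma ceval_add: "ceval z (p + q) = ceval z p + ceval z q"
proof -
  have "map_poly of_int (p + q) = map_poly of_int p + (map_poly of_int q :: complex poly)"
    by (rule poly_eqI) (simp add: coeff_map_poly)
  then show ?thesis by (simp add: ceval_def)
qed

lemma ceval_smult: "ceval z (Polynomial.smult a q) = of_int a * ceval z q"
  by (simp add: ceval_def map_poly_smult)

lemma ceval_mult: "ceval z (p * q) = ceval z p * ceval z q"
  by (induction p) (simp_all add: mult_pCons_left ceval_add ceval_smult algebra_simps)

lemma ceval_diff: "ceval z (p - q) = ceval z p - ceval z q"
  using ceval_add[of z "p - q" q] by simp

lemma ceval_one [simp]: "ceval z 1 = 1"
  by (simp add: one_pCons)

lemma ceval_power: "ceval z (p ^ m) = ceval z p ^ m"
  by (induction m) (simp_all add: ceval_mult)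

lemma ceval_prod: "ceval z (prod f X) = (\<Prod>x\<in>X. ceval z (f x))"
  by (induction X rule: infinite_finite_induct) (simp_all add: ceval_mult)

text \<open>The root of a linear factor with integer coefficients is real: at \<open>z\<close> the
  factor has imaginary part \<open>b * Im z\<close> with leading coefficient \<open>b\<close>
  nonzero.\<close>

lemma ceval_nonreal:
  assumes fc: "factors_completely f" and f: "f \<noteq> 0" and z: "Im z \<noteq> 0"
  shows "ceval z f \<noteq> 0"
proof
  assume 0: "ceval z f = 0"
  obtain c ls where ls: "\<And>l. l \<in> set ls \<Longrightarrow> Polynomial.degree l = 1" "f = [:c:] * prod_list ls"
    using fc by (auto simp: factors_completely_def)
  have "ceval z (prod_list ls) \<noteq> 0" using ls(1)
  proof (induction ls)
    case (Cons l ls)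
    have "Polynomial.degree l = 1" using Cons.prems by simp
    moreover obtain a p where ap: "l = pCons a p" by (rule pCons_cases)
    ultimately have "p \<noteq> 0" "Polynomial.degree p = 0" by (auto split: if_splits)
    then obtain b where l: "l = [:a, b:]" "b \<noteq> 0" using ap by (auto elim: degree_eq_zeroE)
    have "Im (ceval z l) \<noteq> 0" using l z by simp
    then have "ceval z l \<noteq> 0" by auto
    then show ?case using Cons by (simp add: ceval_mult)
  qed simp
  moreover have "c \<noteq> 0" using f ls(2) by auto
  ultimately show False using 0 unfolding ls(2) by (simp add: ceval_smult)
qed

text \<open>At a root, \<open>(1 + z) / z\<close> is a root of unity of order dividing
  \<open>q\<close>. Solving for \<open>z\<close> with the primitive root \<open>u\<close>, which is
  nonreal for \<open>q\<close> at least 3, gives \<open>z = 1 / (u - 1)\<close>.\<close>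

lemma nonreal_root:
  assumes "3 \<le> (q :: nat)"
  obtains z where "Im z \<noteq> 0" "ceval z ([:1, 1:] ^ q - [:0, 1:] ^ q) = 0"
proof -
  define u where "u = cis (2 * pi / real q)"
  have uq: "u ^ q = 1" using assms by (simp add: u_def DeMoivre)
  have "0 < 2 * pi / real q" "2 * pi / real q < pi" using assms by (auto simp: field_simps)
  then have Imu: "Im u \<noteq> 0" using sin_gt_zero[of "2 * pi / real q"] by (simp add: u_def)
  then have u1: "u - 1 \<noteq> 0" by auto
  define z where "z = inverse (u - 1)"
  have "Im z \<noteq> 0" using Imu u1 by (auto simp: z_def complex_eq_iff sum_power2_eq_zero_iff)
  moreover have "1 + z = u * z" using u1 by (simp add: z_def field_simps)
  then have "(1 + z) ^ q = z ^ q" using uq by (simp add: power_mult_distrib)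
  then have "ceval z ([:1, 1:] ^ q - [:0, 1:] ^ q) = 0"
    by (simp add: ceval_diff ceval_power)
  ultimately show ?thesis by (rule that)
qed

lemma factors_completely_iff:
  assumes fin: "finite QQ" and ge: "\<And>Q. Q \<in> QQ \<Longrightarrow> 2 \<le> card Q"
  shows "factors_completely ([:1, 1:] ^ m * (\<Prod>Q\<in>QQ. [:1, 1:] ^ card Q - [:0, 1:] ^ card Q)) \<longleftrightarrow>
    (\<forall>Q\<in>QQ. card Q = 2)"
proof
  let ?f = "[:1, 1:] ^ m * (\<Prod>Q\<in>QQ. [:1, 1:] ^ card Q - [:0, 1:] ^ card Q) :: int poly"
  assume fc: "factors_completely ?f"
  show "\<forall>Q\<in>QQ. card Q = 2"
  proof (rule ccontr)
    assume "\<not> ?thesis"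
    then obtain Q where Q: "Q \<in> QQ" "3 \<le> card Q" using ge by fastforce
    obtain z where z: "Im z \<noteq> 0" "ceval z ([:1, 1:] ^ card Q - [:0, 1:] ^ card Q) = 0"
      using nonreal_root[OF Q(2)] by blast
    have "ceval z ?f = 0"
      unfolding ceval_mult ceval_prod using Q(1) fin z(2) by (auto simp: prod_zero_iff)
    \<comment> \<open>Every factor is 1 at 0, since the exponents \<open>card Q\<close> are
      positive. This excludes the zero polynomial, which would factor trivially.\<close>
    moreover have "poly ?f 0 = 1"
      unfolding poly_mult poly_prod poly_power poly_diff
      using ge by (auto simp: power_0_left intro!: prod.neutral) fastforce
    then have "?f \<noteq> 0" by auto
    ultimately show False using ceval_nonreal[OF fc _ z(1)] by blast
  qed
next
  assume two: "\<forall>Q\<in>QQ. card Q = 2"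
  \<comment> \<open>A difference of two squares: for exponent 2 the factor is
    \<open>1 + 2 t\<close>.\<close>
  have "(\<Prod>Q\<in>QQ. [:1, 1:] ^ card Q - [:0, 1:] ^ card Q) = (\<Prod>Q\<in>QQ. [:1, 2 :: int:])"
    using two by (intro prod.cong) (auto simp: power2_eq_square)
  then have "[:1, 1:] ^ m * (\<Prod>Q\<in>QQ. [:1, 1:] ^ card Q - [:0, 1:] ^ card Q) =
    [:1:] * prod_list (replicate m [:1, 1 :: int:] @ replicate (card QQ) [:1, 2:])"
    by (simp add: prod_list_replicate)
  then show "factors_completely ([:1, 1:] ^ m * (\<Prod>Q\<in>QQ. [:1, 1:] ^ card Q - [:0, 1:] ^ card Q))"
    unfolding factors_completely_def
    by (intro exI[of _ 1] exI[of _ "replicate m [:1, 1:] @ replicate (card QQ) [:1, 2:]"] conjI) auto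
qed


section \<open>Supersolvability\<close>

text \<open>The fibres of \<open>k\<close> are the successive differences of a modular maximal chain.\<close>

locale fibration = simple_matroid_locale +
  fixes k :: "'a \<Rightarrow> nat"
  assumes transversal_indep: "T \<subseteq> ground \<Longrightarrow> inj_on k T \<Longrightarrow> indep T"
    and fibre_line: "x \<in> ground \<Longrightarrow> y \<in> ground \<Longrightarrow> x \<noteq> y \<Longrightarrow> k x = k y \<Longrightarrow> \<exists>z. circ {x, y, z} \<and> k z < k x"
begin

lemma card_image_le_rank:
  assumes "X \<subseteq> ground" shows "card (k ` X) \<le> rk X"
proof -
  have "\<exists>T. T \<subseteq> X \<and> inj_on k T \<and> k ` X = k ` T"
    using subset_image_inj[of "k ` X" k X] by simp
  then obtain T where T: "T \<subseteq> X" "inj_on k T" "k ` X = k ` T" by (elim exE conjE)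
  then have "card (k ` X) = card T" using card_image[OF T(2)] by simp
  also have "\<dots> \<le> rk X"
    by (rule rank_ge[OF T(1) transversal_indep[OF subset_trans[OF T(1) assms] T(2)]])
  finally show ?thesis .
qed

definition level :: "nat \<Rightarrow> 'a set" where
  "level j = {x \<in> ground. k x < j}"

text \<open>The line through \<open>a\<close> and \<open>b\<close> has a third point
  \<open>z\<close> in a lower fibre. It lies in the flat \<open>Y\<close>, and \<open>b\<close> is
  on the line through \<open>a\<close> and \<open>z\<close>. So within a flat one point of a fibre,
  added to the lower fibres, spans the rest of that fibre.\<close>

lemma fibre_closure:
  assumes Y: "Y \<in> flats ground indep" and a: "a \<in> Y" and b: "b \<in> Y" and ab: "k a = k b"
  shows "b \<in> cl (insert a (Y \<inter> level (k a)))"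
proof (cases "a = b")
  case True
  have "insert a (Y \<inter> level (k a)) \<subseteq> ground" using flat_subset[OF Y] a by auto
  then show ?thesis using True subset_closure by blast
next
  case False
  have g: "a \<in> ground" "b \<in> ground" using flat_subset[OF Y] a b by auto
  obtain z where z: "circ {a, b, z}" "k z < k a" using fibre_line[OF g False ab] by blast
  have ne: "z \<noteq> a" "z \<noteq> b" using z ab by auto
  have "z \<in> cl ({a, b, z} - {z})" by (rule circuit_in_closure[OF z(1)]) simp
  then have "z \<in> cl {a, b}" using ne by (simp add: insert_Diff_if)
  then have "z \<in> Y" using flat_closure_subset[OF Y, of "{a, b}"] a b by blast
  moreover have "z \<in> ground" using circuit_ground[OF z(1)] by blast
  ultimately have "{a, z} \<subseteq> insert a (Y \<inter> level (k a))" using z by (auto simp: level_def)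
  moreover have "b \<in> cl ({a, b, z} - {b})" by (rule circuit_in_closure[OF z(1)]) simp
  then have "b \<in> cl {a, z}" using ne False by (simp add: insert_Diff_if insert_commute)
  ultimately show ?thesis using closure_mono by blast
qed

text \<open>Every fibre that meets the flat contributes exactly 1 to the rank: at least 1 because
  transversals are independent, at most 1 by \<open>fibre_closure\<close>.\<close>

lemma rank_flat_level:
  assumes Y: "Y \<in> flats ground indep"
  shows "rk (Y \<inter> level j) = card (k ` (Y \<inter> level j))"
proof (rule antisym)
  have Yg: "Y \<subseteq> ground" using flat_subset[OF Y] .
  show "card (k ` (Y \<inter> level j)) \<le> rk (Y \<inter> level j)" by (rule card_image_le_rank) (use Yg in auto)
  show "rk (Y \<inter> level j) \<le> card (k ` (Y \<inter> level j))"
  proof (induction j)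
    case 0
    then show ?case using rank_indep[OF indep_empty] by (simp add: level_def)
  next
    case (Suc j)
    show ?case
    proof (cases "\<exists>a\<in>Y. k a = j")
      case False
      then have "Y \<inter> level (Suc j) = Y \<inter> level j" using less_Suc_eq by (auto simp: level_def)
      then show ?thesis using Suc by simp
    next
      case True
      then obtain a where a: "a \<in> Y" "k a = j" by blast
      let ?L = "insert a (Y \<inter> level j)"
      have Lg: "?L \<subseteq> ground" using a Yg by auto
      have "Y \<inter> level (Suc j) \<subseteq> cl ?L"
      proof
        fix b assume b: "b \<in> Y \<inter> level (Suc j)"
        show "b \<in> cl ?L"
        proof (cases "k b = j")
          case True
          then show ?thesis using fibre_closure[OF Y a(1), of b] a b by simp
        next
          case False
          then have "b \<in> ?L" using b by (auto simp: level_def)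
          then show ?thesis using subset_closure[OF Lg] by blast
        qed
      qed
      then have "rk (Y \<inter> level (Suc j)) \<le> rk ?L"
        using rank_mono rank_closure[OF Lg] by metis
      also have "\<dots> \<le> Suc (card (k ` (Y \<inter> level j)))" using rank_insert_le[of a "Y \<inter> level j"] Suc by simp
      also have "\<dots> = card (insert j (k ` (Y \<inter> level j)))"
      proof -
        have "finite (k ` (Y \<inter> level j))" using Yg finite_if_ground[of Y] by simp
        moreover have "j \<notin> k ` (Y \<inter> level j)" by (auto simp: level_def)
        ultimately show ?thesis by simp
      qed
      also have "insert j (k ` (Y \<inter> level j)) \<subseteq> k ` (Y \<inter> level (Suc j))"
        using a Yg by (auto simp: level_def)
      then have "card (insert j (k ` (Y \<inter> level j))) \<le> card (k ` (Y \<inter> level (Suc j)))"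
        by (rule card_mono[rotated]) (use Yg finite_if_ground[of Y] in simp)
      finally show ?thesis .
    qed
  qed
qed

lemma ground_flat: "ground \<in> flats ground indep"
  using closure_subset_ground[of ground] subset_closure[of ground] by (simp add: flats_def)

lemma level_top: obtains j where "level j = ground"
proof -
  have "level (Suc (\<Sum>x\<in>ground. k x)) = ground"
    unfolding level_def less_Suc_eq_le using finite_ground by (auto intro: member_le_sum)
  then show ?thesis using that by blast
qed

lemma rank_flat: "Y \<in> flats ground indep \<Longrightarrow> rk Y = card (k ` Y)"
proof -
  assume Y: "Y \<in> flats ground indep"
  obtain j where "level j = ground" by (rule level_top)
  then have "Y \<inter> level j = Y" using flat_subset[OF Y] by blast
  then show ?thesis using rank_flat_level[OF Y, of j] by simp
qed

lemma level_ground: "level j \<subseteq> ground"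
  by (auto simp: level_def)

lemma rank_level: "rk (level j) = card (k ` level j)"
proof -
  have "ground \<inter> level j = level j" using level_ground by blast
  then show ?thesis using rank_flat_level[OF ground_flat, of j] by simp
qed

text \<open>A point outside the level brings a new value of \<open>k\<close> and therefore raises
  the rank.\<close>

lemma level_flat: "level j \<in> flats ground indep"
proof -
  have "x \<in> level j" if x: "x \<in> cl (level j)" for x
  proof (rule ccontr)
    assume "x \<notin> level j"
    moreover have xg: "x \<in> ground" using x closure_subset_ground by blast
    ultimately have "k x \<notin> k ` level j" by (auto simp: level_def)
    moreover have "finite (k ` level j)" using level_ground finite_if_ground[of "level j"] by simp
    ultimately have "card (k ` insert x (level j)) = Suc (card (k ` level j))" by simp
    moreover have "card (k ` insert x (level j)) \<le> rk (insert x (level j))"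
      by (rule card_image_le_rank) (use xg level_ground in auto)
    ultimately show False using x by (simp add: closure_iff rank_level)
  qed
  then have "cl (level j) = level j" using subset_closure[OF level_ground[of j]] by blast
  then show ?thesis using level_ground by (simp add: flats_def)
qed

text \<open>Ranks count fibres, and a level is a union of whole fibres, so the fibres met by its
  intersection with \<open>Y\<close> are those met by both sets. Inclusion and exclusion give one
  inequality, submodularity the other.\<close>

lemma level_modular: "modular_flat ground indep (level j)"
  unfolding modular_flat_def
proof (intro conjI ballI level_flat)
  fix Y assume Y: "Y \<in> flats ground indep"
  have g: "level j \<union> Y \<subseteq> ground" using level_ground flat_subset[OF Y] by blast
  have fin: "finite (k ` level j)" "finite (k ` Y)" using g finite_if_ground by auto
  have int: "k ` (level j \<inter> Y) = k ` level j \<inter> k ` Y"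
    using g by (auto simp: level_def image_iff)
  have "rk (level j) + rk Y = card (k ` (level j \<union> Y)) + card (k ` (level j \<inter> Y))"
    unfolding rank_level rank_flat[OF Y] int image_Un by (rule card_Un_Int[OF fin])
  also have "card (k ` (level j \<inter> Y)) = rk (level j \<inter> Y)"
    using rank_flat_level[OF Y, of j] by (simp add: Int_commute)
  finally have "rk (level j) + rk Y \<le> rk (cl (level j \<union> Y)) + rk (level j \<inter> Y)"
    using card_image_le_rank[OF g] by (simp add: rank_closure[OF g])
  moreover have "rk (cl (level j \<union> Y)) + rk (level j \<inter> Y) \<le> rk (level j) + rk Y"
    using rank_submodular[of "level j" Y] by (simp add: rank_closure[OF g])
  ultimately show "rk (level j) + rk Y = rk (cl (level j \<union> Y)) + rk (level j \<inter> Y)" by (rule antisym)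
qed

lemma level_mono: "i \<le> j \<Longrightarrow> level i \<subseteq> level j"
  by (auto simp: level_def)

text \<open>A nonempty flat comparable with all levels lies between two consecutive ones and meets
  the fibre between them. It then has the rank of the upper level and is equal to it.\<close>

lemma supersolvable: "supersolvable ground indep"
  unfolding supersolvable_def
proof (intro exI conjI ballI)
  let ?C = "range level"
  show "modular_flat ground indep X" if "X \<in> ?C" for X using that level_modular by blast
  have chain: "subset.chain (flats ground indep) ?C"
    unfolding subset_chain_def
  proof (intro conjI ballI)
    fix X Y assume "X \<in> ?C" "Y \<in> ?C"
    then obtain i j where "X = level i" "Y = level j" by blast
    then show "X \<subseteq> Y \<or> Y \<subseteq> X" using level_mono[of i j] level_mono[of j i] nat_le_linear[of i j] by auto
  qed (use level_flat in auto)
  have maximal: "Y \<in> ?C" if Y: "Y \<in> flats ground indep" and comp: "\<And>j. Y \<subseteq> level j \<or> level j \<subseteq> Y" for Y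
  proof -
    have Yg: "Y \<subseteq> ground" using flat_subset[OF Y] .
    obtain t where t: "level t = ground" by (rule level_top)
    define j where "j = (LEAST j. Y \<subseteq> level j)"
    have j: "Y \<subseteq> level j" unfolding j_def by (rule LeastI[of _ t]) (use t Yg in simp)
    show ?thesis
    proof (cases j)
      case 0
      then have "Y = level 0" using j by (auto simp: level_def)
      then show ?thesis by blast
    next
      case (Suc i)
      then have ni: "\<not> Y \<subseteq> level i" using not_less_Least[of i "\<lambda>j. Y \<subseteq> level j"] by (simp add: j_def)
      then have sub: "level i \<subseteq> Y" using comp by blast
      obtain y where y: "y \<in> Y" "y \<notin> level i" using ni by blast
      then have "k y = i" using j Suc by (auto simp: level_def)
      then have "k ` level (Suc i) \<subseteq> k ` Y" using sub y(1) less_Suc_eq by (fastforce simp: level_def)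
      moreover have "finite (k ` Y)" using Yg finite_if_ground by simp
      ultimately have "rk (level (Suc i)) \<le> rk Y"
        unfolding rank_level rank_flat[OF Y] by (rule card_mono[rotated])
      moreover have "rk Y \<le> rk (level (Suc i))" using j Suc by (intro rank_mono) simp
      ultimately have "Y = level (Suc i)"
        using flat_eqI[OF Y level_ground[of "Suc i"]] j Suc by simp
      then show ?thesis by blast
    qed
  qed
  show "subset.maxchain (flats ground indep) ?C"
    unfolding subset.maxchain_def
  proof (intro conjI chain notI)
    assume "\<exists>S. subset.chain (flats ground indep) S \<and> ?C \<subset> S"
    then obtain S where S: "subset.chain (flats ground indep) S" "?C \<subset> S" by blast
    then obtain Y where "Y \<in> S" "Y \<notin> ?C" by blast
    moreover have "Y \<in> ?C"
    proof (rule maximal)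
      show "Y \<in> flats ground indep" using S(1) \<open>Y \<in> S\<close> unfolding subset_chain_def by blast
      fix j
      have "level j \<in> S" using S(2) by blast
      then show "Y \<subseteq> level j \<or> level j \<subseteq> Y"
        using S(1) \<open>Y \<in> S\<close> unfolding subset_chain_def by blast
    qed
    ultimately show False by blast
  qed
qed

end


subsection \<open>Disjoint minimal broken circuits\<close>

context ordered_orlik_solomon
begin

text \<open>In a simple matroid broken circuits have at least 2 elements, so one with exactly 2 is
  minimal.\<close>

lemma three_circuit_MBC:
  assumes D: "circ D" "card D = 3"
  obtains d where "d \<in> D" "D - {d} \<in> MBC" "\<And>x. x \<in> D \<Longrightarrow> pos d \<le> pos x"
proof -
  have Dg: "D \<subseteq> {1..n}" "D \<noteq> {}" using D circuit_ground by auto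
  obtain d where d: "d \<in> D" "\<forall>x\<in>D. pos d \<le> pos x"
    by (rule obtain_min[OF finite_if_ground[OF Dg(1)] Dg(2)])
  have b: "D - {d} \<in> broken_circuits {1..n} indep prec" using d D broken_circuit_iff by blast
  have fin: "finite D" using D circuit_finite by simp
  have "\<not> (\<exists>B'\<in>broken_circuits {1..n} indep prec. B' \<subset> D - {d})"
  proof
    assume "\<exists>B'\<in>broken_circuits {1..n} indep prec. B' \<subset> D - {d}"
    then obtain B' where B': "B' \<in> broken_circuits {1..n} indep prec" "B' \<subset> D - {d}" by blast
    have "card B' < card (D - {d})" using B' fin by (intro psubset_card_mono) auto
    then show False using broken_circuit_bounds(2)[OF B'(1)] D d by simp
  qed
  then have "D - {d} \<in> MBC" using b by (simp add: minimal_broken_circuits_def)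
  then show ?thesis using that d by blast
qed

text \<open>Collapsing everything outside a minimal broken circuit \<open>Q\<close> of size at least 3 kills the
  relations of the 3-element circuits, but not the one that breaks to \<open>Q\<close>.\<close>

definition collapse :: "nat set \<Rightarrow> nat \<Rightarrow> nat" where
  "collapse Q x = (if x \<in> Q then x else n + 1)"

text \<open>The broken circuit of \<open>D\<close> is minimal of size 2, hence different from
  \<open>Q\<close> and disjoint from it; both its points go to \<open>n + 1\<close>.\<close>

lemma collapse_three_circuit:
  assumes disj: "pairwise disjnt MBC" and Q: "Q \<in> MBC" "3 \<le> card Q" and D: "circ D" "card D = 3"
  shows "\<not> inj_on (collapse Q) D"
proof
  assume inj: "inj_on (collapse Q) D"
  obtain d where d: "d \<in> D" "D - {d} \<in> MBC" using three_circuit_MBC[OF D] by blast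
  have card2: "card (D - {d}) = 2" using d D by simp
  then have "D - {d} \<noteq> Q" using Q by auto
  then have "(D - {d}) \<inter> Q = {}" using disj d Q by (auto simp: pairwise_def disjnt_def)
  moreover obtain x y where xy: "D - {d} = {x, y}" "x \<noteq> y" using card2 by (auto simp: card_2_iff)
  ultimately have "x \<notin> Q" "y \<notin> Q" by auto
  then show False using inj_onD[OF inj, of x y] xy by (auto simp: collapse_def)
qed

text \<open>A circuit that breaks to \<open>Q\<close> has a single point outside \<open>Q\<close>,
  so nothing collides with its image \<open>n + 1\<close>.\<close>

lemma collapse_circuit:
  assumes Q: "Q \<in> MBC" obtains C where "circ C" "inj_on (collapse Q) C"
proof -
  obtain C c where C: "circ C" "c \<in> C" "Q = C - {c}" using broken_circuit_iff MBC_broken[OF Q] by blast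
  have Cg: "C \<subseteq> {1..n}" using C circuit_ground by simp
  have "inj_on (collapse Q) C"
  proof (rule inj_onI)
    fix x y assume xy: "x \<in> C" "y \<in> C" "collapse Q x = collapse Q y"
    have "x \<noteq> n + 1" "y \<noteq> n + 1" using xy Cg by fastforce+
    then show "x = y" using xy C by (auto simp: collapse_def split: if_splits)
  qed
  then show ?thesis using that C by blast
qed

lemma supersolvable_imp_two:
  assumes "pairwise disjnt MBC" "Defs.supersolvable {1..n} indep"
  shows "\<forall>Q\<in>MBC. card Q = 2"
proof (rule ccontr)
  assume "\<not> ?thesis"
  then obtain Q where Q: "Q \<in> MBC" "3 \<le> card Q"
    using broken_circuit_bounds(2)[OF MBC_broken] by fastforce
  obtain C where "circ C" "inj_on (collapse Q) C" using collapse_circuit[OF Q(1)] by blast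
  then show False
    using supersolvable_collision[OF assms(2) collapse_three_circuit[OF assms(1) Q]] by blast
qed

text \<open>A representative of the fibre of \<open>x\<close> in the fibration defined by the minimal broken circuits.\<close>

definition mu :: "nat \<Rightarrow> nat" where
  "mu x = (if \<exists>y. {x, y} \<in> MBC \<and> pos y < pos x then THE y. {x, y} \<in> MBC \<and> pos y < pos x else x)"

context
  assumes disj: "pairwise disjnt MBC" and two: "\<forall>Q\<in>MBC. card Q = 2"
begin

lemma MBC_unique: "{x, y} \<in> MBC \<Longrightarrow> {x, y'} \<in> MBC \<Longrightarrow> y = y'"
proof -
  assume xy: "{x, y} \<in> MBC" "{x, y'} \<in> MBC"
  have eq: "{x, y} = {x, y'}"
  proof (rule ccontr)
    assume "{x, y} \<noteq> {x, y'}"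
    then have "disjnt {x, y} {x, y'}" by (rule pairwiseD[OF disj xy])
    then show False by (simp add: disjnt_def)
  qed
  have "card {x, y} = 2" by (rule bspec[OF two xy(1)])
  then have "x \<noteq> y" by auto
  then show "y = y'" using eq by (auto simp: doubleton_eq_iff)
qed

lemma mu_eqI: "{x, y} \<in> MBC \<Longrightarrow> pos y < pos x \<Longrightarrow> mu x = y"
proof -
  assume xy: "{x, y} \<in> MBC" "pos y < pos x"
  have "(THE y. {x, y} \<in> MBC \<and> pos y < pos x) = y"
  proof (rule the_equality)
    fix y' assume "{x, y'} \<in> MBC \<and> pos y' < pos x"
    then show "y' = y" using MBC_unique[OF xy(1), of y'] by simp
  qed (use xy in simp)
  moreover have "\<exists>y. {x, y} \<in> MBC \<and> pos y < pos x" using xy by blast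
  ultimately show ?thesis unfolding mu_def by simp
qed

lemma mu_cases: obtains "mu x = x" | y where "mu x = y" "{x, y} \<in> MBC" "pos y < pos x"
proof (cases "\<exists>y. {x, y} \<in> MBC \<and> pos y < pos x")
  case True
  then obtain y where "{x, y} \<in> MBC" "pos y < pos x" by blast
  then show ?thesis using that(2) mu_eqI by blast
next
  case False
  then have "mu x = x" unfolding mu_def by (rule if_not_P)
  then show ?thesis by (rule that(1))
qed

lemma pos_mu_le: "pos (mu x) \<le> pos x"
  by (cases rule: mu_cases[of x]) auto

lemma mu_ground: "x \<in> {1..n} \<Longrightarrow> mu x \<in> {1..n}"
proof (cases rule: mu_cases[of x])
  case (2 y)
  then show ?thesis using broken_circuit_bounds(1)[OF MBC_broken[OF 2(2)]] by blast
qed simp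

lemma MBC_mu:
  assumes "{x, y} \<in> MBC" shows "mu x = mu y"
proof -
  have g: "x \<in> {1..n}" "y \<in> {1..n}" using broken_circuit_bounds(1)[OF MBC_broken[OF assms]] by auto
  have "card {x, y} = 2" using two assms by blast
  then have "x \<noteq> y" by auto
  then have "pos x \<noteq> pos y" using inj_onD[OF pos_inj] g by blast
  have self: "mu a = a" if "{b, a} \<in> MBC" "pos a < pos b" for a b
  proof (cases rule: mu_cases[of a])
    case (2 y)
    then have "y = b" using MBC_unique that(1) by (simp add: insert_commute)
    then show ?thesis using 2 that by simp
  qed
  from \<open>pos x \<noteq> pos y\<close> consider "pos x < pos y" | "pos y < pos x" by linarith
  then show ?thesis
  proof cases
    case 1
    then have "mu y = x" "mu x = x" using mu_eqI[of y x] self[of y x] assms by (simp_all add: insert_commute)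
    then show ?thesis by simp
  next
    case 2
    then have "mu x = y" "mu y = y" using mu_eqI[of x y] self[of x y] assms by simp_all
    then show ?thesis by simp
  qed
qed

lemma mu_MBC:
  assumes "mu x = mu y" "x \<noteq> y" shows "{x, y} \<in> MBC"
proof (cases rule: mu_cases[of x])
  case 1
  note x = this
  show ?thesis
  proof (cases rule: mu_cases[of y])
    case 1 then show ?thesis using x assms by simp
  next
    case (2 z) then show ?thesis using x assms by (simp add: insert_commute)
  qed
next
  case (2 z)
  note x = this
  show ?thesis
  proof (cases rule: mu_cases[of y])
    case 1 then show ?thesis using x assms by simp
  next
    case (2 z')
    then have "{z, x} \<in> MBC" "{z, y} \<in> MBC" using x assms by (simp_all add: insert_commute)
    then show ?thesis using MBC_unique assms by blast
  qed
qed

text \<open>A transversal contains no minimal broken circuit and is independent for that reason. Two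
  points of one fibre form a minimal broken circuit; the element \<open>c\<close> removed from its
  circuit precedes both, and the representative of \<open>c\<close> does not come after
  \<open>c\<close>, so \<open>c\<close> lies in a lower fibre.\<close>

lemma fibration_pos_mu: "fibration {1..n} indep (\<lambda>x. pos (mu x))"
proof unfold_locales
  fix T assume T: "T \<subseteq> {1..n}" and inj: "inj_on (\<lambda>x. pos (mu x)) T"
  have "nbc T"
    unfolding nbc_iff_MBC
  proof (intro conjI T ballI notI)
    fix Q assume Q: "Q \<in> MBC" "Q \<subseteq> T"
    have "card Q = 2" using two Q by blast
    then obtain x y where xy: "Q = {x, y}" "x \<noteq> y" by (auto simp: card_2_iff)
    then have "mu x = mu y" using MBC_mu Q by blast
    then show False using inj_onD[OF inj, of x y] xy Q by auto
  qed
  then show "indep T" by (rule nbc_indep)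
next
  fix x y assume g: "x \<in> {1..n}" "y \<in> {1..n}" "x \<noteq> y" and eq: "pos (mu x) = pos (mu y)"
  have "mu x = mu y" using inj_onD[OF pos_inj eq] mu_ground g by blast
  then have Q: "{x, y} \<in> MBC" using mu_MBC g by blast
  then obtain C c where C: "circ C" "c \<in> C" "\<forall>x\<in>C. pos c \<le> pos x" "{x, y} = C - {c}"
    using MBC_broken broken_circuit_iff by blast
  have Cxy: "C = {x, y, c}" using C by auto
  have cg: "c \<in> {1..n}" "mu x \<in> {1..n}" using C circuit_ground[OF C(1)] mu_ground g by auto
  have "mu x \<in> {x, y}"
  proof (cases rule: mu_cases[of x])
    case (2 z)
    then show ?thesis using MBC_unique[OF Q] by auto
  qed simp
  then have "mu x \<in> C - {c}" using C(4) by simp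
  then have "pos c \<le> pos (mu x)" "pos c \<noteq> pos (mu x)"
    using C(3) inj_onD[OF pos_inj, of c "mu x"] cg by auto
  then have "pos (mu c) < pos (mu x)" using pos_mu_le[of c] by linarith
  then show "\<exists>z. circ {x, y, z} \<and> pos (mu z) < pos (mu x)" using C(1) Cxy by blast
qed

end

end


section \<open>Colon ideals\<close>

locale fibred_orlik_solomon = orlik_solomon n indep + fibration "{1..n}" indep k for n indep k
begin

text \<open>Lexicographic: the fibre decides, then the point. The factor \<open>n + 1\<close>
  exceeds every point, so that a lower fibre is lighter as a whole and the levels become initial
  segments.\<close>

definition wt :: "nat \<Rightarrow> nat" where
  "wt x = k x * (n + 1) + x"

lemma wt_inj: "inj_on wt {1..n}"
proof (rule inj_onI)
  fix x y assume x: "x \<in> {1..n}" and y: "y \<in> {1..n}" and "wt x = wt y"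
  then have "wt x mod (n + 1) = wt y mod (n + 1)" by simp
  moreover have "wt z mod (n + 1) = z mod (n + 1)" for z
    by (simp only: wt_def add.commute[of _ z] mod_mult_self1)
  ultimately show "x = y" using x y by simp
qed

lemma wt_less: 
  assumes "k x < k y" "x \<in> {1..n}" shows "wt x < wt y"
proof -
  have "wt x < (k x + 1) * (n + 1)" using assms by (simp add: wt_def)
  also have "\<dots> \<le> k y * (n + 1)" using assms by (intro mult_right_mono) auto
  finally show ?thesis by (simp add: wt_def)
qed

sublocale weighted_orlik_solomon n indep wt
  by unfold_locales (rule wt_inj)

lemma nbc_inj: "nbc T \<Longrightarrow> inj_on k T"
proof (rule inj_onI, rule ccontr)
  fix x y assume T: "nbc T" and xy: "x \<in> T" "y \<in> T" "k x = k y" "x \<noteq> y"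
  then have g: "x \<in> {1..n}" "y \<in> {1..n}" using nbc_subset by blast+
  obtain z where z: "circ {x, y, z}" "k z < k x" using fibre_line[OF g xy(4,3)] by blast
  have zg: "z \<in> {1..n}" using circuit_ground[OF z(1)] by blast
  then have "\<forall>u\<in>{x, y, z}. wt z \<le> wt u" using wt_less[of z x] wt_less[of z y] z xy by auto
  moreover have "{x, y, z} - {z} \<subseteq> T" using xy by auto
  ultimately show False using T z(1) unfolding nbc_def by blast
qed

text \<open>A point in a fibre below \<open>b\<close> cannot lie in the span, because adding it
  would give a larger transversal, which is independent. A lighter point \<open>s\<close> in the
  fibre of \<open>b\<close> would bring such a point into the span, namely the third point of the
  line through \<open>s\<close> and \<open>b\<close>.\<close>

lemma transversal_good:
  assumes T: "T \<subseteq> {1..n}" and inj: "inj_on k T" shows "good T"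
  unfolding good_def
proof (intro conjI ballI T)
  fix b s assume b: "b \<in> T" and s: "s \<in> cl {b' \<in> T. wt b \<le> wt b'}"
  let ?D = "{b' \<in> T. wt b \<le> wt b'}"
  have Dg: "?D \<subseteq> {1..n}" using T by auto
  have D: "inj_on k ?D" "indep ?D" using inj_on_subset[OF inj, of ?D] transversal_indep[OF Dg] by auto
  have sg: "s \<in> {1..n}" using s closure_subset_ground by blast
  have bg: "b \<in> {1..n}" using b T by blast
  have kD: "k b \<le> k b'" if "b' \<in> ?D" for b'
    using that wt_less[of b' b] T by (metis (no_types, lifting) linorder_not_less mem_Collect_eq subsetD)
  have no: "z \<notin> cl ?D" if "z \<in> {1..n}" "k z < k b" for z
  proof
    assume z: "z \<in> cl ?D"
    have "k z \<notin> k ` ?D" using kD that by fastforce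
    then have "inj_on k (insert z ?D)" "z \<notin> ?D" using D by auto
    then have "indep (insert z ?D)" using that Dg by (intro transversal_indep) auto
    then show False using closure_indep_iff[OF D(2) that(1) \<open>z \<notin> ?D\<close>] z by simp
  qed
  show "wt b \<le> wt s"
  proof (rule ccontr)
    assume lt: "\<not> wt b \<le> wt s"
    have "\<not> k s < k b" using no[OF sg] s by blast
    moreover have "\<not> k b < k s" using wt_less[of b s] bg lt by auto
    ultimately have eq: "k s = k b" by simp
    have "s \<noteq> b" using lt by auto
    then obtain z where z: "circ {s, b, z}" "k z < k s" using fibre_line[OF sg bg _ eq] by blast
    have zg: "z \<in> {1..n}" using circuit_ground[OF z(1)] by blast
    have ne: "z \<noteq> s" "z \<noteq> b" using z eq by auto
    have "z \<in> cl ({s, b, z} - {z})" by (rule circuit_in_closure[OF z(1)]) simp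
    then have "z \<in> cl {s, b}" using ne by (simp add: insert_Diff_if)
    moreover have "{s, b} \<subseteq> cl ?D" using s b subset_closure[OF Dg] by auto
    from closure_mono[OF this] have "cl {s, b} \<subseteq> cl ?D" unfolding closure_idem[OF Dg] .
    ultimately show False using no[OF zg] z eq by auto
  qed
qed

text \<open>The preimage in \<open>ext\<close> of the left ideal of \<open>A\<close> generated by
  the variables in \<open>S\<close>.\<close>

definition gen_ideal :: "nat set \<Rightarrow> 'k::field ext set" where
  "gen_ideal S = {f. \<exists>g. f - (\<Sum>s\<in>S. g s * gen s) \<in> N}"

lemma gen_ideal_N: "f \<in> N \<Longrightarrow> f \<in> gen_ideal S"
  unfolding gen_ideal_def by (intro CollectI exI[of _ "\<lambda>_. 0"]) simp

lemma gen_ideal_add: "f \<in> gen_ideal S \<Longrightarrow> g \<in> gen_ideal S \<Longrightarrow> f + g \<in> gen_ideal S"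
proof -
  assume "f \<in> gen_ideal S" "g \<in> gen_ideal S"
  then obtain u v where "f - (\<Sum>s\<in>S. u s * gen s) \<in> N" "g - (\<Sum>s\<in>S. v s * gen s) \<in> N"
    by (auto simp: gen_ideal_def)
  from N_add[OF this] have "f + g - (\<Sum>s\<in>S. (u s + v s) * gen s) \<in> N"
    by (simp add: distrib_right sum.distrib algebra_simps)
  then show "f + g \<in> gen_ideal S"
    unfolding gen_ideal_def by (intro CollectI exI[of _ "\<lambda>s. u s + v s"])
qed

lemma gen_ideal_mult: "f \<in> gen_ideal S \<Longrightarrow> h * f \<in> gen_ideal S"
proof -
  assume "f \<in> gen_ideal S"
  then obtain u where "f - (\<Sum>s\<in>S. u s * gen s) \<in> N" by (auto simp: gen_ideal_def)
  from N_mult_left[OF this, of h] have "h * f - (\<Sum>s\<in>S. (h * u s) * gen s) \<in> N"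
    by (simp add: right_diff_distrib sum_distrib_left mult.assoc)
  then show "h * f \<in> gen_ideal S"
    unfolding gen_ideal_def by (intro CollectI exI[of _ "\<lambda>s. h * u s"])
qed

lemma gen_ideal_minus: "f \<in> gen_ideal S \<Longrightarrow> - f \<in> gen_ideal S"
  using gen_ideal_mult[of f S "- 1"] by simp

lemma gen_ideal_diff: "f \<in> gen_ideal S \<Longrightarrow> g \<in> gen_ideal S \<Longrightarrow> f - g \<in> gen_ideal S"
  using gen_ideal_add[of f S "- g"] gen_ideal_minus[of g S] by simp

lemma gen_ideal_sum: "(\<And>x. x \<in> X \<Longrightarrow> f x \<in> gen_ideal S) \<Longrightarrow> sum f X \<in> gen_ideal S"
  by (induction X rule: infinite_finite_induct) (auto intro: gen_ideal_add gen_ideal_N)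

lemma gen_in_gen_ideal:
  assumes "finite S" "s \<in> S" shows "f * gen s \<in> gen_ideal S"
proof -
  have "(\<Sum>t\<in>S. (if t = s then f else 0) * gen t) = (\<Sum>t\<in>S. if t = s then f * gen s else 0)"
    by (rule sum.cong) auto
  also have "\<dots> = f * gen s" using assms by simp
  finally show ?thesis
    unfolding gen_ideal_def by (intro CollectI exI[of _ "\<lambda>t. if t = s then f else 0"]) simp
qed

lemma emon_in_gen_ideal:
  assumes S: "finite S" and T: "finite T" "s \<in> T" "s \<in> S"
  shows "emon T \<in> (gen_ideal S :: 'k::field ext set)"
proof -
  let ?c = "ext_sign (T - {s}) {s} :: 'k"
  have "emon (T - {s}) * gen s = cst ?c * (emon T :: 'k ext)"
    using T by (simp add: emon_mult insert_absorb)
  then have "cst ?c * (emon (T - {s}) * gen s) = cst ?c * (cst ?c * (emon T :: 'k ext))" by simp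
  also have "\<dots> = emon T" by (simp add: ext_sign_def cst_sign_cancel)
  finally have "emon T = cst ?c * emon (T - {s}) * (gen s :: 'k ext)" by (simp add: mult.assoc)
  then show ?thesis using gen_in_gen_ideal[OF S T(3), of "cst ?c * emon (T - {s})"] by simp
qed

text \<open>Only an \<open>s\<close> heavier than \<open>x\<close> and in the same fibre needs an
  argument. The third point \<open>z\<close> of the line through \<open>s\<close> and
  \<open>x\<close> is lighter than both, and the relation of this circuit expresses
  \<open>e_s * e_x\<close> as a multiple of \<open>e_z\<close>.\<close>

lemma gen_mult_gen_ideal:
  fixes x s :: nat
  assumes x: "x \<in> {1..n}" and s: "s \<in> {1..n}" "k s \<le> k x"
  shows "gen s * gen x \<in> (gen_ideal {y \<in> {1..n}. wt y < wt x} :: 'k::field ext set)"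
proof -
  let ?S = "{y \<in> {1..n}. wt y < wt x}"
  have fin: "finite ?S" by simp
  have left: "gen z * gen y \<in> (gen_ideal ?S :: 'k ext set)" if z: "z \<in> ?S" for z y
    unfolding gen_anticommute[of z y] by (intro gen_ideal_minus gen_in_gen_ideal[OF fin z])
  consider "wt s < wt x" | "s = x" | "wt x < wt s"
    using inj_onD[OF wt_inj, of s x] x s by (meson linorder_less_linear)
  then show ?thesis
  proof cases
    case 1 then show ?thesis using left s by simp
  next
    case 2 then show ?thesis using gen_ideal_N[OF N_zero] by simp
  next
    case 3
    have "k s = k x" using wt_less[of s x] s 3 by (cases "k s < k x") auto
    moreover have "s \<noteq> x" using 3 by auto
    ultimately obtain z where z: "circ {s, x, z}" "k z < k x" using fibre_line[of s x] s x by metis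
    have zS: "z \<in> ?S" using circuit_ground[OF z(1)] z(2) wt_less by auto
    have zn: "z \<notin> {s, x}" using z \<open>k s = k x\<close> by auto
    have eq: "{s, x, z} = insert z {s, x}" by auto
    have "bd (insert z {s, x}) \<in> (N :: 'k ext set)"
      using bd_in_N[OF circuit_ground[OF z(1)] circuit_not_indep[OF z(1)]] unfolding eq .
    from N_mult_left[OF this, of "cst ((- 1) ^ card {j \<in> {s, x}. j < z})"]
    have 1: "emon {s, x} - gen z * bd {s, x} \<in> (N :: 'k ext set)"
      by (subst (asm) bd_insert[OF _ zn]) simp_all
    have 2: "gen z * bd {s, x} \<in> (gen_ideal ?S :: 'k ext set)"
      unfolding bd_def sum_distrib_left gen_cst_left_commute
    proof (rule gen_ideal_sum)
      fix i assume "i \<in> {s, x}"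
      then have "{s, x} - {i} = {s} \<or> {s, x} - {i} = {x}" using \<open>s \<noteq> x\<close> by auto
      then show "cst ((- 1) ^ card {j \<in> {s, x}. j < i}) * (gen z * emon ({s, x} - {i})) \<in> (gen_ideal ?S :: 'k ext set)"
        using left[OF zS] by (auto intro: gen_ideal_mult)
    qed
    have "emon {s, x} \<in> (gen_ideal ?S :: 'k ext set)"
      using gen_ideal_add[OF gen_ideal_N[OF 1] 2] by simp
    moreover have "gen s * gen x = cst (ext_sign {s} {x}) * (emon {s, x} :: 'k ext)"
      using \<open>s \<noteq> x\<close> by (simp add: emon_mult insert_commute)
    ultimately show ?thesis using gen_ideal_mult by simp
  qed
qed

text \<open>For the inclusion not covered by \<open>gen_mult_gen_ideal\<close>, \<open>f\<close> is
  reduced to a combination \<open>g\<close> of basis monomials that use only fibres above that of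
  \<open>x\<close>. For such a monomial \<open>T\<close>, the set \<open>insert x T\<close> is again
  a transversal and hence good, and its functional reads off the coefficient of the heaviest
  \<open>T\<close> in \<open>g\<close>.\<close>

lemma colon_ideal:
  fixes f :: "'k::field ext"
  assumes x: "x \<in> {1..n}"
  shows "f * gen x \<in> gen_ideal {y \<in> {1..n}. wt y < wt x} \<longleftrightarrow> f \<in> gen_ideal {y \<in> {1..n}. k y \<le> k x}"
proof -
  let ?S = "{y \<in> {1..n}. wt y < wt x}" and ?F = "{y \<in> {1..n}. k y \<le> k x}"
  have colon_back: "h * gen x \<in> gen_ideal ?S" if h: "h \<in> gen_ideal ?F" for h :: "'k ext"
  proof -
    obtain u where u: "h - (\<Sum>s\<in>?F. u s * gen s) \<in> N" using h by (auto simp: gen_ideal_def)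
    have "(\<Sum>s\<in>?F. u s * gen s) * gen x \<in> gen_ideal ?S"
      unfolding sum_distrib_right mult.assoc
      by (intro gen_ideal_sum gen_ideal_mult gen_mult_gen_ideal[OF x]) auto
    from gen_ideal_add[OF gen_ideal_N[OF N_mult_right[OF u, of "gen x"]] this]
    show ?thesis by (simp add: left_diff_distrib)
  qed
  have "f \<in> gen_ideal ?F" if f: "f * gen x \<in> gen_ideal ?S"
  proof -
    obtain b where fN: "f - (\<Sum>T | nbc T. cst (b T) * emon T) \<in> N" using nbc_span[of f] by (elim exE conjE)
    let ?T = "{T. nbc T \<and> T \<inter> ?F = {}}"
    define g where "g = (\<Sum>T\<in>?T. cst (b T) * (emon T :: 'k ext))"
    have finT: "finite ?T" by (rule finite_nbc)
    have "(\<Sum>T | nbc T. cst (b T) * emon T) = g + (\<Sum>T | nbc T \<and> T \<inter> ?F \<noteq> {}. cst (b T) * (emon T :: 'k ext))"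
    proof -
      let ?R = "{T. nbc T \<and> T \<inter> ?F \<noteq> {}}"
      have "(\<Sum>T | nbc T. cst (b T) * (emon T :: 'k ext)) = (\<Sum>T\<in>?T \<union> ?R. cst (b T) * emon T)"
        by (rule sum.cong) auto
      also have "\<dots> = g + (\<Sum>T\<in>?R. cst (b T) * emon T)"
        unfolding g_def by (rule sum.union_disjoint[OF finT finite_nbc]) auto
      finally show ?thesis .
    qed
    moreover have "(\<Sum>T | nbc T \<and> T \<inter> ?F \<noteq> {}. cst (b T) * (emon T :: 'k ext)) \<in> gen_ideal ?F"
    proof (rule gen_ideal_sum, rule gen_ideal_mult)
      fix T assume T: "T \<in> {T. nbc T \<and> T \<inter> ?F \<noteq> {}}"
      then obtain s where "s \<in> T" "s \<in> ?F" by blast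
      moreover have "finite T" using T nbc_subset finite_if_ground by blast
      ultimately show "emon T \<in> gen_ideal ?F" by (intro emon_in_gen_ideal[of ?F T s]) auto
    qed
    moreover have "f - (\<Sum>T | nbc T. cst (b T) * emon T) \<in> gen_ideal ?F"
      by (rule gen_ideal_N[OF fN])
    ultimately have "f - (\<Sum>T | nbc T. cst (b T) * emon T) \<in> gen_ideal ?F" and
      rest: "(\<Sum>T | nbc T. cst (b T) * emon T) - g \<in> gen_ideal ?F" by simp_all
    from gen_ideal_add[OF this] have fg: "f - g \<in> gen_ideal ?F" by simp
    from gen_ideal_diff[OF f colon_back[OF this]] have gx: "g * gen x \<in> gen_ideal ?S"
      by (simp add: algebra_simps)
    have "b T = 0" if "T \<in> ?T" for T
    proof (rule ccontr)
      assume "b T \<noteq> 0"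
      let ?M = "{T \<in> ?T. b T \<noteq> 0}"
      have "T \<in> ?M" using that \<open>b T \<noteq> 0\<close> by blast
      then have M: "finite ?M" "?M \<noteq> {}" using finite_subset[OF _ finT, of ?M] by blast+
      obtain T where T: "T \<in> ?M" and mx[rule_format]: "\<forall>U\<in>?M. sum wt U \<le> sum wt T"
        by (rule obtain_max[OF M])
      have Tg: "T \<subseteq> {1..n}" using T nbc_subset by blast
      have finU: "finite U" "x \<notin> U" if "U \<in> ?T" for U
        using that nbc_subset finite_if_ground x by blast+
      define B where "B = insert x T"
      have Bg: "B \<subseteq> {1..n}" using Tg x by (simp add: B_def)
      have kT: "k x < k t" if "t \<in> T" for t using T that Tg by fastforce
      have "inj_on k B" unfolding B_def using nbc_inj T kT by fastforce
      then have gB: "good B" by (rule transversal_good[OF Bg])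
      obtain u where u: "g * gen x - (\<Sum>s\<in>?S. u s * gen s) \<in> N" using gx by (auto simp: gen_ideal_def)
      \<comment> \<open>Labels are not heavier than their points, and \<open>s\<close> is lighter
        than all of \<open>B\<close>. So the label of \<open>s\<close> is not in \<open>B\<close>,
        and a multiple of its generator has no \<open>B\<close>-coefficient.\<close>
      have zero: "func B (u s * gen s) = 0" if s: "s \<in> ?S" for s
      proof -
        have ge: "wt x \<le> wt t" if "t \<in> B" for t
          using that kT wt_less[OF _ x, of t] by (auto simp: B_def less_imp_le)
        have "lev B s \<notin> B"
        proof
          assume lB: "lev B s \<in> B"
          then have "lev B s \<noteq> n + 1" using Bg by auto
          then have "wt (lev B s) \<le> wt s" by (cases rule: lev_cases[OF gB, of s]) auto
          then show False using ge[OF lB] s by simp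
        qed
        then show ?thesis using s by (simp add: func_def gsub_mult gsub_gen coeff_mult_gen_notin)
      qed
      have "func B (g * gen x) = func B (g * gen x - (\<Sum>s\<in>?S. u s * gen s)) + func B (\<Sum>s\<in>?S. u s * gen s)"
        unfolding func_add[symmetric] by simp
      also have "\<dots> = 0" using func_N[OF gB u] zero by (simp add: func_sum)
      finally have 0: "func B (g * gen x) = 0" .
      \<comment> \<open>Triangularity and the maximal weight of \<open>T\<close> leave only the
        summand of \<open>T\<close>.\<close>
      have term0: "func B (cst (b U) * (emon U * gen x)) = (if U = T then b T * ext_sign T {x} * func B (emon B) else 0)"
        if U: "U \<in> ?T" for U
      proof -
        have "func B (cst (b U) * (emon U * gen x)) = b U * ext_sign U {x} * func B (emon (insert x U))"
          using finU[OF U] by (simp add: emon_mult func_cst_mult)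
        moreover have "b U = 0 \<or> func B (emon (insert x U)) = (0 :: 'k)" if "U \<noteq> T"
        proof (rule ccontr)
          assume "\<not> ?thesis"
          then have nz: "b U \<noteq> 0" "func B (emon (insert x U)) \<noteq> (0 :: 'k)" by auto
          have "insert x U \<subseteq> {1..n}" using U nbc_subset x by auto
          from func_emon[OF gB this nz(2)] have "insert x U = B \<or> sum wt B < sum wt (insert x U)" .
          moreover have "insert x U \<noteq> B" using that finU[OF U] finU[of T] T by (auto simp: B_def dest: insert_ident)
          ultimately have "sum wt T < sum wt U" using finU[OF U] finU[of T] T by (simp add: B_def)
          then show False using mx[of U] U nz by auto
        qed
        ultimately show ?thesis by (auto simp: B_def)
      qed
      have "func B (g * gen x) = (\<Sum>U\<in>?T. func B (cst (b U) * (emon U * gen x)))"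
        by (simp add: g_def sum_distrib_right mult.assoc func_sum)
      also have "\<dots> = (\<Sum>U\<in>?T. if U = T then b T * ext_sign T {x} * func B (emon B) else 0)"
        by (rule sum.cong) (use term0 in auto)
      also have "\<dots> = b T * ext_sign T {x} * func B (emon B)" using finT T by simp
      finally show False using 0 T func_self[OF gB, where 'k='k] by (auto simp: ext_sign_def)
    qed
    then have "g = 0" unfolding g_def by (intro sum.neutral) auto
    then show ?thesis using fg by simp
  qed
  then show ?thesis using colon_back by blast
qed

end


section \<open>Koszul filtrations\<close>

text \<open>A resolution is built from matrices whose rows have successive colon ideals in the family
  \<open>FF\<close>; the syzygies of such a matrix are the rows of another one. Everything is computed modulo the
  two-sided ideal \<open>N\<close>, \<open>D1\<close> consists of the elements of degree 1, and \<open>h1\<close>, \<open>h2\<close> extract homogeneous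
  components.\<close>

locale koszul_filtration =
  fixes N D1 :: "'r::ring_1 set" and h1 h2 :: "'r \<Rightarrow> 'r" and FF :: "'r list set"
  assumes N_0: "0 \<in> N" and N_plus: "a \<in> N \<Longrightarrow> b \<in> N \<Longrightarrow> a + b \<in> N"
    and N_left: "a \<in> N \<Longrightarrow> b * a \<in> N" and N_right: "a \<in> N \<Longrightarrow> a * b \<in> N"
    and D1_0: "0 \<in> D1" and D1_minus: "a \<in> D1 \<Longrightarrow> - a \<in> D1"
    and h1_D1: "h1 a \<in> D1" and h1_id: "a \<in> D1 \<Longrightarrow> h1 a = a"
    and h2_plus: "h2 (a + b) = h2 a + h2 b" and h2_mult: "r \<in> D1 \<Longrightarrow> h2 (a * r) = h1 a * r"
    and h2_N: "a \<in> N \<Longrightarrow> h2 a \<in> N"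
    and FF_D1: "xs \<in> FF \<Longrightarrow> set xs \<subseteq> D1"
    and FF_colon: "xs \<in> FF \<Longrightarrow> p < length xs \<Longrightarrow>
      \<exists>ys\<in>FF. \<forall>a. (\<exists>v. a * xs ! p - (\<Sum>i<p. v i * xs ! i) \<in> N) \<longleftrightarrow>
        (\<exists>v. a - (\<Sum>i<length ys. v i * ys ! i) \<in> N)"
begin

lemma N_neg: "a \<in> N \<Longrightarrow> - a \<in> N"
  using N_left[of a "- 1"] by simp

lemma N_sub: "a \<in> N \<Longrightarrow> b \<in> N \<Longrightarrow> a - b \<in> N"
  using N_plus[of a "- b"] N_neg[of b] by simp

lemma N_setsum: "(\<And>x. x \<in> X \<Longrightarrow> f x \<in> N) \<Longrightarrow> sum f X \<in> N"
  by (induction X rule: infinite_finite_induct) (auto intro: N_plus N_0)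

lemma h2_zero: "h2 0 = 0"
  using h2_plus[of 0 0] by simp

lemma h2_sum: "h2 (sum f X) = (\<Sum>x\<in>X. h2 (f x))"
  by (induction X rule: infinite_finite_induct) (auto simp: h2_plus h2_zero)

lemma h2_minus: "h2 (a - b) = h2 a - h2 b"
  using h2_plus[of "a - b" b] by (simp add: algebra_simps)

text \<open>The rows of \<open>r\<close> consist of linear forms, and for every row the colon of the
  submodule generated by the preceding rows is the left ideal of a member of \<open>FF\<close>, all
  modulo \<open>N\<close>.\<close>

definition filt :: "nat \<Rightarrow> nat \<Rightarrow> (nat \<Rightarrow> nat \<Rightarrow> 'r) \<Rightarrow> bool" where
  "filt b c r \<longleftrightarrow> (\<forall>j<b. \<forall>k<c. r j k \<in> D1) \<and>
    (\<forall>j<b. \<exists>xs\<in>FF. \<forall>a. (\<exists>v. \<forall>k<c. a * r j k - (\<Sum>i<j. v i * r i k) \<in> N) \<longleftrightarrow>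
      (\<exists>v. a - (\<Sum>i<length xs. v i * xs ! i) \<in> N))"

text \<open>Exactness modulo \<open>N\<close>: the rows of \<open>r'\<close> generate the relations
  among the rows of \<open>r\<close>.\<close>

definition syz :: "nat \<Rightarrow> nat \<Rightarrow> (nat \<Rightarrow> nat \<Rightarrow> 'r) \<Rightarrow> nat \<Rightarrow> (nat \<Rightarrow> nat \<Rightarrow> 'r) \<Rightarrow> bool" where
  "syz b c r b' r' \<longleftrightarrow> (\<forall>v. (\<forall>k<c. (\<Sum>j<b. v j * r j k) \<in> N) \<longleftrightarrow>
    (\<exists>u. \<forall>j<b. v j - (\<Sum>i<b'. u i * r' i j) \<in> N))"

text \<open>In a relation among \<open>Suc b\<close> rows the last coefficient lies in the colon
  ideal of the last row. Hence the syzygies are those of the first \<open>b\<close> rows together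
  with one lift for each generator \<open>xs ! p\<close> of that colon ideal. The new matrix has the
  colon ideals of \<open>r'\<close> followed by those of \<open>xs\<close>.\<close>

lemma filt_syz_step:
  assumes filt: "filt (Suc b) c r" and filt': "filt b' b r'" and syz: "syz b c r b' r'"
  shows "\<exists>b'' r''. filt b'' (Suc b) r'' \<and> syz (Suc b) c r b'' r''"
proof -
  obtain xs where xs: "xs \<in> FF" and colon: "\<And>a. (\<exists>v. \<forall>k<c. a * r b k - (\<Sum>i<b. v i * r i k) \<in> N) \<longleftrightarrow>
      (\<exists>v. a - (\<Sum>i<length xs. v i * xs ! i) \<in> N)"
    using filt unfolding filt_def by (meson lessI)
  have rD: "r j k \<in> D1" if "j \<le> b" "k < c" for j k
    using filt that unfolding filt_def by (simp add: less_Suc_eq_le)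
  have syzI: "\<exists>u. \<forall>j<b. v j - (\<Sum>i<b'. u i * r' i j) \<in> N"
    if "\<And>k. k < c \<Longrightarrow> (\<Sum>j<b. v j * r j k) \<in> N" for v
  proof -
    have "\<forall>k<c. (\<Sum>j<b. v j * r j k) \<in> N" using that by blast
    then show ?thesis using syz unfolding syz_def by simp
  qed
  have syzD: "(\<Sum>j<b. v j * r j k) \<in> N"
    if u: "\<exists>u. \<forall>j<b. v j - (\<Sum>i<b'. u i * r' i j) \<in> N" and k: "k < c" for v k
    using syz[unfolded syz_def, THEN spec, of v, THEN iffD2, OF u] k by blast
  have xD: "xs ! p \<in> D1" if "p < length xs" for p
    using FF_D1[OF xs] that nth_mem by blast
  have "\<exists>v. \<forall>k<c. xs ! p * r b k - (\<Sum>i<b. v i * r i k) \<in> N" if p: "p < length xs" for p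
  proof -
    have "(\<Sum>i<length xs. (if i = p then 1 else 0) * xs ! i) = (\<Sum>i<length xs. if i = p then xs ! p else 0)"
      by (rule sum.cong) auto
    also have "\<dots> = xs ! p" using p by simp
    finally have "xs ! p - (\<Sum>i<length xs. (if i = p then 1 else 0) * xs ! i) \<in> N" using N_0 by simp
    then have "\<exists>v. xs ! p - (\<Sum>i<length xs. v i * xs ! i) \<in> N"
      by (rule exI[of _ "\<lambda>i. if i = p then 1 else 0"])
    then show ?thesis unfolding colon .
  qed
  then have "\<forall>p. \<exists>v. p < length xs \<longrightarrow> (\<forall>k<c. xs ! p * r b k - (\<Sum>i<b. v i * r i k) \<in> N)" by blast
  then obtain V0 where V0: "\<And>p k. p < length xs \<Longrightarrow> k < c \<Longrightarrow> xs ! p * r b k - (\<Sum>i<b. V0 p i * r i k) \<in> N"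
    by metis
  \<comment> \<open>The lifts can be chosen linear: \<open>xs ! p * r b k\<close> has degree 2, and
    taking the degree 2 part of the relation replaces the coefficients by their degree 1
    parts.\<close>
  define V where "V p i = h1 (V0 p i)" for p i
  have VD: "V p i \<in> D1" for p i unfolding V_def by (rule h1_D1)
  have V: "xs ! p * r b k - (\<Sum>i<b. V p i * r i k) \<in> N" if "p < length xs" "k < c" for p k
  proof -
    have "h2 (xs ! p * r b k - (\<Sum>i<b. V0 p i * r i k)) = xs ! p * r b k - (\<Sum>i<b. V p i * r i k)"
      using that rD xD by (simp add: h2_minus h2_sum h2_mult h1_id V_def)
    then show ?thesis using h2_N[OF V0[OF that]] by simp
  qed
  \<comment> \<open>First the rows of \<open>r'\<close>, padded by 0 in column \<open>b\<close>,
    then the rows with left part \<open>- V p\<close> and last entry \<open>xs ! p\<close>.\<close>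
  define r'' where "r'' m j = (if m < b' then if j < b then r' m j else 0
      else if j = b then xs ! (m - b') else - V (m - b') j)" for m j
  let ?l = "length xs"
  have low: "r'' m j = r' m j" "r'' m b = 0" if "m < b'" "j < b" for m j
    using that by (auto simp: r''_def)
  have lowb: "r'' m b = 0" if "m < b'" for m using that by (auto simp: r''_def)
  have high: "r'' (b' + p) b = xs ! p" "j < b \<Longrightarrow> r'' (b' + p) j = - V p j" for p j
    by (auto simp: r''_def)
  have split: "(\<Sum>m<b' + p. u m * r'' m j) = (\<Sum>m<b'. u m * r'' m j) + (\<Sum>q<p. u (b' + q) * r'' (b' + q) j)"
    for u p j
  proof -
    have "{..<b' + p} = {..<b'} \<union> (\<lambda>q. b' + q) ` {..<p}"
    proof -
      have "m \<in> (\<lambda>q. b' + q) ` {..<p}" if "m < b' + p" "\<not> m < b'" for m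
        using that by (intro image_eqI[of _ _ "m - b'"]) auto
      then show ?thesis by auto
    qed
    moreover have "(\<Sum>m\<in>(\<lambda>q. b' + q) ` {..<p}. u m * r'' m j) = (\<Sum>q<p. u (b' + q) * r'' (b' + q) j)"
      by (subst sum.reindex) auto
    ultimately show ?thesis by (simp add: sum.union_disjoint image_iff disjoint_iff)
  qed
  have split_low: "(\<Sum>m<b' + p. u m * r'' m j) = (\<Sum>m<b'. u m * r' m j) - (\<Sum>q<p. u (b' + q) * V q j)"
    if "j < b" for u p j
    unfolding split using that by (simp add: low high sum_negf)
  have split_b: "(\<Sum>m<b' + p. u m * r'' m b) = (\<Sum>q<p. u (b' + q) * xs ! q)" for u p
    unfolding split by (simp add: lowb high)
  have kerV: "(\<Sum>j<b. (\<Sum>q<p. u q * V q j) * r j k) - (\<Sum>q<p. u q * xs ! q) * r b k \<in> N"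
    if "p \<le> ?l" "k < c" for u p k
  proof -
    have "(\<Sum>j<b. (\<Sum>q<p. u q * V q j) * r j k) = (\<Sum>q<p. u q * (\<Sum>j<b. V q j * r j k))"
      unfolding sum_distrib_right sum_distrib_left by (subst sum.swap) (simp add: mult.assoc)
    then have "(\<Sum>j<b. (\<Sum>q<p. u q * V q j) * r j k) - (\<Sum>q<p. u q * xs ! q) * r b k =
        - (\<Sum>q<p. u q * (xs ! q * r b k - (\<Sum>j<b. V q j * r j k)))"
      by (simp add: sum_distrib_right right_diff_distrib sum_subtractf mult.assoc)
    also have "\<dots> \<in> N" by (intro N_neg N_setsum N_left V) (use that in auto)
    finally show ?thesis .
  qed
  have "syz (Suc b) c r (b' + ?l) r''"
    unfolding syz_def
  proof (rule allI, rule iffI)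
    fix v assume v: "\<forall>k<c. (\<Sum>j<Suc b. v j * r j k) \<in> N"
    have "v b * r b k - (\<Sum>i<b. (- v i) * r i k) \<in> N" if "k < c" for k
      using v[rule_format, OF that] by (simp add: sum_negf add.commute)
    then have "\<exists>u. \<forall>k<c. v b * r b k - (\<Sum>i<b. u i * r i k) \<in> N" by (intro exI allI impI)
    then obtain u where u: "v b - (\<Sum>i<?l. u i * xs ! i) \<in> N" unfolding colon by blast
    \<comment> \<open>Subtracting the combination \<open>u\<close> of the lifts clears the last
      coefficient of \<open>v\<close> modulo \<open>N\<close>; what remains is a relation among the
      first \<open>b\<close> rows.\<close>
    define z where "z j = v j + (\<Sum>q<?l. u q * V q j)" for j
    have "(\<Sum>j<b. z j * r j k) \<in> N" if k: "k < c" for k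
    proof -
      have "(\<Sum>j<b. z j * r j k) = (\<Sum>j<Suc b. v j * r j k) - (v b - (\<Sum>i<?l. u i * xs ! i)) * r b k
          + ((\<Sum>j<b. (\<Sum>q<?l. u q * V q j) * r j k) - (\<Sum>q<?l. u q * xs ! q) * r b k)"
        by (simp add: z_def distrib_right sum.distrib left_diff_distrib)
      also have "\<dots> \<in> N" by (intro N_plus N_sub N_right[OF u] kerV) (use v k in auto)
      finally show ?thesis .
    qed
    then obtain u' where u': "\<And>j. j < b \<Longrightarrow> z j - (\<Sum>i<b'. u' i * r' i j) \<in> N"
      using syzI[of z] by blast
    define w where "w m = (if m < b' then u' m else u (m - b'))" for m
    have w: "(\<Sum>i<b'. w i * g i) = (\<Sum>i<b'. u' i * g i)" "w (b' + q) = u q" for g q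
      by (auto simp: w_def)
    have "v j - (\<Sum>m<b' + ?l. w m * r'' m j) \<in> N" if j: "j < Suc b" for j
    proof (cases "j < b")
      case True
      then show ?thesis unfolding split_low[OF True] w using u'[OF True] by (simp add: z_def algebra_simps)
    next
      case False
      then have "j = b" using j by simp
      then show ?thesis using u by (simp add: split_b w)
    qed
    then show "\<exists>u. \<forall>j<Suc b. v j - (\<Sum>i<b' + ?l. u i * r'' i j) \<in> N" by blast
  next
    fix v assume "\<exists>u. \<forall>j<Suc b. v j - (\<Sum>i<b' + ?l. u i * r'' i j) \<in> N"
    then obtain u where u: "\<And>j. j < Suc b \<Longrightarrow> v j - (\<Sum>i<b' + ?l. u i * r'' i j) \<in> N" by blast
    show "\<forall>k<c. (\<Sum>j<Suc b. v j * r j k) \<in> N"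
    proof (intro allI impI)
      fix k assume k: "k < c"
      let ?U = "\<lambda>j. \<Sum>i<b'. u i * r' i j"
      have "\<exists>u'. \<forall>j<b. ?U j - (\<Sum>i<b'. u' i * r' i j) \<in> N" using N_0 by (intro exI[of _ u]) simp
      then have U: "(\<Sum>j<b. ?U j * r j k) \<in> N" by (rule syzD[OF _ k])
      have "(\<Sum>j<Suc b. v j * r j k) = (\<Sum>j<Suc b. (v j - (\<Sum>i<b' + ?l. u i * r'' i j)) * r j k)
          + (\<Sum>j<b. ?U j * r j k) - ((\<Sum>j<b. (\<Sum>q<?l. u (b' + q) * V q j) * r j k) - (\<Sum>q<?l. u (b' + q) * xs ! q) * r b k)"
      proof -
        have "(\<Sum>j<b. (\<Sum>i<b' + ?l. u i * r'' i j) * r j k) =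
            (\<Sum>j<b. ?U j * r j k) - (\<Sum>j<b. (\<Sum>q<?l. u (b' + q) * V q j) * r j k)"
          unfolding sum_subtractf[symmetric] left_diff_distrib[symmetric]
          by (rule sum.cong) (simp_all add: split_low)
        then show ?thesis by (simp add: split_b left_diff_distrib sum_subtractf)
      qed
      also have "\<dots> \<in> N"
        by (intro N_sub N_plus U kerV[OF le_refl k, of "\<lambda>q. u (b' + q)"] N_setsum N_right u) auto
      finally show "(\<Sum>j<Suc b. v j * r j k) \<in> N" .
    qed
  qed
  moreover have "filt (b' + ?l) (Suc b) r''"
    unfolding filt_def
  proof (intro conjI allI impI)
    fix m j assume "m < b' + ?l" "j < Suc b"
    then show "r'' m j \<in> D1"
      using filt' xD[of "m - b'"] VD D1_0 D1_minus unfolding filt_def r''_def by auto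
  next
    fix m assume m: "m < b' + ?l"
    show "\<exists>ys\<in>FF. \<forall>a. (\<exists>v. \<forall>j<Suc b. a * r'' m j - (\<Sum>i<m. v i * r'' i j) \<in> N) \<longleftrightarrow>
      (\<exists>v. a - (\<Sum>i<length ys. v i * ys ! i) \<in> N)"
    proof (cases "m < b'")
      case True
      have "(\<forall>j<Suc b. a * r'' m j - (\<Sum>i<m. v i * r'' i j) \<in> N) \<longleftrightarrow>
          (\<forall>j<b. a * r' m j - (\<Sum>i<m. v i * r' i j) \<in> N)" for a v
      proof -
        have "(\<Sum>i<m. v i * r'' i b) = 0" using True by (intro sum.neutral) (auto simp: lowb)
        then have "a * r'' m b - (\<Sum>i<m. v i * r'' i b) \<in> N" using True N_0 by (simp add: lowb)
        moreover have "a * r'' m j - (\<Sum>i<m. v i * r'' i j) = a * r' m j - (\<Sum>i<m. v i * r' i j)" if "j < b" for j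
          using True that by (simp add: low)
        ultimately show ?thesis by (auto simp: less_Suc_eq)
      qed
      then show ?thesis using filt' True unfolding filt_def by simp
    next
      case False
      define p where "p = m - b'"
      have p: "m = b' + p" "p < ?l" using False m by (auto simp: p_def)
      obtain ys where ys: "ys \<in> FF" "\<And>a. (\<exists>v. a * xs ! p - (\<Sum>i<p. v i * xs ! i) \<in> N) \<longleftrightarrow>
        (\<exists>v. a - (\<Sum>i<length ys. v i * ys ! i) \<in> N)" using FF_colon[OF xs p(2)] by blast
      have "(\<exists>v. \<forall>j<Suc b. a * r'' m j - (\<Sum>i<m. v i * r'' i j) \<in> N) \<longleftrightarrow>
          (\<exists>v. a * xs ! p - (\<Sum>i<p. v i * xs ! i) \<in> N)" for a
      proof
        assume "\<exists>v. \<forall>j<Suc b. a * r'' m j - (\<Sum>i<m. v i * r'' i j) \<in> N"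
        then obtain v where "a * r'' m b - (\<Sum>i<m. v i * r'' i b) \<in> N" by blast
        then have "a * xs ! p - (\<Sum>q<p. v (b' + q) * xs ! q) \<in> N" unfolding p(1) split_b high(1) .
        then show "\<exists>v. a * xs ! p - (\<Sum>i<p. v i * xs ! i) \<in> N" by (rule exI[of _ "\<lambda>q. v (b' + q)"])
      next
        assume "\<exists>v. a * xs ! p - (\<Sum>i<p. v i * xs ! i) \<in> N"
        then obtain v where v: "a * xs ! p - (\<Sum>i<p. v i * xs ! i) \<in> N" by blast
        \<comment> \<open>The error that a solution in the last column leaves in the other columns.
          It is a relation among the first \<open>b\<close> rows, hence absorbed by the rows of
          \<open>r'\<close>, so the colon ideal of row \<open>b' + p\<close> is decided by the last
          column.\<close>
        define z where "z j = (\<Sum>q<p. v q * V q j) - a * V p j" for j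
        have "(\<Sum>j<b. z j * r j k) \<in> N" if k: "k < c" for k
        proof -
          have "(\<Sum>j<b. z j * r j k) = ((\<Sum>j<b. (\<Sum>q<p. v q * V q j) * r j k) - (\<Sum>q<p. v q * xs ! q) * r b k)
            + a * (xs ! p * r b k - (\<Sum>j<b. V p j * r j k)) - (a * xs ! p - (\<Sum>i<p. v i * xs ! i)) * r b k"
            by (simp add: z_def left_diff_distrib right_diff_distrib sum_subtractf sum_distrib_left mult.assoc)
          also have "\<dots> \<in> N"
            by (intro N_sub N_plus kerV N_left N_right[OF v] V) (use p k in auto)
          finally show ?thesis .
        qed
        then obtain u where u: "\<And>j. j < b \<Longrightarrow> z j - (\<Sum>i<b'. u i * r' i j) \<in> N"
          using syzI[of z] by blast
        define w where "w m = (if m < b' then u m else v (m - b'))" for m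
        have w: "(\<Sum>i<b'. w i * g i) = (\<Sum>i<b'. u i * g i)" "w (b' + q) = v q" for g q
          by (auto simp: w_def)
        have "a * r'' m j - (\<Sum>i<m. w i * r'' i j) \<in> N" if j: "j < Suc b" for j
        proof (cases "j < b")
          case True
          have "a * r'' m j - (\<Sum>i<m. w i * r'' i j) = z j - (\<Sum>i<b'. u i * r' i j)"
            unfolding p(1) split_low[OF True] w using True by (simp add: high z_def algebra_simps)
          then show ?thesis using u[OF True] by simp
        next
          case False
          then have "j = b" using j by simp
          then show ?thesis using v unfolding p(1) by (simp add: split_b w high)
        qed
        then show "\<exists>v. \<forall>j<Suc b. a * r'' m j - (\<Sum>i<m. v i * r'' i j) \<in> N" by blast
      qed
      then show ?thesis using ys by auto
    qed
  qed
  ultimately show ?thesis by blast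
qed

lemma filt_syz: "filt b c r \<Longrightarrow> \<exists>b' r'. filt b' b r' \<and> syz b c r b' r'"
proof (induction b)
  case 0
  have "filt 0 0 (\<lambda>_ _. 0)" "syz 0 c r 0 (\<lambda>_ _. 0)"
    using N_0 by (simp_all add: filt_def syz_def)
  then show ?case by blast
next
  case (Suc b)
  then have "filt b c r" by (simp add: filt_def)
  then show ?case using Suc filt_syz_step by blast
qed

lemma filt_resolution:
  assumes "filt b1 b0 r0"
  shows "\<exists>b r. b 0 = b0 \<and> b 1 = b1 \<and> r 0 = r0 \<and> (\<forall>i. filt (b (Suc i)) (b i) (r i)) \<and>
    (\<forall>i. syz (b (Suc i)) (b i) (r i) (b (Suc (Suc i))) (r (Suc i)))"
proof -
  \<comment> \<open>The clause for \<open>i = 0\<close> pins the start of the chosen sequence to the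
    given matrix.\<close>
  let ?P = "\<lambda>i (b, c, r). filt b c r \<and> (i = (0::nat) \<longrightarrow> b = b1 \<and> c = b0 \<and> r = r0)"
  let ?Q = "\<lambda>i (b, c, r) (b', c', r'). c' = b \<and> syz b c r b' r'"
  have "\<exists>f. \<forall>i. ?P i (f i) \<and> ?Q i (f i) (f (Suc i))"
  proof (rule dependent_nat_choice)
    show "\<exists>x. ?P 0 x" using assms by auto
    fix x i assume "?P i x"
    then obtain b c r where x: "x = (b, c, r)" "filt b c r" by (cases x) auto
    obtain b' r' where "filt b' b r'" "syz b c r b' r'" using filt_syz[OF x(2)] by blast
    then show "\<exists>y. ?P (Suc i) y \<and> ?Q i x y" using x by (intro exI[of _ "(b', b, r')"]) simp
  qed
  then obtain f where f: "\<forall>i. ?P i (f i) \<and> ?Q i (f i) (f (Suc i))" by (elim exE)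
  define B C R where "B i = fst (f i)" and "C i = fst (snd (f i))" and "R i = snd (snd (f i))" for i
  have fi: "f i = (B i, C i, R i)" for i by (simp add: B_def C_def R_def)
  have 1: "filt (B i) (C i) (R i)" "C (Suc i) = B i" "syz (B i) (C i) (R i) (B (Suc i)) (R (Suc i))" for i
    using f[THEN spec, of i] unfolding fi by simp_all
  have 0: "B 0 = b1" "C 0 = b0" "R 0 = r0" using f[THEN spec, of 0] unfolding fi by simp_all
  show ?thesis by (rule exI[of _ C], rule exI[of _ R]) (use 0 1 in simp)
qed

end


section \<open>Koszulness of the Orlik-Solomon algebra\<close>

text \<open>Each monomial is split at its largest generator, which already stands on the right; so
  no signs arise.\<close>

lemma hom_deg_Suc_expand:
  assumes f: "hom_deg (Suc p) f"
  obtains g where "\<And>j. hom_deg p (g j)" "trunc n f = (\<Sum>j\<in>{1..n}. g j * gen j)"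
proof -
  let ?P = "{T. T \<subseteq> {1..n} \<and> T \<noteq> {}}"
  define g where "g j = (\<Sum>T\<in>{T \<in> ?P. Max T = j}. cst (coeff f T) * emon (T - {j}))" for j
  have finP: "finite ?P" by (rule finite_subset[of _ "Pow {1..n}"]) auto
  have fin: "finite T" if "T \<in> ?P" for T using that finite_subset by blast
  have "hom_deg p (g j)" for j
    unfolding g_def
  proof (rule hom_deg_sum)
    fix T assume T: "T \<in> {T \<in> ?P. Max T = j}"
    then have finT: "finite T" using fin by blast
    then have "j \<in> T" using T Max_in by auto
    then have c: "card (T - {j}) = card T - 1" using finT by simp
    show "hom_deg p (cst (coeff f T) * emon (T - {j}))"
    proof (cases "card T = Suc p")
      case True
      then show ?thesis using hom_deg_emon[of "T - {j}"] finT c by (intro hom_deg_cst_mult) simp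
    next
      case False
      then have "coeff f T = 0" using f by (simp add: hom_deg_def)
      then show ?thesis by simp
    qed
  qed
  moreover have "trunc n f = (\<Sum>j\<in>{1..n}. g j * gen j)"
  proof -
    have summand: "cst (coeff f T) * emon (T - {Max T}) * gen (Max T) = cst (coeff f T) * emon T" if T: "T \<in> ?P" for T
    proof -
      have finT: "finite T" and ne: "T \<noteq> {}" using T fin by auto
      then have m: "Max T \<in> T" by simp
      have "{(i, j). i \<in> T - {Max T} \<and> j \<in> {Max T} \<and> j < i} = {}"
        using finT Max_ge[of T] by (fastforce simp: not_less)
      then have "ext_sign (T - {Max T}) {Max T} = (1 :: 'a)"
        unfolding ext_sign_def by (simp only: card.empty power_0)
      then show ?thesis using finT m by (simp add: mult.assoc emon_mult insert_absorb)
    qed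
    have "trunc n f = (\<Sum>T\<in>Pow {1..n}. cst (coeff f T) * emon T)" by (rule trunc_expand)
    also have "\<dots> = (\<Sum>T\<in>?P. cst (coeff f T) * emon T)"
    proof (rule sum.mono_neutral_right)
      have "coeff f {} = 0" using f by (simp add: hom_deg_def)
      then show "\<forall>T\<in>Pow {1..n} - ?P. cst (coeff f T) * emon T = 0" by auto
    qed auto
    also have "\<dots> = (\<Sum>T\<in>?P. cst (coeff f T) * emon (T - {Max T}) * gen (Max T))"
      by (rule sum.cong) (use summand in auto)
    also have "\<dots> = (\<Sum>j\<in>{1..n}. \<Sum>T\<in>{T \<in> ?P. Max T = j}. cst (coeff f T) * emon (T - {Max T}) * gen (Max T))"
    proof (rule sum.group[symmetric])
      show "Max ` ?P \<subseteq> {1..n}" using fin Max_in by blast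
    qed (use finP in auto)
    also have "\<dots> = (\<Sum>j\<in>{1..n}. g j * gen j)"
      unfolding g_def sum_distrib_right by (intro sum.cong) auto
    finally show ?thesis .
  qed
  ultimately show ?thesis by (rule that)
qed

section \<open>Matrices over the quotient as congruences modulo \<open>N\<close>\<close>

context orlik_solomon
begin

lemma proj_sum: "finite X \<Longrightarrow> proj (sum f X) = finsum A (\<lambda>x. proj (f x)) X"
proof -
  interpret A: ring A by (rule A_ring)
  show "finite X \<Longrightarrow> proj (sum f X) = finsum A (\<lambda>x. proj (f x)) X"
    by (induction X rule: finite_induct) (simp_all add: proj_zero proj_add)
qed

lemma free_module_iff: "v \<in> free_module A b \<longleftrightarrow> (\<exists>u. v = (\<lambda>j\<in>{..<b}. proj (u j)))"
proof
  assume v: "v \<in> free_module A b"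
  have "\<forall>j\<in>{..<b}. \<exists>f. v j = proj f"
  proof
    fix j assume "j \<in> {..<b}"
    then have "v j \<in> range proj" using v PiE_mem[of v "{..<b}" "\<lambda>_. carrier A"] by (simp add: free_module_def carrier_A)
    then show "\<exists>f. v j = proj f" by blast
  qed
  then obtain u where "\<forall>j\<in>{..<b}. v j = proj (u j)" by metis
  then have "v = (\<lambda>j\<in>{..<b}. proj (u j))"
    using v by (intro HOL.ext) (auto simp: free_module_def PiE_def extensional_def)
  then show "\<exists>u. v = (\<lambda>j\<in>{..<b}. proj (u j))" by blast
qed (auto simp: free_module_def)

lemma free_module_range: "free_module A b = range (\<lambda>u. \<lambda>j\<in>{..<b}. proj (u j))"
  by (rule Set.set_eqI) (simp only: free_module_iff image_iff bex_UNIV)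

context
  fixes b c :: nat and D :: "nat \<Rightarrow> nat \<Rightarrow> (nat set \<Rightarrow> 'k::field) set" and R :: "nat \<Rightarrow> nat \<Rightarrow> 'k ext"
  assumes D: "\<And>j k. j < b \<Longrightarrow> k < c \<Longrightarrow> D j k = proj (R j k)"
begin

lemma mat_apply_proj:
  "mat_apply A b c D (\<lambda>j\<in>{..<b}. proj (u j)) = (\<lambda>k\<in>{..<c}. proj (\<Sum>j<b. u j * R j k))"
proof -
  interpret A: ring "A :: (nat set \<Rightarrow> 'k) set ring" by (rule A_ring)
  have "(\<Oplus>\<^bsub>A\<^esub>j\<in>{..<b}. (\<lambda>j\<in>{..<b}. proj (u j)) j \<otimes>\<^bsub>A\<^esub> D j k) = proj (\<Sum>j<b. u j * R j k)" if "k < c" for k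
    unfolding proj_sum[OF finite_lessThan] by (rule A.finsum_cong') (use that D in \<open>auto simp: proj_mult\<close>)
  then show ?thesis unfolding mat_apply_def by (intro HOL.ext) auto
qed

lemma restrict_proj_eq_iff:
  "(\<lambda>k\<in>{..<c}. proj (z k)) = (\<lambda>k\<in>{..<c}. proj (y k)) \<longleftrightarrow> (\<forall>k<c. z k - y k \<in> N)"
  unfolding proj_eq_iff[symmetric] by (auto simp: restrict_def fun_eq_iff)

lemma mat_image_iff:
  "(\<lambda>k\<in>{..<c}. proj (z k)) \<in> mat_image A b c D \<longleftrightarrow> (\<exists>u. \<forall>k<c. z k - (\<Sum>j<b. u j * R j k) \<in> N)"
proof -
  have "mat_image A b c D = range (\<lambda>u. \<lambda>k\<in>{..<c}. proj (\<Sum>j<b. u j * R j k))"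
    unfolding mat_image_def free_module_range image_image mat_apply_proj ..
  then show ?thesis by (simp only: image_iff restrict_proj_eq_iff bex_UNIV)
qed

lemma mat_image_free: "x \<in> mat_image A b c D \<Longrightarrow> x \<in> free_module A c"
  unfolding mat_image_def free_module_range image_image mat_apply_proj
proof (elim imageE)
  fix u assume "x = (\<lambda>k\<in>{..<c}. proj (\<Sum>j<b. u j * R j k))"
  then show "x \<in> range (\<lambda>u. \<lambda>j\<in>{..<c}. proj (u j))"
    by (rule image_eqI[of _ _ "\<lambda>k. \<Sum>j<b. u j * R j k"]) simp
qed

lemma mat_kernel_iff:
  "(\<lambda>j\<in>{..<b}. proj (v j)) \<in> mat_kernel A b c D \<longleftrightarrow> (\<forall>k<c. (\<Sum>j<b. v j * R j k) \<in> N)"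
proof -
  have "(\<lambda>k\<in>{..<c}. \<zero>\<^bsub>A\<^esub>) = (\<lambda>k\<in>{..<c}. proj (0 :: 'k ext))" by (simp add: proj_zero)
  then show ?thesis
    unfolding mat_kernel_def mem_Collect_eq mat_apply_proj free_module_iff
    using restrict_proj_eq_iff[of "\<lambda>k. \<Sum>j<b. v j * R j k" "\<lambda>_. 0"] by auto
qed

end

end

section \<open>Linear resolutions and quadratic relations\<close>

context weighted_orlik_solomon
begin

text \<open>Elements of positive degree are left combinations of the variables, by
  \<open>hom_deg_Suc_expand\<close>; conversely such a combination splits into components of degrees
  1 to \<open>n\<close>.\<close>

lemma irrelevant_ideal_iff:
  "proj f \<in> irrelevant_ideal A (OS_homogeneous n indep) \<longleftrightarrow>
    (\<exists>g. f - (\<Sum>j\<in>{1..n}. g j * gen j) \<in> (N :: 'k::field ext set))"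
proof
  assume "proj f \<in> irrelevant_ideal A (OS_homogeneous n indep)"
  then obtain m x where mx: "proj f = finsum A x {1..m}" "\<And>p. p \<in> {1..m} \<Longrightarrow> x p \<in> OS_homogeneous n indep p"
    by (auto simp: irrelevant_ideal_def)
  have "\<forall>p\<in>{1..m}. \<exists>h :: 'k ext. hom_deg p h \<and> x p = proj h"
    using mx(2) unfolding OS_homogeneous_eq by blast
  then obtain h :: "nat \<Rightarrow> 'k ext" where h: "\<And>p. p \<in> {1..m} \<Longrightarrow> hom_deg p (h p)" "\<And>p. p \<in> {1..m} \<Longrightarrow> x p = proj (h p)"
    by metis
  interpret A: ring "A :: (nat set \<Rightarrow> 'k) set ring" by (rule A_ring)
  have "proj f = proj (\<Sum>p\<in>{1..m}. h p)"
    unfolding mx(1) proj_sum[OF finite_atLeastAtMost] by (rule A.finsum_cong') (use h in auto)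
  then have fh: "f - (\<Sum>p\<in>{1..m}. h p) \<in> N" by (simp add: proj_eq_iff)
  have "\<forall>p\<in>{1..m}. \<exists>g. trunc n (h p) = (\<Sum>j\<in>{1..n}. g j * gen j)"
  proof
    fix p assume p: "p \<in> {1..m}"
    then have "hom_deg (Suc (p - 1)) (h p)" using h(1) by simp
    from hom_deg_Suc_expand[OF this, where n=n]
    show "\<exists>g. trunc n (h p) = (\<Sum>j\<in>{1..n}. g j * gen j)" by metis
  qed
  then obtain g where g: "\<And>p. p \<in> {1..m} \<Longrightarrow> trunc n (h p) = (\<Sum>j\<in>{1..n}. g p j * gen j)" by metis
  have "(\<Sum>p\<in>{1..m}. h p - trunc n (h p)) \<in> N" by (intro N_sum N_diff_trunc)
  from N_add[OF fh this] have "f - (\<Sum>p\<in>{1..m}. trunc n (h p)) \<in> N" by (simp add: sum_subtractf)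
  moreover have "(\<Sum>p\<in>{1..m}. trunc n (h p)) = (\<Sum>j\<in>{1..n}. (\<Sum>p\<in>{1..m}. g p j) * gen j)"
    unfolding sum_distrib_right by (subst sum.swap) (intro sum.cong g refl)
  ultimately show "\<exists>g. f - (\<Sum>j\<in>{1..n}. g j * gen j) \<in> N" by auto
next
  assume "\<exists>g. f - (\<Sum>j\<in>{1..n}. g j * gen j) \<in> (N :: 'k ext set)"
  then obtain g where g: "f - (\<Sum>j\<in>{1..n}. g j * gen j) \<in> (N :: 'k ext set)" by blast
  define f' where "f' = trunc n (\<Sum>j\<in>{1..n}. g j * gen j)"
  have f': "proj f = proj f'" using g by (simp add: f'_def proj_trunc proj_eq_iff)
  \<comment> \<open>Every summand ends in a generator, so there is no constant term.\<close>
  have "hcomp 0 f' = 0"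
    by (simp add: hcomp_0 f'_def coeff_trunc coeff_mult_gen_notin)
  have "f' = (\<Sum>p\<le>n. hcomp p f')" using trunc_eq_sum_hcomp[of n f'] by (simp add: f'_def)
  also have "\<dots> = (\<Sum>p\<in>{1..n}. hcomp p f')"
    by (rule sum.mono_neutral_right) (use \<open>hcomp 0 f' = 0\<close> in \<open>auto simp: not_less_eq_eq\<close>)
  finally have "proj f = finsum A (\<lambda>p. proj (hcomp p f')) {1..n}"
    unfolding f' using proj_sum[of "{1..n}" "\<lambda>p. hcomp p f'"] by simp
  moreover have "\<forall>p\<in>{1..n}. proj (hcomp p f') \<in> OS_homogeneous n indep p"
    unfolding OS_homogeneous_eq by simp
  ultimately show "proj f \<in> irrelevant_ideal A (OS_homogeneous n indep)"
    unfolding irrelevant_ideal_def by blast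
qed

text \<open>Straightening in degree at most 2 uses only circuits with 3 elements, whose boundaries
  the substitution kills. Run inside the part of \<open>N\<close> that is killed, it ends in a
  normal form, which is 0 by independence.\<close>

lemma gsub_N_low_degree:
  assumes three: "\<And>C. circ C \<Longrightarrow> card C = 3 \<Longrightarrow> \<not> inj_on l C"
    and f: "f \<in> N" "hom_deg q f" "q \<le> 2"
  shows "gsub n l f = (0 :: 'k::field ext)"
proof -
  let ?Z = "{f \<in> N. gsub n l f = (0 :: 'k ext)}"
  have "\<exists>a. trunc n f - (\<Sum>T | nbc T \<and> card T = q. cst (a T) * emon T) \<in> ?Z"
  proof (rule straighten)
    fix C assume C: "circ C" "card C \<le> q + 1"
    then have "card C = 3" using circuit_card[OF C(1)] f(3) by simp
    then have "gsub n l (bd C) = (0 :: 'k ext)"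
      using three C circuit_ground by (intro gsub_bd_collision) auto
    then show "bd C \<in> ?Z" using bd_in_N[OF circuit_ground circuit_not_indep] C by simp
  qed (use f in \<open>auto simp: gsub_add gsub_mult hom_deg_trunc intro: N_add N_mult_left\<close>)
  then obtain a where a: "trunc n f - (\<Sum>T | nbc T \<and> card T = q. cst (a T) * emon T) \<in> ?Z" by blast
  have "trunc n f - (trunc n f - (\<Sum>T | nbc T \<and> card T = q. cst (a T) * emon T)) \<in> (N :: 'k ext set)"
    by (rule N_diff) (use a f in \<open>auto simp: N_trunc\<close>)
  then have "(\<Sum>T | nbc T \<and> card T = q. cst (a T) * emon T) \<in> (N :: 'k ext set)" by simp
  then have a0: "a T = 0" if "nbc T" "card T = q" for T
    using good_independent[of "{T. nbc T \<and> card T = q}" a] finite_nbc nbc_good that by auto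
  have "(\<Sum>T | nbc T \<and> card T = q. cst (a T) * (emon T :: 'k ext)) = 0"
    using a0 by (intro sum.neutral) auto
  then show ?thesis using a by (simp add: gsub_trunc)
qed

text \<open>A linear resolution starts with a presentation of the irrelevant ideal by linear forms with
  linear relations among them, so a substitution that kills the quadratic relations kills them all.\<close>

lemma koszul_gsub_N:
  assumes kos: "koszul (A :: (nat set \<Rightarrow> 'k::field) set ring) (OS_homogeneous n indep)"
    and three: "\<And>C. circ C \<Longrightarrow> card C = 3 \<Longrightarrow> \<not> inj_on l C"
    and f: "f \<in> N" "hom_deg q f"
  shows "gsub n l f = (0 :: 'k ext)"
proof -
  let ?A = "A :: (nat set \<Rightarrow> 'k) set ring"
  have low: "gsub n l h = 0" if "h \<in> N" "hom_deg q h" "q \<le> 2" for h :: "'k ext" and q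
    by (rule gsub_N_low_degree[OF _ that]) (rule three)
  obtain b d where res: "linear_resolution ?A (OS_homogeneous n indep) b d"
    using kos by (auto simp: koszul_def)
  have b0: "b 0 = 1" and lin: "\<And>i j k. j < b (Suc i) \<Longrightarrow> k < b i \<Longrightarrow> d i j k \<in> OS_homogeneous n indep 1"
    and im0: "mat_image ?A (b 1) (b 0) (d 0) = {v \<in> free_module ?A (b 0). v 0 \<in> irrelevant_ideal ?A (OS_homogeneous n indep)}"
    and ex: "\<And>i. mat_image ?A (b (Suc (Suc i))) (b (Suc i)) (d (Suc i)) = mat_kernel ?A (b (Suc i)) (b i) (d i)"
    using res unfolding linear_resolution_def by auto
  have "\<forall>i j k. \<exists>g. j < b (Suc i) \<longrightarrow> k < b i \<longrightarrow> hom_deg 1 g \<and> d i j k = proj g"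
    using lin unfolding OS_homogeneous_eq by blast
  then obtain D :: "nat \<Rightarrow> nat \<Rightarrow> nat \<Rightarrow> 'k ext"
    where D: "\<And>i j k. j < b (Suc i) \<Longrightarrow> k < b i \<Longrightarrow> hom_deg 1 (D i j k) \<and> d i j k = proj (D i j k)"
    by metis
  \<comment> \<open>The linear forms that the first map of the resolution sends the basis vectors
    to.\<close>
  define Y where "Y j = D 0 j 0" for j
  have Y: "hom_deg 1 (Y j)" if "j < b 1" for j unfolding Y_def using D[of j 0 0] that b0 by simp
  have D0: "d 0 j k = proj (D 0 j k)" if "j < b 1" "k < b 0" for j k using D[of j 0 k] that by simp
  have D1: "d 1 j k = proj (D 1 j k)" "hom_deg 1 (D 1 j k)" if "j < b 2" "k < b 1" for j k
    using D[of j 1 k] that by (simp_all add: numeral_2_eq_2)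
  have image0: "(\<lambda>k\<in>{..<b 0}. proj (z k)) \<in> mat_image ?A (b 1) (b 0) (d 0) \<longleftrightarrow>
      (\<exists>u. \<forall>k<b 0. z k - (\<Sum>j<b 1. u j * D 0 j k) \<in> N)" for z
    by (rule mat_image_iff) (rule D0)
  have kernel0: "(\<lambda>j\<in>{..<b 1}. proj (v j)) \<in> mat_kernel ?A (b 1) (b 0) (d 0) \<longleftrightarrow>
      (\<forall>k<b 0. (\<Sum>j<b 1. v j * D 0 j k) \<in> N)" for v
    by (rule mat_kernel_iff) (rule D0)
  have image1: "(\<lambda>k\<in>{..<b 1}. proj (z k)) \<in> mat_image ?A (b 2) (b 1) (d 1) \<longleftrightarrow>
      (\<exists>u. \<forall>k<b 1. z k - (\<Sum>j<b 2. u j * D 1 j k) \<in> N)" for z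
    by (rule mat_image_iff) (rule D1(1))
  have ex0: "mat_image ?A (b 2) (b 1) (d 1) = mat_kernel ?A (b 1) (b 0) (d 0)"
    using ex[of 0] by (simp add: numeral_2_eq_2)
  have "\<exists>V. gen j - (\<Sum>k<b 1. V k * Y k) \<in> (N :: 'k ext set)" if j: "j \<in> {1..n}" for j
  proof -
    have "(\<Sum>i\<in>{1..n}. (if i = j then 1 else 0) * gen i) = (\<Sum>i\<in>{1..n}. if i = j then (gen j :: 'k ext) else 0)"
      by (rule sum.cong) auto
    also have "\<dots> = gen j" using j by simp
    finally have "gen j - (\<Sum>i\<in>{1..n}. (if i = j then 1 else 0) * gen i) \<in> (N :: 'k ext set)" by simp
    then have "proj (gen j :: 'k ext) \<in> irrelevant_ideal ?A (OS_homogeneous n indep)"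
      unfolding irrelevant_ideal_iff by (rule exI[of _ "\<lambda>i. if i = j then 1 else 0"])
    then have "(\<lambda>k\<in>{..<b 0}. proj (gen j :: 'k ext)) \<in> mat_image ?A (b 1) (b 0) (d 0)"
      unfolding im0 mem_Collect_eq free_module_iff using b0 by (intro conjI exI[of _ "\<lambda>_. gen j"]) simp_all
    then have "\<exists>V. \<forall>k<b 0. gen j - (\<Sum>i<b 1. V i * D 0 i k) \<in> N" by (rule image0[THEN iffD1])
    then show ?thesis using b0 unfolding Y_def by auto
  qed
  then obtain V where V: "\<And>j. j \<in> {1..n} \<Longrightarrow> gen j - (\<Sum>k<b 1. V j k * Y k) \<in> (N :: 'k ext set)" by metis
  \<comment> \<open>Constants suffice to express the variables by the \<open>Y k\<close> modulo
    \<open>N\<close>, since the relation has degree 1; this keeps the degree of \<open>u k\<close>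
    below that of \<open>f\<close> in the induction.\<close>
  define al where "al j k = hcomp 0 (V j k)" for j k
  have al: "gen j - (\<Sum>k<b 1. al j k * Y k) \<in> (N :: 'k ext set)" if j: "j \<in> {1..n}" for j
  proof -
    have "hcomp 1 (V j k * Y k) = al j k * Y k" if "k < b 1" for k
      using hcomp_mult_right[OF Y[OF that], of 0 "V j k"] by (simp add: al_def)
    then have "hcomp 1 (gen j - (\<Sum>k<b 1. V j k * Y k)) = gen j - (\<Sum>k<b 1. al j k * Y k)"
      using hcomp_hom_deg[OF hom_deg_gen] by (simp add: hcomp_diff hcomp_sum)
    then show ?thesis using N_hcomp[OF V[OF j], of 1] by simp
  qed
  have al_gsub: "gen (l j) = (\<Sum>k<b 1. gsub n l (al j k) * gsub n l (Y k))" if j: "j \<in> {1..n}" for j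
  proof -
    have "hom_deg 1 (gen j - (\<Sum>k<b 1. al j k * Y k))"
    proof (intro hom_deg_diff hom_deg_gen hom_deg_sum)
      fix k assume "k \<in> {..<b 1}"
      then show "hom_deg 1 (al j k * Y k)" using hom_deg_mult[of 0 "al j k" 1 "Y k"] Y by (simp add: al_def)
    qed
    from low[OF al[OF j] this]
    have "gsub n l (gen j - (\<Sum>k<b 1. al j k * Y k)) = 0" by simp
    then show ?thesis using gsub_gen[OF j, of l, where 'a='k] by (simp add: gsub_diff gsub_sum gsub_mult)
  qed
  \<comment> \<open>A unit vector shows that each row of the second matrix is a relation among the
    \<open>Y k\<close>. Its entries are linear, so the relation has degree 2 and \<open>low\<close>
    applies.\<close>
  have rel: "gsub n l (\<Sum>k<b 1. D 1 m k * Y k) = 0" if m: "m < b 2" for m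
  proof (rule low)
    have "(\<Sum>i<b 2. (if i = m then 1 else 0) * D 1 i k) = (\<Sum>i<b 2. if i = m then D 1 m k else 0)" for k
      by (rule sum.cong) auto
    then have "\<exists>u. \<forall>k<b 1. D 1 m k - (\<Sum>i<b 2. u i * D 1 i k) \<in> N"
      using m by (intro exI[of _ "\<lambda>i. if i = m then 1 else 0"]) simp
    then have "(\<lambda>k\<in>{..<b 1}. proj (D 1 m k)) \<in> mat_image ?A (b 2) (b 1) (d 1)"
      by (rule image1[THEN iffD2])
    then have "\<forall>k<b 0. (\<Sum>j<b 1. D 1 m j * D 0 j k) \<in> N"
      unfolding ex0 by (rule kernel0[THEN iffD1])
    then show "(\<Sum>k<b 1. D 1 m k * Y k) \<in> N" using b0 by (simp add: Y_def)
    show "hom_deg 2 (\<Sum>k<b 1. D 1 m k * Y k)"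
    proof (rule hom_deg_sum)
      fix k assume "k \<in> {..<b 1}"
      then show "hom_deg 2 (D 1 m k * Y k)"
        using hom_deg_mult[of 1 "D 1 m k" 1 "Y k"] D1(2)[OF m] Y by (simp add: numeral_2_eq_2)
    qed
  qed (rule order_refl)
  from f show ?thesis
  proof (induction q arbitrary: f rule: less_induct)
    case (less q)
    show ?case
    proof (cases "q \<le> 2")
      case True then show ?thesis using low less.prems by blast
    next
      case False
      then obtain s where s: "q = Suc (Suc s)" by (metis add_2_eq_Suc le_add_diff_inverse nat_le_linear)
      obtain g where g: "\<And>j. hom_deg (Suc s) (g j)" "trunc n f = (\<Sum>j\<in>{1..n}. g j * gen j)"
        using hom_deg_Suc_expand[of "Suc s" f n] less.prems(2) s by metis
      \<comment> \<open>\<open>f\<close> becomes the combination of the \<open>Y k\<close> with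
        coefficients \<open>u k\<close>, modulo \<open>N\<close>. As \<open>f\<close> is in
        \<open>N\<close>, these coefficients form a syzygy and come from the second matrix.\<close>
      define u where "u k = (\<Sum>j\<in>{1..n}. g j * al j k)" for k
      have hu: "hom_deg (Suc s) (u k)" for k
        unfolding u_def
      proof (rule hom_deg_sum)
        fix j show "hom_deg (Suc s) (g j * al j k)"
          using hom_deg_mult[OF g(1), of 0 "al j k" j] by (simp add: al_def)
      qed
      have "(\<Sum>k<b 1. u k * Y k) = trunc n f - (\<Sum>j\<in>{1..n}. g j * (gen j - (\<Sum>k<b 1. al j k * Y k)))"
      proof -
        have "(\<Sum>k<b 1. u k * Y k) = (\<Sum>j\<in>{1..n}. g j * (\<Sum>k<b 1. al j k * Y k))"
          unfolding u_def sum_distrib_right sum_distrib_left by (subst sum.swap) (simp add: mult.assoc)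
        then show ?thesis by (simp add: g(2) right_diff_distrib sum_subtractf)
      qed
      also have "\<dots> \<in> N"
      proof (rule N_diff)
        show "trunc n f \<in> N" using less.prems(1) by (simp add: N_trunc)
        show "(\<Sum>j\<in>{1..n}. g j * (gen j - (\<Sum>k<b 1. al j k * Y k))) \<in> N"
          by (rule N_sum, rule N_mult_left, rule al)
      qed
      finally have "\<forall>i<b 0. (\<Sum>k<b 1. u k * D 0 k i) \<in> N" using b0 by (simp add: Y_def)
      then have "(\<lambda>k\<in>{..<b 1}. proj (u k)) \<in> mat_kernel ?A (b 1) (b 0) (d 0)"
        by (rule kernel0[THEN iffD2])
      then have "\<exists>H. \<forall>k<b 1. u k - (\<Sum>m<b 2. H m * D 1 m k) \<in> N"
        unfolding ex0[symmetric] by (rule image1[THEN iffD1])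
      then obtain H where H: "\<And>k. k < b 1 \<Longrightarrow> u k - (\<Sum>m<b 2. H m * D 1 m k) \<in> N" by (elim exE) blast
      \<comment> \<open>Coefficients of degree \<open>s\<close> make the expression of
        \<open>u k\<close> homogeneous of degree \<open>Suc s\<close>, which is less than
        \<open>q\<close>, so that the induction hypothesis turns the congruence into an equality
        after substitution.\<close>
      let ?H = "\<lambda>m. hcomp s (H m)"
      have guk: "gsub n l (u k) = (\<Sum>m<b 2. gsub n l (?H m) * gsub n l (D 1 m k))" if k: "k < b 1" for k
      proof -
        have "hcomp (Suc s) (H m * D 1 m k) = ?H m * D 1 m k" if "m < b 2" for m
          using hcomp_mult_right[OF D1(2)[OF that k], of s "H m"] by simp
        then have "hcomp (Suc s) (u k - (\<Sum>m<b 2. H m * D 1 m k)) = u k - (\<Sum>m<b 2. ?H m * D 1 m k)"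
          using hcomp_hom_deg[OF hu] by (simp add: hcomp_diff hcomp_sum)
        then have uN: "u k - (\<Sum>m<b 2. ?H m * D 1 m k) \<in> N" using N_hcomp[OF H[OF k], of "Suc s"] by simp
        have "hom_deg (Suc s) (u k - (\<Sum>m<b 2. ?H m * D 1 m k))"
        proof (intro hom_deg_diff hu hom_deg_sum)
          fix m assume "m \<in> {..<b 2}"
          then show "hom_deg (Suc s) (?H m * D 1 m k)"
            using hom_deg_mult[of s "?H m" 1 "D 1 m k"] D1(2)[of m k] k by simp
        qed
        from less.IH[OF _ uN this] s have "gsub n l (u k - (\<Sum>m<b 2. ?H m * D 1 m k)) = 0" by blast
        then show ?thesis by (simp add: gsub_diff gsub_sum gsub_mult)
      qed
      have "gsub n l f = gsub n l (trunc n f)" by (simp add: gsub_trunc)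
      also have "\<dots> = (\<Sum>j\<in>{1..n}. gsub n l (g j) * (\<Sum>k<b 1. gsub n l (al j k) * gsub n l (Y k)))"
        unfolding g(2) gsub_sum gsub_mult by (rule sum.cong) (simp_all only: gsub_gen al_gsub)
      also have "\<dots> = (\<Sum>k<b 1. gsub n l (u k) * gsub n l (Y k))"
        unfolding u_def gsub_sum gsub_mult sum_distrib_right sum_distrib_left
        by (subst sum.swap) (simp add: mult.assoc)
      also have "\<dots> = (\<Sum>k<b 1. (\<Sum>m<b 2. gsub n l (?H m) * gsub n l (D 1 m k)) * gsub n l (Y k))"
        by (rule sum.cong) (simp_all add: guk)
      also have "\<dots> = (\<Sum>m<b 2. gsub n l (?H m) * gsub n l (\<Sum>k<b 1. D 1 m k * Y k))"
        unfolding gsub_sum gsub_mult sum_distrib_right sum_distrib_left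
        by (subst sum.swap) (simp add: mult.assoc)
      also have "\<dots> = 0"
      proof (rule sum.neutral, rule ballI)
        fix m assume "m \<in> {..<b 2}"
        then have "gsub n l (\<Sum>k<b 1. D 1 m k * Y k) = 0" by (intro rel) simp
        then show "gsub n l (?H m) * gsub n l (\<Sum>k<b 1. D 1 m k * Y k) = 0" by (simp only: mult_zero_right)
      qed
      finally show ?thesis .
    qed
  qed
qed

end

text \<open>The terms of the boundary have distinct image monomials, so none of them can
  cancel.\<close>

lemma gsub_bd_injective:
  assumes C: "C \<subseteq> {1..n}" "C \<noteq> {}" and inj: "inj_on l C"
  shows "gsub n l (bd C) \<noteq> (0 :: 'k::field ext)"
proof -
  obtain c where c: "c \<in> C" using C by blast
  have fin: "finite C" using C finite_subset by blast
  let ?s = "\<lambda>i. (- 1 :: 'k) ^ card {j \<in> C. j < i}" and ?U = "l ` (C - {c})"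
  have summand: "coeff (gsub n l (emon (C - {i})) :: 'k ext) ?U = 0 \<longleftrightarrow> i \<noteq> c" if i: "i \<in> C" for i
  proof -
    have sub: "C - {i} \<subseteq> {1..n}" and inj': "inj_on l (C - {i})"
      using C inj_on_subset[OF inj, of "C - {i}"] by auto
    obtain s where s: "s \<noteq> 0" "gsub n l (emon (C - {i})) = cst s * (emon (l ` (C - {i})) :: 'k ext)"
      using gsub_emon_cases(2)[OF sub inj'] by blast
    have "l ` (C - {c}) = l ` (C - {i}) \<longleftrightarrow> C - {c} = C - {i}"
      by (rule inj_on_image_eq_iff[OF inj]) auto
    moreover have "C - {c} = C - {i} \<longleftrightarrow> i = c" using c i by blast
    ultimately show ?thesis using s fin by (simp add: coeff_emon)
  qed
  have "coeff (gsub n l (bd C) :: 'k ext) ?U = (\<Sum>i\<in>C. ?s i * coeff (gsub n l (emon (C - {i}))) ?U)"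
    by (simp add: bd_def gsub_sum gsub_cst_mult)
  also have "\<dots> = (\<Sum>i\<in>C. if i = c then ?s c * coeff (gsub n l (emon (C - {c}))) ?U else 0)"
    by (rule sum.cong) (use summand in auto)
  also have "\<dots> = ?s c * coeff (gsub n l (emon (C - {c}))) ?U" using c fin by simp
  finally have "coeff (gsub n l (bd C) :: 'k ext) ?U \<noteq> 0" using summand[OF c] by simp
  then show ?thesis by auto
qed

lemma (in ordered_orlik_solomon) koszul_imp_two:
  assumes disj: "pairwise disjnt MBC"
    and kos: "koszul (A :: (nat set \<Rightarrow> 'k::field) set ring) (OS_homogeneous n indep)"
  shows "\<forall>Q\<in>MBC. card Q = 2"
proof (rule ccontr)
  assume "\<not> ?thesis"
  then obtain Q where Q: "Q \<in> MBC" "3 \<le> card Q"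
    using broken_circuit_bounds(2)[OF MBC_broken] by fastforce
  obtain C where C: "circ C" "inj_on (collapse Q) C" using collapse_circuit[OF Q(1)] by blast
  have Cg: "C \<subseteq> {1..n}" "C \<noteq> {}" using C(1) circuit_ground circuit_card by force+
  have "gsub n (collapse Q) (bd C) = (0 :: 'k ext)"
    by (rule koszul_gsub_N[OF kos _ bd_in_N[OF Cg(1) circuit_not_indep[OF C(1)]]
          hom_deg_bd[OF circuit_finite[OF C(1)]]]) (rule collapse_three_circuit[OF disj Q])
  then show False using gsub_bd_injective[OF Cg C(2), where 'k='k] by blast
qed

lemma set_take_sorted_wrt:
  fixes f :: "'a \<Rightarrow> nat"
  assumes "sorted_wrt (\<lambda>x y. f x < f y) L" "p < length L"
  shows "set (take p L) = {y \<in> set L. f y < f (L ! p)}"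
proof
  show "set (take p L) \<subseteq> {y \<in> set L. f y < f (L ! p)}"
  proof
    fix y assume "y \<in> set (take p L)"
    then obtain i where "i < p" "y = L ! i" using assms(2) by (auto simp: in_set_conv_nth)
    then show "y \<in> {y \<in> set L. f y < f (L ! p)}"
      using sorted_wrt_nth_less[OF assms(1), of i p] assms(2) by simp
  qed
  show "{y \<in> set L. f y < f (L ! p)} \<subseteq> set (take p L)"
  proof
    fix y assume "y \<in> {y \<in> set L. f y < f (L ! p)}"
    then obtain i where i: "i < length L" "y = L ! i" "f (L ! i) < f (L ! p)" by (auto simp: in_set_conv_nth)
    have "i < p"
    proof (rule ccontr)
      assume "\<not> i < p"
      then have "f (L ! p) \<le> f (L ! i)"
        using assms i(1) sorted_wrt_nth_less[OF assms(1), of p i] by (cases "i = p") auto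
      then show False using i by simp
    qed
    then show "y \<in> set (take p L)" using i by (auto simp: in_set_conv_nth intro!: exI[of _ i])
  qed
qed

section \<open>The filtration by levels and its resolution\<close>

context fibred_orlik_solomon
begin

definition wt_list :: "nat list" where
  "wt_list = sort_key wt [1..<Suc n]"

definition level_list :: "nat \<Rightarrow> nat list" where
  "level_list j = filter (\<lambda>x. k x < j) wt_list"

lemma set_wt_list: "set wt_list = {1..n}"
  by (auto simp: wt_list_def)

lemma set_level_list: "set (level_list j) = {x \<in> {1..n}. k x < j}"
  by (auto simp: level_list_def set_wt_list)

lemma wt_list_sorted: "sorted_wrt (\<lambda>x y. wt x < wt y) wt_list"
proof -
  have "distinct (map wt wt_list)"
    unfolding distinct_map set_wt_list by (rule conjI[OF _ wt_inj]) (simp add: wt_list_def)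
  moreover have "sorted (map wt wt_list)" by (simp add: wt_list_def)
  ultimately have "sorted_wrt (<) (map wt wt_list)" by (simp only: strict_sorted_iff)
  then show ?thesis unfolding sorted_wrt_map .
qed

lemma gen_ideal_list:
  assumes "distinct es"
  shows "(\<exists>v. f - (\<Sum>i<length es. v i * gen (es ! i)) \<in> N) \<longleftrightarrow> f \<in> (gen_ideal (set es) :: 'k::field ext set)"
proof
  assume "\<exists>v. f - (\<Sum>i<length es. v i * gen (es ! i)) \<in> N"
  then obtain v where v: "f - (\<Sum>i<length es. v i * gen (es ! i)) \<in> N" by blast
  have "(\<Sum>i<length es. v i * gen (es ! i)) \<in> (gen_ideal (set es) :: 'k ext set)"
    by (intro gen_ideal_sum gen_in_gen_ideal) auto
  from gen_ideal_add[OF gen_ideal_N[OF v] this] show "f \<in> gen_ideal (set es)" by simp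
next
  assume "f \<in> gen_ideal (set es)"
  then obtain g where g: "f - (\<Sum>s\<in>set es. g s * gen s) \<in> N" by (auto simp: gen_ideal_def)
  have "(\<Sum>s\<in>set es. g s * gen s) = (\<Sum>i<length es. g (es ! i) * (gen (es ! i) :: 'k ext))"
    using sum.reindex_bij_betw[OF bij_betw_nth[OF assms refl refl], of "\<lambda>s. g s * gen s"] by simp
  then show "\<exists>v. f - (\<Sum>i<length es. v i * gen (es ! i)) \<in> N"
    using g by (intro exI[of _ "\<lambda>i. g (es ! i)"]) simp
qed

lemma distinct_level_list: "distinct (level_list j)"
  by (simp add: level_list_def wt_list_def)

text \<open>A point lighter than \<open>x\<close> is in no higher fibre, so the entries before
  \<open>x\<close> in a level are all the lighter points of the ground set. Then
  \<open>colon_ideal\<close> applies, and its answer is the level that ends with the fibre of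
  \<open>x\<close>.\<close>

lemma level_list_colon:
  assumes p: "p < length (level_list j)"
  shows "(\<exists>v. a * gen (level_list j ! p) - (\<Sum>i<p. v i * gen (level_list j ! i)) \<in> N) \<longleftrightarrow>
    (\<exists>v. a - (\<Sum>i<length (level_list (Suc (k (level_list j ! p)))).
        v i * gen (level_list (Suc (k (level_list j ! p))) ! i)) \<in> (N :: 'k::field ext set))"
proof -
  define x where "x = level_list j ! p"
  let ?t = "take p (level_list j)"
  have x: "x \<in> {1..n}" "k x < j" using nth_mem[OF p] by (auto simp: x_def set_level_list)
  have "sorted_wrt (\<lambda>x y. wt x < wt y) (level_list j)"
    unfolding level_list_def by (rule sorted_wrt_filter[OF wt_list_sorted])
  then have "set ?t = {y \<in> set (level_list j). wt y < wt x}"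
    unfolding x_def using p by (rule set_take_sorted_wrt)
  also have "\<dots> = {y \<in> {1..n}. wt y < wt x}"
  proof -
    have "k y < j" if "wt y < wt x" for y
      using wt_less[of x y] x that by (cases "k x < k y") auto
    then show ?thesis by (auto simp: set_level_list)
  qed
  finally have t: "set ?t = {y \<in> {1..n}. wt y < wt x}" .
  have len: "length ?t = p" using p by simp
  have "(\<Sum>i<p. v i * gen (level_list j ! i)) = (\<Sum>i<length ?t. v i * (gen (?t ! i) :: 'k ext))" for v
    unfolding len by (rule sum.cong) auto
  then have "(\<exists>v. a * gen x - (\<Sum>i<p. v i * gen (level_list j ! i)) \<in> (N :: 'k ext set)) \<longleftrightarrow> a * gen x \<in> gen_ideal (set ?t)"
    using gen_ideal_list[of ?t "a * gen x"] distinct_level_list[of j] by simp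
  also have "\<dots> \<longleftrightarrow> a \<in> gen_ideal {y \<in> {1..n}. k y \<le> k x}"
    unfolding t by (rule colon_ideal[OF x(1)])
  also have "{y \<in> {1..n}. k y \<le> k x} = set (level_list (Suc (k x)))"
    by (auto simp: set_level_list)
  also note gen_ideal_list[OF distinct_level_list, symmetric]
  finally show ?thesis unfolding x_def .
qed

text \<open>The lists of variables of the levels form the family \<open>FF\<close>; the axiom on
  degree 2 parts of \<open>N\<close> is the gradedness of the ideal, \<open>N_hcomp\<close>.\<close>

lemma koszul: "koszul (A :: (nat set \<Rightarrow> 'k::field) set ring) (OS_homogeneous n indep)"
proof -
  let ?A = "A :: (nat set \<Rightarrow> 'k) set ring"
  define FF where "FF = range (\<lambda>j. map gen (level_list j) :: 'k ext list)"
  interpret F: koszul_filtration "N :: 'k ext set" "{f. hom_deg 1 f}" "hcomp 1" "hcomp 2" FF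
  proof unfold_locales
    fix r a :: "'k ext" assume "r \<in> {f. hom_deg 1 f}"
    then show "hcomp 2 (a * r) = hcomp 1 a * r"
      using hcomp_mult_right[of 1 r 1 a] by (simp add: numeral_2_eq_2)
  next
    fix xs :: "'k ext list" assume "xs \<in> FF"
    then show "set xs \<subseteq> {f. hom_deg 1 f}" unfolding FF_def using hom_deg_gen by auto
  next
    fix xs :: "'k ext list" and p assume "xs \<in> FF" and p: "p < length xs"
    then obtain j where xs: "xs = map gen (level_list j)" unfolding FF_def by blast
    have p': "p < length (level_list j)" using p xs by simp
    let ?ys = "map gen (level_list (Suc (k (level_list j ! p)))) :: 'k ext list"
    have "(\<exists>v. a * xs ! p - (\<Sum>i<p. v i * xs ! i) \<in> N) \<longleftrightarrow> (\<exists>v. a - (\<Sum>i<length ?ys. v i * ?ys ! i) \<in> N)" for a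
    proof -
      have "(\<Sum>i<p. v i * xs ! i) = (\<Sum>i<p. v i * gen (level_list j ! i))" for v
        using p' by (intro sum.cong) (auto simp: xs)
      moreover have "(\<Sum>i<length ?ys. v i * ?ys ! i) =
          (\<Sum>i<length (level_list (Suc (k (level_list j ! p)))). v i * gen (level_list (Suc (k (level_list j ! p))) ! i))" for v
        by (rule sum.cong) auto
      ultimately show ?thesis using level_list_colon[OF p', of a] p' by (simp add: xs)
    qed
    then show "\<exists>ys\<in>FF. \<forall>a. (\<exists>v. a * xs ! p - (\<Sum>i<p. v i * xs ! i) \<in> N) \<longleftrightarrow> (\<exists>v. a - (\<Sum>i<length ys. v i * ys ! i) \<in> N)"
      unfolding FF_def by blast
  qed (auto simp: N_add N_mult_left N_mult_right hom_deg_minus hcomp_hom_deg hcomp_add N_hcomp)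
  obtain t where t: "level t = {1..n}" by (rule level_top)
  define L where "L = level_list t"
  have setL: "set L = {1..n}" using t unfolding L_def set_level_list level_def .
  \<comment> \<open>The first matrix is the column of all variables by increasing weight. Its image
    is the irrelevant ideal, and its colon ideals are those of the largest level.\<close>
  define r0 :: "nat \<Rightarrow> nat \<Rightarrow> 'k ext" where "r0 j i = gen (L ! j)" for j i
  have "F.filt (length L) 1 r0"
    unfolding F.filt_def
  proof (intro conjI allI impI)
    show "r0 j i \<in> {f. hom_deg 1 f}" for j i by (simp add: r0_def hom_deg_gen[simplified])
    fix p assume p: "p < length L"
    have "map gen L \<in> FF" by (simp add: FF_def L_def)
    moreover have "p < length (map gen L)" using p by simp
    ultimately obtain ys where ys: "ys \<in> FF" "\<forall>a. (\<exists>v. a * map gen L ! p - (\<Sum>i<p. v i * map gen L ! i) \<in> N) \<longleftrightarrow>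
        (\<exists>v. a - (\<Sum>i<length ys. v i * ys ! i) \<in> N)" using F.FF_colon by blast
    have "(\<Sum>i<p. v i * map gen L ! i) = (\<Sum>i<p. v i * r0 i 0)" for v
      using p by (intro sum.cong) (auto simp: r0_def)
    then show "\<exists>xs\<in>FF. \<forall>a. (\<exists>v. \<forall>i<1. a * r0 p i - (\<Sum>j<p. v j * r0 j i) \<in> N) \<longleftrightarrow> (\<exists>v. a - (\<Sum>i<length xs. v i * xs ! i) \<in> N)"
      using ys p by (intro bexI[of _ ys]) (simp_all add: r0_def)
  qed
  from F.filt_resolution[OF this] obtain b r where br: "b 0 = 1" "b 1 = length L" "r 0 = r0"
    "\<forall>i. F.filt (b (Suc i)) (b i) (r i)" "\<forall>i. F.syz (b (Suc i)) (b i) (r i) (b (Suc (Suc i))) (r (Suc i))"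
    by (elim exE conjE)
  define d where "d i j c = proj (r i j c)" for i j c
  have "linear_resolution ?A (OS_homogeneous n indep) b d"
    unfolding linear_resolution_def
  proof (intro conjI allI impI)
    show "b 0 = 1" by (rule br(1))
    fix i j c assume "j < b (Suc i)" "c < b i"
    then have "hom_deg 1 (r i j c)" using br(4)[THEN spec, of i] unfolding F.filt_def by blast
    then show "d i j c \<in> OS_homogeneous n indep 1" unfolding OS_homogeneous_eq d_def by blast
  next
    have "x \<in> mat_image ?A (b 1) (b 0) (d 0) \<longleftrightarrow>
      x \<in> free_module ?A (b 0) \<and> x 0 \<in> irrelevant_ideal ?A (OS_homogeneous n indep)" for x
    proof (cases "x \<in> free_module ?A (b 0)")
      case True
      then obtain z where z: "x = (\<lambda>j\<in>{..<b 0}. proj (z j))" using free_module_iff by blast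
      have "x \<in> mat_image ?A (b 1) (b 0) (d 0) \<longleftrightarrow> (\<exists>u. \<forall>c<b 0. z c - (\<Sum>j<b 1. u j * r 0 j c) \<in> N)"
        unfolding z by (rule mat_image_iff) (simp add: d_def)
      also have "\<dots> \<longleftrightarrow> z 0 \<in> gen_ideal {1..n}"
        using gen_ideal_list[of L "z 0"] distinct_level_list[of t] br setL by (simp add: r0_def L_def)
      also have "\<dots> \<longleftrightarrow> x 0 \<in> irrelevant_ideal ?A (OS_homogeneous n indep)"
        unfolding z using br(1) by (simp add: irrelevant_ideal_iff gen_ideal_def)
      finally show ?thesis using True by simp
    next
      case False
      then show ?thesis using mat_image_free[of "b 1" "b 0" "d 0" "r 0" x] by (auto simp: d_def)
    qed
    then show "mat_image ?A (b 1) (b 0) (d 0) =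
      {v \<in> free_module ?A (b 0). v 0 \<in> irrelevant_ideal ?A (OS_homogeneous n indep)}" by blast
  next
    fix i
    have "x \<in> mat_image ?A (b (Suc (Suc i))) (b (Suc i)) (d (Suc i)) \<longleftrightarrow> x \<in> mat_kernel ?A (b (Suc i)) (b i) (d i)" for x
    proof (cases "x \<in> free_module ?A (b (Suc i))")
      case True
      then obtain z where z: "x = (\<lambda>j\<in>{..<b (Suc i)}. proj (z j))" using free_module_iff by blast
      have "x \<in> mat_image ?A (b (Suc (Suc i))) (b (Suc i)) (d (Suc i)) \<longleftrightarrow>
        (\<exists>u. \<forall>c<b (Suc i). z c - (\<Sum>j<b (Suc (Suc i)). u j * r (Suc i) j c) \<in> N)"
        unfolding z by (rule mat_image_iff) (simp add: d_def)
      also have "\<dots> \<longleftrightarrow> (\<forall>c<b i. (\<Sum>j<b (Suc i). z j * r i j c) \<in> N)"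
        using br(5)[THEN spec, of i, unfolded F.syz_def, THEN spec, of z] by (rule sym)
      also have "\<dots> \<longleftrightarrow> x \<in> mat_kernel ?A (b (Suc i)) (b i) (d i)"
        unfolding z by (rule mat_kernel_iff[symmetric]) (simp add: d_def)
      finally show ?thesis .
    next
      case False
      then show ?thesis using mat_image_free[of "b (Suc (Suc i))" "b (Suc i)" "d (Suc i)" "r (Suc i)" x]
        by (auto simp: d_def mat_kernel_def)
    qed
    then show "mat_image ?A (b (Suc (Suc i))) (b (Suc i)) (d (Suc i)) = mat_kernel ?A (b (Suc i)) (b i) (d i)"
      by blast
  qed
  then show ?thesis unfolding koszul_def by blast
qed

end


section \<open>The theorem\<close>

theorem theorem4p9:
  fixes n :: nat and indep :: "nat set \<Rightarrow> bool" and prec :: "nat rel"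
  assumes "simple_matroid {1..n} indep"
    and "linear_order_on {1..n} prec"
    and "pairwise disjnt (minimal_broken_circuits {1..n} indep prec)"
  shows "OS_poincare TYPE('k::field) n indep =
           [:1, 1:] ^ (n - (\<Sum>Q\<in>minimal_broken_circuits {1..n} indep prec. card Q)) *
           (\<Prod>Q\<in>minimal_broken_circuits {1..n} indep prec.
              [:1, 1:] ^ card Q - [:0, 1:] ^ card Q)
         \<and>
         (factors_completely (OS_poincare TYPE('k) n indep) \<longleftrightarrow>
            (\<forall>Q\<in>minimal_broken_circuits {1..n} indep prec. card Q = 2)) \<and>
         ((\<forall>Q\<in>minimal_broken_circuits {1..n} indep prec. card Q = 2) \<longleftrightarrow>
            supersolvable {1..n} indep) \<and>
         (supersolvable {1..n} indep \<longleftrightarrow>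
            koszul (OS_algebra n indep :: (nat set \<Rightarrow> 'k) set ring) (OS_homogeneous n indep))"
proof -
  interpret ordered_orlik_solomon n indep prec
    using assms(1,2)
    by (auto simp: simple_matroid_def ordered_orlik_solomon_def ordered_orlik_solomon_axioms_def
        orlik_solomon_def simple_matroid_locale_def simple_matroid_locale_axioms_def)
  let ?A = "A :: (nat set \<Rightarrow> 'k) set ring"
  let ?two = "\<forall>Q\<in>MBC. card Q = 2"
  note disj = assms(3)
  have formula: "OS_poincare TYPE('k) n indep =
      [:1, 1:] ^ (n - (\<Sum>Q\<in>MBC. card Q)) * (\<Prod>Q\<in>MBC. [:1, 1:] ^ card Q - [:0, 1:] ^ card Q)"
    by (rule poincare_formula[OF disj])
  moreover have "factors_completely (OS_poincare TYPE('k) n indep) \<longleftrightarrow> ?two"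
    unfolding formula
    by (rule factors_completely_iff[OF finite_MBC broken_circuit_bounds(2)[OF MBC_broken]])
  moreover have "Defs.supersolvable {1..n} indep \<and> koszul ?A (OS_homogeneous n indep)" if two: ?two
  proof -
    interpret F: fibration "{1..n}" indep "\<lambda>x. pos (mu x)" by (rule fibration_pos_mu[OF disj two])
    interpret G: fibred_orlik_solomon n indep "\<lambda>x. pos (mu x)" ..
    show ?thesis using F.supersolvable G.koszul by blast
  qed
  ultimately show ?thesis
    using supersolvable_imp_two[OF disj] koszul_imp_two[OF disj, where 'k='k] by blast
qed

end
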